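(* Let $D$ be a DEFiM. Then $D$ is sensible for the $\lambda$-calculus with $D$-tests $\Lambda_{\tau(D)}$ if and only if there exists an $S$-realizer of $D$, i.e. a function $R$ from $D$ to saturated sets of terms of $\Lambda_{\tau(D)}$ such that for all $\alpha,\beta\in D$: $R(\alpha\wedge\beta)=R(\alpha)\cap R(\beta)$, $R(\alpha\to\beta)=R(\alpha)\mapsto R(\beta)$, $R(\omega)=\Lambda_{\tau(D)}$, and $\mathcal N^-_\alpha\subseteq R(\alpha)\subseteq\mathcal N^+_\alpha$ for every $\alpha\neq\omega$.
   Context: Filter models. A filter model is a triple $(D,\wedge,\to)$ where $(D,\wedge)$ is a meet-semilattice with top $\omega$ ($\alpha\ge_D\beta$ iff $\alpha\wedge\beta=\beta$) and $\to$ is a binary operation with: for every finite family $(\alpha_i,\beta_i)_i$ and all $\gamma,\delta$, $\gamma\to\delta\ge_D\bigwedge_i(\alpha_i\to\beta_i)$ iff $\delta\ge_D\bigwedge_{\{i\mid\gamma\le_D\alpha_i\}}\beta_i$ (empty meet $=\omega$). Extensional: a function $\mathrm{ext}_D$ gives each $\alpha$ a finite $\mathrm{ext}_D(\alpha)\subseteq D\times D$ with $\alpha=\bigwedge_{(\beta,\gamma)\in\mathrm{ext}_D(\alpha)}(\beta\to\gamma)$. Distributive: whenever $\alpha\ge_D\beta\wedge\gamma$ there are $\beta'\ge_D\beta,\gamma'\ge_D\gamma$ with $\alpha=\beta'\wedge\gamma'$. DEFiM = distributive extensional filter model with fixed $\mathrm{ext}_D$. Calculus $\Lambda_{\tau(D)}$: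 terms $M::=x\mid\lambda x.M\mid MN\mid\sum_{i\le n}\bar\tau_{\alpha_i}(Q_i)$, tests $Q::=\sum_{i\le n}Q_i\mid\prod_{i\le n}Q_i\mid\tau_\alpha(M)$ ($\alpha,\alpha_i\in D\setminus\{\omega\}$, $n\ge0$); sums/products are finite multisets, empty sum $\mathbf 0$, empty product $\epsilon$, $\bar\epsilon_\alpha:=\bar\tau_\alpha(\epsilon)$, $\tau_\omega(M):=\epsilon$, $\bar\epsilon_\omega:=\mathbf 0$. Rules: $(\lambda x.M)N\to M[N/x]$; $(\sum_i\bar\tau_{\alpha_i}(Q_i))N\to\sum_i\sum_{(\beta,\gamma)\in\mathrm{ext}_D(\alpha_i)}\bar\tau_\gamma(Q_i\cdot\tau_\beta(N))$; $\tau_\alpha(\lambda x.M)\to\prod_{(\beta,\gamma)\in\mathrm{ext}_D(\alpha)}\tau_\gamma(M[\bar\epsilon_\beta/x])$; $\tau_\alpha(\sum_{i\in I}\bar\tau_{\beta_i}(Q_i))\to\sum_{\{I'\subseteq I\mid\alpha\ge_D\bigwedge_{i\in I'}\beta_i\}}\prod_{i\in I'}Q_i$; $\prod_{i}\sum_{j\le k_i}Q_{i,j}\to\sum_{j_1,\dots,j_n}\prod_iQ_{i,j_i}$; $\bar\tau_\alpha(\sum_iQ_i)\to\sum_i\bar\tau_\alpha(Q_i)$. Full reduction $\to$: closure under all constructors. Head reduction $\to_h$: closure of the rules under $\lambda x.[\cdot]$; $[\cdot]N$ and $\tau_\alpha([\cdot])$ when the reduced term is an application; $\bar\tau_\alpha([\cdot])$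 and $[\cdot]\cdot P$ when the reduced test is not a sum; $[\cdot]+N$ for terms and $[\cdot]+P$ for tests. May-head-normal forms: tests $\prod_i\tau_{\alpha_i}(x_iM_i^1\cdots M_i^{n_i})+Q$; terms $\lambda x_1..x_n.y\,M_1\cdots M_m$ or $\lambda x_1..x_n.\bar\tau_\alpha(Q)+N$ with $\alpha\neq\omega$, $Q$ a head-normal test without sums. $\Downarrow$: head-reduces to a may-head-normal form; $\Uparrow$: not $\Downarrow$. Interpretation: $[\![x_i]\!]^{\vec x}=\{(\vec\alpha,\beta)\mid\beta\ge_D\alpha_i\}$; $[\![\lambda y.M]\!]^{\vec x}=\{(\vec\alpha,\bigwedge_i(\beta_i\to\gamma_i))\mid\forall i,(\vec\alpha\beta_i,\gamma_i)\in[\![M]\!]^{\vec xy}\}$; $[\![MN]\!]^{\vec x}=\{(\vec\alpha,\bigwedge_i\beta_i)\mid\exists(\gamma_i)_i,(\vec\alpha,\bigwedge_i(\gamma_i\to\beta_i))\in[\![M]\!]^{\vec x},(\vec\alpha,\bigwedge_i\gamma_i)\in[\![N]\!]^{\vec x}\}$; $[\![\sum_{i\in J}\bar\tau_{\alpha_i}(Q_i)]\!]^{\vec x}=\{(\vec\beta,\gamma)\mid\exists I\subseteq J,\vec\beta\in\bigcap_{i\in I}[\![Q_i]\!]^{\vec x},\gamma\ge_D\bigwedge_{i\in I}\alpha_i\}$; $[\![\tau_\alpha(M)]\!]^{\vec x}=\{\vec\beta\mid(\vec\beta,\alpha)\in[\![M]\!]^{\vec x}\}$; products of tests are intersections ($[\![\epsilon]\!]=D^{\vec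 x}$), sums of tests unions ($[\![\mathbf 0]\!]=\emptyset$). $D$ is sensible for $\Lambda_{\tau(D)}$ if for all terms $M$ and tests $Q$: $M\Uparrow$ iff $[\![M]\!]^{\vec x}=\{(\vec\alpha,\omega)\mid\vec\alpha\}$, and $Q\Uparrow$ iff $[\![Q]\!]^{\vec x}=\emptyset$. Realizers. A saturated set is a set of terms of $\Lambda_{\tau(D)}$ closed under backward reduction (if $M\to N$ and $N$ is in the set, so is $M$). For sets $S,T$ of terms, $S\mapsto T:=\{M\mid\forall N\in S,\ MN\in T\}$. For $\alpha\in D\setminus\{\omega\}$: $\mathcal N^+_\alpha:=\{M\in\Lambda_{\tau(D)}\mid\forall\beta\ge_D\alpha,\ \tau_\beta(M)\Downarrow\}$ and $\mathcal N^-_\alpha:=\{\sum_i\bar\epsilon_{\beta_i}+L\mid\alpha\ge_D\bigwedge_i\beta_i,\ L\in\Lambda_{\tau(D)}\}$.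
   Formalization: D is additionally assumed to contain an element other than ω; for the one-point D = {ω} the equivalence fails, since R(ω) = all terms is an S-realizer while the variable x converges with interpretation {(α, ω)}. *)

theory Defs
  imports Main "HOL-Library.Multiset"
begin

section \<open>Filter models\<close>

text \<open>A meet-semilattice with top is a type of class \<^class>\<open>bounded_semilattice_inf_top\<close>: the meet
  is \<^const>\<open>inf\<close>, the top element (omega) is \<^const>\<open>top\<close>, and \<open>\<alpha> \<ge> \<beta>\<close> iff \<open>inf \<alpha> \<beta> = \<beta>\<close>.
  As meets are idempotent, a finite family of pairs only matters through its finite set of
  values, so meets of finite families are taken over finite sets.\<close>

definition Meet :: "'d::bounded_semilattice_inf_top set \<Rightarrow> 'd" where
  "Meet A = Finite_Set.fold inf top A"

definition arrows :: "('d \<Rightarrow> 'd \<Rightarrow> 'd) \<Rightarrow> ('d \<times> 'd) set \<Rightarrow> 'd::bounded_semilattice_inf_top" where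
  "arrows arr P = Meet ((\<lambda>(\<beta>, \<gamma>). arr \<beta> \<gamma>) ` P)"

definition filter_model :: "('d::bounded_semilattice_inf_top \<Rightarrow> 'd \<Rightarrow> 'd) \<Rightarrow> bool" where
  "filter_model arr \<longleftrightarrow>
     (\<forall>P \<gamma> \<delta>. finite P \<longrightarrow>
        (arr \<gamma> \<delta> \<ge> arrows arr P \<longleftrightarrow> \<delta> \<ge> Meet {\<beta> |\<alpha> \<beta>. (\<alpha>, \<beta>) \<in> P \<and> \<gamma> \<le> \<alpha>}))"

definition extensional_by ::
  "('d::bounded_semilattice_inf_top \<Rightarrow> 'd \<Rightarrow> 'd) \<Rightarrow> ('d \<Rightarrow> ('d \<times> 'd) set) \<Rightarrow> bool" where
  "extensional_by arr ext \<longleftrightarrow> (\<forall>\<alpha>. finite (ext \<alpha>) \<and> \<alpha> = arrows arr (ext \<alpha>))"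

definition distributive_model :: "'d::bounded_semilattice_inf_top itself \<Rightarrow> bool" where
  "distributive_model _ \<longleftrightarrow>
     (\<forall>\<alpha> \<beta> \<gamma> :: 'd. \<alpha> \<ge> inf \<beta> \<gamma> \<longrightarrow> (\<exists>\<beta>' \<gamma>'. \<beta>' \<ge> \<beta> \<and> \<gamma>' \<ge> \<gamma> \<and> \<alpha> = inf \<beta>' \<gamma>'))"

definition DEFiM ::
  "('d::bounded_semilattice_inf_top \<Rightarrow> 'd \<Rightarrow> 'd) \<Rightarrow> ('d \<Rightarrow> ('d \<times> 'd) set) \<Rightarrow> bool" where
  "DEFiM arr ext \<longleftrightarrow>
     filter_model arr \<and> extensional_by arr ext \<and> distributive_model TYPE('d)"


section \<open>Terms and tests\<close>

text \<open>De Bruijn syntax. \<open>TSum {#(\<alpha>\<^sub>1, Q\<^sub>1), \<dots>#}\<close> is the sum of the terms bar-tau of index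
  \<open>\<alpha>\<^sub>i\<close> applied to \<open>Q\<^sub>i\<close>; in particular \<open>TSum {#}\<close> is the term \<open>0\<close>.

  Sums and products of tests are taken up to associativity, commutativity and neutrality of the
  empty sum and product. The classes of that equivalence are represented by canonical
  forms: a sum (product) has no sum (product) among its immediate components and does not have
  exactly one component. The predicates \<open>wf_trm\<close>, \<open>wf_tst\<close> select the canonical forms whose
  indices all differ from omega; these are the terms and the tests of the calculus.\<close>

datatype 'd trm =
    Var nat
  | Lam "'d trm"
  | is_App: App "'d trm" "'d trm"
  | TSum "('d \<times> 'd tst) multiset"
and 'd tst =
    Tau 'd "'d trm"
  | is_QSum: QSum "'d tst multiset"
  | is_QProd: QProd "'d tst multiset"

primrec wf_trm :: "'d::bounded_semilattice_inf_top trm \<Rightarrow> bool"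
  and wf_tst :: "'d tst \<Rightarrow> bool" where
  "wf_trm (Var i) \<longleftrightarrow> True"
| "wf_trm (Lam M) \<longleftrightarrow> wf_trm M"
| "wf_trm (App M N) \<longleftrightarrow> wf_trm M \<and> wf_trm N"
| "wf_trm (TSum A) \<longleftrightarrow> (\<forall>(\<alpha>, w) \<in># image_mset (map_prod id wf_tst) A. \<alpha> \<noteq> top \<and> w)"
| "wf_tst (Tau \<alpha> M) \<longleftrightarrow> \<alpha> \<noteq> top \<and> wf_trm M"
| "wf_tst (QSum A) \<longleftrightarrow> size A \<noteq> 1 \<and> (\<forall>Q \<in># A. \<not> is_QSum Q) \<and> (\<forall>w \<in># image_mset wf_tst A. w)"
| "wf_tst (QProd A) \<longleftrightarrow> size A \<noteq> 1 \<and> (\<forall>Q \<in># A. \<not> is_QProd Q) \<and> (\<forall>w \<in># image_mset wf_tst A. w)"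

definition Terms :: "'d::bounded_semilattice_inf_top trm set" where
  "Terms = {M. wf_trm M}"

definition Tests :: "'d::bounded_semilattice_inf_top tst set" where
  "Tests = {Q. wf_tst Q}"

primrec fv_trm :: "'d trm \<Rightarrow> nat set" and fv_tst :: "'d tst \<Rightarrow> nat set" where
  "fv_trm (Var i) = {i}"
| "fv_trm (Lam M) = {i. Suc i \<in> fv_trm M}"
| "fv_trm (App M N) = fv_trm M \<union> fv_trm N"
| "fv_trm (TSum A) = \<Union> (snd ` set_mset (image_mset (map_prod id fv_tst) A))"
| "fv_tst (Tau \<alpha> M) = fv_trm M"
| "fv_tst (QSum A) = \<Union> (set_mset (image_mset fv_tst A))"
| "fv_tst (QProd A) = \<Union> (set_mset (image_mset fv_tst A))"

primrec lift_trm :: "'d trm \<Rightarrow> nat \<Rightarrow> 'd trm" and lift_tst :: "'d tst \<Rightarrow> nat \<Rightarrow> 'd tst" where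
  "lift_trm (Var i) k = Var (if i < k then i else Suc i)"
| "lift_trm (Lam M) k = Lam (lift_trm M (Suc k))"
| "lift_trm (App M N) k = App (lift_trm M k) (lift_trm N k)"
| "lift_trm (TSum A) k = TSum (image_mset (map_prod id (\<lambda>Q. lift_tst Q k)) A)"
| "lift_tst (Tau \<alpha> M) k = Tau \<alpha> (lift_trm M k)"
| "lift_tst (QSum A) k = QSum (image_mset (\<lambda>Q. lift_tst Q k) A)"
| "lift_tst (QProd A) k = QProd (image_mset (\<lambda>Q. lift_tst Q k) A)"

text \<open>\<open>subst_trm M k N\<close> replaces the variable \<open>k\<close> by \<open>N\<close> and lowers the variables above \<open>k\<close>.\<close>

primrec subst_trm :: "'d trm \<Rightarrow> nat \<Rightarrow> 'd trm \<Rightarrow> 'd trm"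
  and subst_tst :: "'d tst \<Rightarrow> nat \<Rightarrow> 'd trm \<Rightarrow> 'd tst" where
  "subst_trm (Var i) k N = (if i < k then Var i else if i = k then N else Var (i - 1))"
| "subst_trm (Lam M) k N = Lam (subst_trm M (Suc k) (lift_trm N 0))"
| "subst_trm (App M L) k N = App (subst_trm M k N) (subst_trm L k N)"
| "subst_trm (TSum A) k N = TSum (image_mset (map_prod id (\<lambda>Q. subst_tst Q k N)) A)"
| "subst_tst (Tau \<alpha> M) k N = Tau \<alpha> (subst_trm M k N)"
| "subst_tst (QSum A) k N = QSum (image_mset (\<lambda>Q. subst_tst Q k N) A)"
| "subst_tst (QProd A) k N = QProd (image_mset (\<lambda>Q. subst_tst Q k N) A)"

text \<open>Sums and products of a multiset of tests, as operations on canonical forms.\<close>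

definition summands :: "'d tst \<Rightarrow> 'd tst multiset" where
  "summands Q = (case Q of QSum A \<Rightarrow> A | _ \<Rightarrow> {#Q#})"

definition factors :: "'d tst \<Rightarrow> 'd tst multiset" where
  "factors Q = (case Q of QProd A \<Rightarrow> A | _ \<Rightarrow> {#Q#})"

definition qsum :: "'d tst multiset \<Rightarrow> 'd tst" where
  "qsum A = (let B = (\<Sum>Q\<in>#A. summands Q) in
     if size B = 1 then (THE Q. B = {#Q#}) else QSum B)"

definition qprod :: "'d tst multiset \<Rightarrow> 'd tst" where
  "qprod A = (let B = (\<Sum>Q\<in>#A. factors Q) in
     if size B = 1 then (THE Q. B = {#Q#}) else QProd B)"

abbreviation qplus :: "'d tst \<Rightarrow> 'd tst \<Rightarrow> 'd tst" where
  "qplus P Q \<equiv> qsum {#P, Q#}"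

abbreviation qtimes :: "'d tst \<Rightarrow> 'd tst \<Rightarrow> 'd tst" where
  "qtimes P Q \<equiv> qprod {#P, Q#}"

text \<open>Conventions for the index omega: \<open>tau \<omega> M\<close> is the empty product, and a summand
  bar-tau of index omega is the empty sum (as for bar-epsilon of index omega, whatever its test).
  Such summands arise in reduction because \<open>ext \<alpha>\<close> may contain pairs \<open>(\<beta>, \<omega>)\<close>.\<close>

definition tau :: "'d::bounded_semilattice_inf_top \<Rightarrow> 'd trm \<Rightarrow> 'd tst" where
  "tau \<alpha> M = (if \<alpha> = top then QProd {#} else Tau \<alpha> M)"

definition bartau ::
  "'d::bounded_semilattice_inf_top \<Rightarrow> 'd tst \<Rightarrow> ('d \<times> 'd tst) multiset" where
  "bartau \<alpha> Q = (if \<alpha> = top then {#} else {#(\<alpha>, Q)#})"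

definition bareps :: "'d::bounded_semilattice_inf_top \<Rightarrow> ('d \<times> 'd tst) multiset" where
  "bareps \<alpha> = bartau \<alpha> (QProd {#})"


section \<open>Reduction\<close>

text \<open>In \<open>tau_sum\<close> the subfamilies \<open>I'\<close> of the summed family are subsets of the positions of an
  enumeration \<open>xs\<close> of it. In \<open>prod_sum\<close> a factor that is not a sum counts as the sum of itself; the
  identity instances, in which no factor is a sum, are left out.

  In the contexts \<open>[\<cdot>] + P\<close> and \<open>[\<cdot>] \<cdot> P\<close> the canonical form of the compound test is taken
  before and after the step; \<open>Q \<in> Tests\<close> and \<open>P \<in> Tests\<close> only exclude decompositions into
  data that are not canonical.\<close>

inductive rule_trm ::
  "('d::bounded_semilattice_inf_top \<Rightarrow> ('d \<times> 'd) set) \<Rightarrow> 'd trm \<Rightarrow> 'd trm \<Rightarrow> bool"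
  for ext where
  beta: "rule_trm ext (App (Lam M) N) (subst_trm M 0 N)"
| sum_app: "rule_trm ext (App (TSum A) N)
     (TSum (\<Sum>(\<alpha>, Q)\<in>#A. \<Sum>(\<beta>, \<gamma>)\<in>#mset_set (ext \<alpha>). bartau \<gamma> (qtimes Q (tau \<beta> N))))"
| bartau_sum: "rule_trm ext (TSum {#(\<alpha>, QSum A)#}) (TSum {#(\<alpha>, Q). Q \<in># A#})"

inductive rule_tst ::
  "('d::bounded_semilattice_inf_top \<Rightarrow> ('d \<times> 'd) set) \<Rightarrow> 'd tst \<Rightarrow> 'd tst \<Rightarrow> bool"
  for ext where
  tau_lam: "rule_tst ext (Tau \<alpha> (Lam M))
     (qprod {#tau \<gamma> (subst_trm M 0 (TSum (bareps \<beta>))). (\<beta>, \<gamma>) \<in># mset_set (ext \<alpha>)#})"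
| tau_sum: "rule_tst ext (Tau \<alpha> (TSum (mset xs)))
     (qsum {#qprod {#snd (xs ! i). i \<in># mset_set I#}.
        I \<in># mset_set {I. I \<subseteq> {..<length xs} \<and> \<alpha> \<ge> Meet ((\<lambda>i. fst (xs ! i)) ` I)}#})"
| prod_sum: "list_all2 (\<lambda>Q qs. summands Q = mset qs) Qs qss \<Longrightarrow> \<exists>Q\<in>set Qs. is_QSum Q \<Longrightarrow>
     rule_tst ext (QProd (mset Qs)) (qsum (mset (map (\<lambda>qs. qprod (mset qs)) (product_lists qss))))"

inductive red_trm ::
    "('d::bounded_semilattice_inf_top \<Rightarrow> ('d \<times> 'd) set) \<Rightarrow> 'd trm \<Rightarrow> 'd trm \<Rightarrow> bool"
  and red_tst ::
    "('d \<Rightarrow> ('d \<times> 'd) set) \<Rightarrow> 'd tst \<Rightarrow> 'd tst \<Rightarrow> bool"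
  for ext where
  "rule_trm ext M M' \<Longrightarrow> red_trm ext M M'"
| "red_trm ext M M' \<Longrightarrow> red_trm ext (Lam M) (Lam M')"
| "red_trm ext M M' \<Longrightarrow> red_trm ext (App M N) (App M' N)"
| "red_trm ext N N' \<Longrightarrow> red_trm ext (App M N) (App M N')"
| "red_tst ext Q Q' \<Longrightarrow> red_trm ext (TSum {#(\<alpha>, Q)#}) (TSum {#(\<alpha>, Q')#})"
| "red_trm ext (TSum A) (TSum A') \<Longrightarrow> red_trm ext (TSum (A + B)) (TSum (A' + B))"
| "rule_tst ext Q Q' \<Longrightarrow> red_tst ext Q Q'"
| "red_trm ext M M' \<Longrightarrow> red_tst ext (Tau \<alpha> M) (Tau \<alpha> M')"
| "red_tst ext Q Q' \<Longrightarrow> Q \<in> Tests \<Longrightarrow> P \<in> Tests \<Longrightarrow>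
     red_tst ext (qplus Q P) (qplus Q' P)"
| "red_tst ext Q Q' \<Longrightarrow> Q \<in> Tests \<Longrightarrow> P \<in> Tests \<Longrightarrow>
     red_tst ext (qtimes Q P) (qtimes Q' P)"

inductive hred_trm ::
    "('d::bounded_semilattice_inf_top \<Rightarrow> ('d \<times> 'd) set) \<Rightarrow> 'd trm \<Rightarrow> 'd trm \<Rightarrow> bool"
  and hred_tst ::
    "('d \<Rightarrow> ('d \<times> 'd) set) \<Rightarrow> 'd tst \<Rightarrow> 'd tst \<Rightarrow> bool"
  for ext where
  "rule_trm ext M M' \<Longrightarrow> hred_trm ext M M'"
| "hred_trm ext M M' \<Longrightarrow> hred_trm ext (Lam M) (Lam M')"
| "hred_trm ext M M' \<Longrightarrow> is_App M \<Longrightarrow> hred_trm ext (App M N) (App M' N)"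
| "hred_tst ext Q Q' \<Longrightarrow> \<not> is_QSum Q \<Longrightarrow> hred_trm ext (TSum {#(\<alpha>, Q)#}) (TSum {#(\<alpha>, Q')#})"
| "hred_trm ext (TSum A) (TSum A') \<Longrightarrow> hred_trm ext (TSum (A + B)) (TSum (A' + B))"
| "rule_tst ext Q Q' \<Longrightarrow> hred_tst ext Q Q'"
| "hred_trm ext M M' \<Longrightarrow> is_App M \<Longrightarrow> hred_tst ext (Tau \<alpha> M) (Tau \<alpha> M')"
| "hred_tst ext Q Q' \<Longrightarrow> Q \<in> Tests \<Longrightarrow> P \<in> Tests \<Longrightarrow>
     hred_tst ext (qplus Q P) (qplus Q' P)"
| "hred_tst ext Q Q' \<Longrightarrow> \<not> is_QSum Q \<Longrightarrow> Q \<in> Tests \<Longrightarrow> P \<in> Tests \<Longrightarrow>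
     hred_tst ext (qtimes Q P) (qtimes Q' P)"

text \<open>\<open>hn_prod Q\<close>: the test \<open>Q\<close> is a product of tests \<open>\<tau>\<^bsub>\<alpha>\<^esub>(x M\<^sub>1 \<dots> M\<^sub>n)\<close>, i.e. a head-normal test
  without sums.\<close>

definition hn_prod :: "'d tst \<Rightarrow> bool" where
  "hn_prod Q \<longleftrightarrow>
     (\<exists>A. Q = qprod A \<and> (\<forall>P \<in># A. \<exists>\<alpha> x Ms. P = Tau \<alpha> (foldl App (Var x) Ms)))"

definition mhnf_tst :: "'d tst \<Rightarrow> bool" where
  "mhnf_tst Q \<longleftrightarrow> (\<exists>Q\<^sub>0 P. hn_prod Q\<^sub>0 \<and> Q = qplus Q\<^sub>0 P)"

definition mhnf_trm :: "'d::bounded_semilattice_inf_top trm \<Rightarrow> bool" where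
  "mhnf_trm M \<longleftrightarrow>
     (\<exists>n y Ms. M = (Lam ^^ n) (foldl App (Var y) Ms)) \<or>
     (\<exists>n \<alpha> Q B. M = (Lam ^^ n) (TSum ({#(\<alpha>, Q)#} + B)) \<and> \<alpha> \<noteq> top \<and> hn_prod Q)"

definition converges_trm ::
  "('d::bounded_semilattice_inf_top \<Rightarrow> ('d \<times> 'd) set) \<Rightarrow> 'd trm \<Rightarrow> bool" where
  "converges_trm ext M \<longleftrightarrow> (\<exists>N. (hred_trm ext)\<^sup>*\<^sup>* M N \<and> mhnf_trm N)"

definition converges_tst ::
  "('d::bounded_semilattice_inf_top \<Rightarrow> ('d \<times> 'd) set) \<Rightarrow> 'd tst \<Rightarrow> bool" where
  "converges_tst ext Q \<longleftrightarrow> (\<exists>P. (hred_tst ext)\<^sup>*\<^sup>* Q P \<and> mhnf_tst P)"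


section \<open>Interpretation\<close>

text \<open>\<open>sem_trm arr M n\<close> is the interpretation of \<open>M\<close> in a context of \<open>n\<close> variables, meaningful when
  the free variables of \<open>M\<close> are below \<open>n\<close>. Environments are lists of length \<open>n\<close>, whose head is the
  value of the innermost variable.\<close>

primrec sem_trm ::
    "('d::bounded_semilattice_inf_top \<Rightarrow> 'd \<Rightarrow> 'd) \<Rightarrow> 'd trm \<Rightarrow> nat \<Rightarrow> ('d list \<times> 'd) set"
  and sem_tst ::
    "('d \<Rightarrow> 'd \<Rightarrow> 'd) \<Rightarrow> 'd tst \<Rightarrow> nat \<Rightarrow> 'd list set" where
  "sem_trm arr (Var i) n = {(as, \<beta>). length as = n \<and> i < n \<and> \<beta> \<ge> as ! i}"
| "sem_trm arr (Lam M) n = {(as, arrows arr P) |as P.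
     length as = n \<and> finite P \<and> (\<forall>(\<beta>, \<gamma>) \<in> P. (\<beta> # as, \<gamma>) \<in> sem_trm arr M (Suc n))}"
| "sem_trm arr (App M N) n = {(as, Meet (snd ` P)) |as P.
     length as = n \<and> finite P \<and> (as, arrows arr P) \<in> sem_trm arr M n \<and>
     (as, Meet (fst ` P)) \<in> sem_trm arr N n}"
| "sem_trm arr (TSum A) n = {(bs, \<gamma>). length bs = n \<and>
     (\<exists>B. B \<subseteq># image_mset (map_prod id (\<lambda>Q. sem_tst arr Q n)) A \<and>
        (\<forall>(\<alpha>, S) \<in># B. bs \<in> S) \<and> \<gamma> \<ge> Meet (fst ` set_mset B))}"
| "sem_tst arr (Tau \<alpha> M) n = {bs. (bs, \<alpha>) \<in> sem_trm arr M n}"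
| "sem_tst arr (QProd A) n =
     {bs. length bs = n \<and> (\<forall>S \<in># image_mset (\<lambda>Q. sem_tst arr Q n) A. bs \<in> S)}"
| "sem_tst arr (QSum A) n = \<Union> (set_mset (image_mset (\<lambda>Q. sem_tst arr Q n) A))"

definition sensible ::
  "('d::bounded_semilattice_inf_top \<Rightarrow> 'd \<Rightarrow> 'd) \<Rightarrow> ('d \<Rightarrow> ('d \<times> 'd) set) \<Rightarrow> bool" where
  "sensible arr ext \<longleftrightarrow>
     (\<forall>M \<in> Terms. \<forall>n. fv_trm M \<subseteq> {..<n} \<longrightarrow>
        (\<not> converges_trm ext M \<longleftrightarrow> sem_trm arr M n = {(as, top) |as. length as = n})) \<and>
     (\<forall>Q \<in> Tests. \<forall>n. fv_tst Q \<subseteq> {..<n} \<longrightarrow>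
        (\<not> converges_tst ext Q \<longleftrightarrow> sem_tst arr Q n = {}))"


section \<open>Realizers\<close>

definition saturated ::
  "('d::bounded_semilattice_inf_top \<Rightarrow> ('d \<times> 'd) set) \<Rightarrow> 'd trm set \<Rightarrow> bool" where
  "saturated ext S \<longleftrightarrow>
     S \<subseteq> Terms \<and> (\<forall>M \<in> Terms. \<forall>N. red_trm ext M N \<longrightarrow> N \<in> S \<longrightarrow> M \<in> S)"

definition fun_space ::
  "'d::bounded_semilattice_inf_top trm set \<Rightarrow> 'd trm set \<Rightarrow> 'd trm set" where
  "fun_space S T = {M \<in> Terms. \<forall>N \<in> S. App M N \<in> T}"

definition N_pos ::
  "('d::bounded_semilattice_inf_top \<Rightarrow> ('d \<times> 'd) set) \<Rightarrow> 'd \<Rightarrow> 'd trm set" where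
  "N_pos ext \<alpha> = {M \<in> Terms. \<forall>\<beta> \<ge> \<alpha>. converges_tst ext (tau \<beta> M)}"

text \<open>Only sums of bar-tau can be added, so the remaining summand \<open>L\<close> is a term \<open>TSum B\<close>.\<close>

definition N_neg :: "'d::bounded_semilattice_inf_top \<Rightarrow> 'd trm set" where
  "N_neg \<alpha> = {TSum ((\<Sum>\<beta>\<in>#b. bareps \<beta>) + B) |b B. \<alpha> \<ge> Meet (set_mset b) \<and> TSum B \<in> Terms}"

definition S_realizer ::
  "('d::bounded_semilattice_inf_top \<Rightarrow> 'd \<Rightarrow> 'd) \<Rightarrow> ('d \<Rightarrow> ('d \<times> 'd) set) \<Rightarrow>
     ('d \<Rightarrow> 'd trm set) \<Rightarrow> bool" where
  "S_realizer arr ext R \<longleftrightarrow>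
     (\<forall>\<alpha>. saturated ext (R \<alpha>)) \<and>
     (\<forall>\<alpha> \<beta>. R (inf \<alpha> \<beta>) = R \<alpha> \<inter> R \<beta>) \<and>
     (\<forall>\<alpha> \<beta>. R (arr \<alpha> \<beta>) = fun_space (R \<alpha>) (R \<beta>)) \<and>
     R top = Terms \<and>
     (\<forall>\<alpha>. \<alpha> \<noteq> top \<longrightarrow> N_neg \<alpha> \<subseteq> R \<alpha> \<and> R \<alpha> \<subseteq> N_pos ext \<alpha>)"

end

theory Submission
  imports Defs
begin

text \<open>From sensibility to a realizer: \<open>R \<alpha>\<close> is the set of the terms whose interpretation has type \<open>\<alpha>\<close>
  in every environment. Interpretations do not grow along reduction (subject expansion),
  so \<open>R \<alpha>\<close> is saturated.

  From a realizer to sensibility, the usual adequacy proof breaks down at a sum of bar-taus under an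
  abstraction: a realizer may contain open terms \<open>N\<close> and need not be closed under forward
  reduction, so \<open>N \<in> R \<beta>\<close> does not put bar-tau of index \<open>\<alpha>\<close> applied to \<open>\<tau>\<^bsub>\<beta>\<^esub>(N)\<close> into
  \<open>R \<alpha>\<close>. It does put the application of bar-epsilon of index \<open>\<beta> \<rightarrow> \<alpha>\<close> to \<open>N\<close> into \<open>R \<alpha>\<close>. Hence a term
  \<open>M\<close> is first translated to a term \<open>P\<close> in which all tests are coded by applications of
  bar-epsilons. Adequacy holds for \<open>P\<close>, and \<open>M\<close> simulates \<open>P\<close>, so that convergence of \<open>P\<close>
  carries over to \<open>M\<close>. The remaining inclusion, that converging terms and tests have a nontrivial
  interpretation, is subject expansion again.\<close>

section \<open>Finite meets and arrows\<close>

text \<open>The combinators of the coding come from \<open>N_neg\<close>: a sum of bar-epsilons lies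
  in \<open>R \<kappa>\<close> for each of its indices \<kappa>. As \<open>R\<close> sends arrows to
  function spaces, an index that is an iterated arrow makes such a sum act as a combinator of that
  type: \<alpha> \<rightarrow> ... \<rightarrow> \<alpha> \<rightarrow> \<alpha> codes a product of
  tests, and a sum of types that each look at a single argument codes a sum. The free variables of
  \<open>M\<close> are treated differently on the two sides. In \<open>P\<close> they become
  bar-epsilons of the types given by the environment, in \<open>M\<close> they stay; this does no
  harm, because a term headed by a free variable already is a may-head-normal form. Head reduction
  is awkward for the simulation, since a product over sums is distributed in one step that involves
  all factors. It is replaced by the indexed notion \<open>cv\<close>, which can be taken apart
  along products and sums, and the simulation is an induction on its index. Head expansion leads
  from convergence to \<open>cv\<close>; the way back needs a multiset order, as the factors of a
  product interact.\<close>

lemma Meet_empty [simp]: "Meet {} = top"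
  by (simp add: Meet_def)

lemma Meet_insert [simp]:
  fixes A :: "'d::bounded_semilattice_inf_top set"
  assumes "finite A"
  shows "Meet (insert a A) = inf a (Meet A)"
proof -
  interpret comp_fun_idem "inf :: 'd \<Rightarrow> 'd \<Rightarrow> 'd" by (fact comp_fun_idem_inf)
  show ?thesis by (simp add: Meet_def assms)
qed

lemma le_Meet_iff: "finite A \<Longrightarrow> x \<le> Meet A \<longleftrightarrow> (\<forall>a\<in>A. x \<le> a)"
  by (induction A rule: finite_induct) auto

lemma Meet_lower: "finite A \<Longrightarrow> a \<in> A \<Longrightarrow> Meet A \<le> a"
  using le_Meet_iff by blast

text \<open>Members \<open>top\<close> of \<open>B\<close> do not affect its meet. Exempting them
  matters because \<open>bartau\<close> and \<open>bareps\<close> drop the summands of index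
  \<open>top\<close>, so that such values have no counterpart in the family on the left.\<close>

lemma Meet_le_Meet:
  assumes "finite A" "finite B" "\<And>b. b \<in> B \<Longrightarrow> b \<noteq> top \<Longrightarrow> \<exists>a\<in>A. a \<le> b"
  shows "Meet A \<le> Meet B"
  using assms Meet_lower[OF assms(1)] order_trans
  by (fastforce simp: le_Meet_iff)

lemma Meet_antimono: "A \<subseteq> B \<Longrightarrow> finite B \<Longrightarrow> Meet B \<le> Meet A"
  by (rule Meet_le_Meet) (auto dest: finite_subset)

lemma Meet_Un: "finite A \<Longrightarrow> finite B \<Longrightarrow> Meet (A \<union> B) = inf (Meet A) (Meet B)"
  by (induction A rule: finite_induct) (auto simp: inf_assoc)

lemma Meet_eq_top_iff: "finite A \<Longrightarrow> Meet A = top \<longleftrightarrow> (\<forall>a\<in>A. a = top)"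
  using le_Meet_iff[of A top] by (simp add: top_unique)

lemma fv_Lam_subset_iff: "fv_trm (Lam M) \<subseteq> {..<n} \<longleftrightarrow> fv_trm M \<subseteq> {..<Suc n}"
proof
  assume *: "fv_trm (Lam M) \<subseteq> {..<n}"
  show "fv_trm M \<subseteq> {..<Suc n}"
  proof
    fix i assume "i \<in> fv_trm M"
    then show "i \<in> {..<Suc n}" using * by (cases i) auto
  qed
qed auto

lemma fv_TSum_subset_iff: "fv_trm (TSum A) \<subseteq> X \<longleftrightarrow> (\<forall>\<alpha> Q. (\<alpha>, Q) \<in># A \<longrightarrow> fv_tst Q \<subseteq> X)"
  by (fastforce simp: UN_subset_iff split_beta)

locale defim =
  fixes arr :: "'d::bounded_semilattice_inf_top \<Rightarrow> 'd \<Rightarrow> 'd"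
    and ext :: "'d \<Rightarrow> ('d \<times> 'd) set"
  assumes DEFiM: "DEFiM arr ext"
begin

lemma finite_ext [simp]: "finite (ext \<alpha>)"
  and arrows_ext: "arrows arr (ext \<alpha>) = \<alpha>"
  using DEFiM by (auto simp: DEFiM_def extensional_by_def)

lemma arrows_le_arr_iff:
  "finite P \<Longrightarrow> arrows arr P \<le> arr \<gamma> \<delta> \<longleftrightarrow> Meet {\<beta> |\<alpha> \<beta>. (\<alpha>, \<beta>) \<in> P \<and> \<gamma> \<le> \<alpha>} \<le> \<delta>"
  using DEFiM by (simp add: DEFiM_def filter_model_def)

lemma distributive: "inf \<beta> \<gamma> \<le> \<alpha> \<Longrightarrow> \<exists>\<beta>' \<gamma>'. \<beta> \<le> \<beta>' \<and> \<gamma> \<le> \<gamma>' \<and> \<alpha> = inf \<beta>' \<gamma>'"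
  for \<alpha> \<beta> \<gamma> :: 'd
  using DEFiM unfolding DEFiM_def distributive_model_def by blast

lemma finite_codomain: "finite P \<Longrightarrow> finite {\<beta> |\<alpha> \<beta>. (\<alpha>, \<beta>) \<in> P \<and> R \<alpha> \<beta>}"
  by (rule finite_subset[of _ "snd ` P"]) (auto intro: rev_image_eqI)

lemma le_arrows_iff: "finite P \<Longrightarrow> x \<le> arrows arr P \<longleftrightarrow> (\<forall>(\<alpha>, \<beta>)\<in>P. x \<le> arr \<alpha> \<beta>)"
  by (auto simp: arrows_def le_Meet_iff)

lemma arrows_lower: "finite P \<Longrightarrow> (\<alpha>, \<beta>) \<in> P \<Longrightarrow> arrows arr P \<le> arr \<alpha> \<beta>"
  using le_arrows_iff by blast

lemma arrows_empty [simp]: "arrows arr {} = top"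
  and arrows_single [simp]: "arrows arr {(\<alpha>, \<beta>)} = arr \<alpha> \<beta>"
  by (simp_all add: arrows_def)

lemma arrows_Un:
  "finite P \<Longrightarrow> finite P' \<Longrightarrow> arrows arr (P \<union> P') = inf (arrows arr P) (arrows arr P')"
  by (simp add: arrows_def image_Un Meet_Un)

lemma ext_le_arr: "(\<beta>, \<gamma>) \<in> ext \<alpha> \<Longrightarrow> \<alpha> \<le> arr \<beta> \<gamma>"
  using arrows_lower[of "ext \<alpha>"] by (simp add: arrows_ext)

lemma arr_top_iff [simp]: "arr \<gamma> \<delta> = top \<longleftrightarrow> \<delta> = top"
  using arrows_le_arr_iff[of "{}" \<gamma> \<delta>] by (simp add: top_unique)

text \<open>The filter model condition for a single pair. If \<open>\<gamma> \<le> \<alpha>\<close>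
  fails, the selected codomains form the empty set, with meet \<open>top\<close>, and this forces
  \<open>\<delta> = top\<close>.\<close>

lemma arr_le_arr_iff: "arr \<alpha> \<beta> \<le> arr \<gamma> \<delta> \<longleftrightarrow> \<delta> = top \<or> \<gamma> \<le> \<alpha> \<and> \<beta> \<le> \<delta>"
  using arrows_le_arr_iff[of "{(\<alpha>, \<beta>)}" \<gamma> \<delta>] by (cases "\<gamma> \<le> \<alpha>") (auto simp: top_unique)

text \<open>If all codomains were \<open>top\<close>, all arrows of \<open>ext \<alpha>\<close>
  would be \<open>top\<close> by \<open>arr_top_iff\<close>, and so would their meet
  \<alpha>.\<close>

lemma ext_nontop: "\<alpha> \<noteq> top \<Longrightarrow> \<exists>(\<beta>, \<gamma>)\<in>ext \<alpha>. \<gamma> \<noteq> top"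
  using le_arrows_iff[of "ext \<alpha>" top] by (auto simp: arrows_ext top_unique)

text \<open>Brings a meet of arbitrary types into the shape of a finite family of arrows, to which
  \<open>arrows_le_arr_iff\<close> applies.\<close>

lemma arrows_Union_ext_le:
  assumes "finite S" shows "arrows arr (\<Union>\<alpha>\<in>S. ext \<alpha>) \<le> Meet S"
proof -
  have fin: "finite (\<Union>\<alpha>\<in>S. ext \<alpha>)" using assms by simp
  have "arrows arr (\<Union>\<alpha>\<in>S. ext \<alpha>) \<le> \<alpha>" if "\<alpha> \<in> S" for \<alpha>
  proof -
    have "arrows arr (\<Union>\<alpha>\<in>S. ext \<alpha>) \<le> arrows arr (ext \<alpha>)"
      using that by (subst le_arrows_iff) (auto intro!: arrows_lower[OF fin])
    then show ?thesis by (simp add: arrows_ext)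
  qed
  then show ?thesis using le_Meet_iff[OF assms] by blast
qed

text \<open>Distributivity, iterated over a finite family. The first components are carried along
  because an application pairs every result type with an argument type: raising the results must
  leave the arguments in place.\<close>

lemma Meet_snd_split:
  fixes P :: "('c \<times> 'd) set"
  assumes "finite P" "Meet (snd ` P) \<le> \<beta>"
  shows "\<exists>P'. finite P' \<and> \<beta> = Meet (snd ` P') \<and> (\<forall>\<gamma> \<beta>'. (\<gamma>, \<beta>') \<in> P' \<longrightarrow> (\<exists>\<beta>''. (\<gamma>, \<beta>'') \<in> P \<and> \<beta>'' \<le> \<beta>'))"
  using assms
proof (induction P arbitrary: \<beta> rule: finite_induct)
  case empty
  then show ?case by (intro exI[of _ "{}"]) (simp add: top_unique)
next
  case (insert p P)
  then have "inf (snd p) (Meet (snd ` P)) \<le> \<beta>" by simp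
  then obtain \<beta>\<^sub>1 \<beta>\<^sub>2 where *: "snd p \<le> \<beta>\<^sub>1" "Meet (snd ` P) \<le> \<beta>\<^sub>2" "\<beta> = inf \<beta>\<^sub>1 \<beta>\<^sub>2"
    by (meson distributive)
  from insert.IH[OF *(2)] obtain P' where P': "finite P'" "\<beta>\<^sub>2 = Meet (snd ` P')"
    "\<forall>\<gamma> \<beta>'. (\<gamma>, \<beta>') \<in> P' \<longrightarrow> (\<exists>\<beta>''. (\<gamma>, \<beta>'') \<in> P \<and> \<beta>'' \<le> \<beta>')" by (elim exE conjE)
  show ?case
  proof (intro exI[of _ "insert (fst p, \<beta>\<^sub>1) P'"] conjI)
    show "\<forall>\<gamma> \<beta>'. (\<gamma>, \<beta>') \<in> insert (fst p, \<beta>\<^sub>1) P' \<longrightarrow>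
        (\<exists>\<beta>''. (\<gamma>, \<beta>'') \<in> insert p P \<and> \<beta>'' \<le> \<beta>')"
      using * P' by (cases p) auto
  qed (use * P' in auto)
qed

section \<open>The interpretation\<close>

lemma length_sem:
  fixes M :: "'d trm" and Q :: "'d tst"
  shows "\<forall>n as \<beta>. (as, \<beta>) \<in> sem_trm arr M n \<longrightarrow> length as = n"
    and "\<forall>n bs. bs \<in> sem_tst arr Q n \<longrightarrow> length bs = n"
  by (induction M and Q) auto

text \<open>The largest admissible subfamily consists of all summands whose test holds, and it has
  the least meet; so it can stand in for the existential over subfamilies.\<close>

lemma sem_TSum_iff:
  "(bs, \<gamma>) \<in> sem_trm arr (TSum A) n \<longleftrightarrow>
     length bs = n \<and> Meet {\<alpha>. \<exists>Q. (\<alpha>, Q) \<in># A \<and> bs \<in> sem_tst arr Q n} \<le> \<gamma>"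
  (is "?l \<longleftrightarrow> _ \<and> Meet ?S \<le> \<gamma>")
proof -
  let ?A = "image_mset (map_prod id (\<lambda>Q. sem_tst arr Q n)) A"
  have fin: "finite ?S"
    by (rule finite_subset[of _ "fst ` set_mset A"]) (auto intro: rev_image_eqI)
  have "Meet ?S \<le> \<gamma>" if "B \<subseteq># ?A" "\<forall>(\<alpha>, S) \<in># B. bs \<in> S" "Meet (fst ` set_mset B) \<le> \<gamma>" for B
  proof -
    have "fst ` set_mset B \<subseteq> ?S"
      using that(1,2) by (fastforce dest: mset_subset_eqD)
    then have "Meet ?S \<le> Meet (fst ` set_mset B)"
      using fin by (rule Meet_antimono)
    with that(3) show ?thesis by simp
  qed
  moreover have "\<exists>B. B \<subseteq># ?A \<and> (\<forall>(\<alpha>, S) \<in># B. bs \<in> S) \<and> Meet (fst ` set_mset B) \<le> \<gamma>" if "Meet ?S \<le> \<gamma>"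
  proof -
    have "fst ` set_mset {#(\<alpha>, S) \<in># ?A. bs \<in> S#} = ?S"
      by (force simp: image_iff)
    with that show ?thesis
      by (intro exI[of _ "{#(\<alpha>, S) \<in># ?A. bs \<in> S#}"]) auto
  qed
  ultimately show ?thesis by auto
qed

lemma finite_sem_TSum [simp]: "finite {\<alpha>. \<exists>Q. (\<alpha>, Q) \<in># A \<and> R Q}"
  by (rule finite_subset[of _ "fst ` set_mset A"]) (auto intro: rev_image_eqI)

declare sem_trm.simps(4) [simp del]

lemma sem_Lam_iff:
  "(as, \<beta>) \<in> sem_trm arr (Lam M) n \<longleftrightarrow> length as = n \<and>
     (\<exists>P. finite P \<and> \<beta> = arrows arr P \<and> (\<forall>\<beta> \<gamma>. (\<beta>, \<gamma>) \<in> P \<longrightarrow> (\<beta> # as, \<gamma>) \<in> sem_trm arr M (Suc n)))"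
  by auto

lemma sem_App_iff:
  "(as, \<beta>) \<in> sem_trm arr (App M N) n \<longleftrightarrow> length as = n \<and>
     (\<exists>P. finite P \<and> \<beta> = Meet (snd ` P) \<and> (as, arrows arr P) \<in> sem_trm arr M n \<and>
        (as, Meet (fst ` P)) \<in> sem_trm arr N n)"
  by auto

definition filters :: "'d trm \<Rightarrow> nat \<Rightarrow> bool" where
  "filters M n \<longleftrightarrow>
      (\<forall>as. length as = n \<longrightarrow> (as, top) \<in> sem_trm arr M n) \<and>
      (\<forall>as \<beta> \<gamma>. (as, \<beta>) \<in> sem_trm arr M n \<longrightarrow> (as, \<gamma>) \<in> sem_trm arr M n \<longrightarrow>
         (as, inf \<beta> \<gamma>) \<in> sem_trm arr M n) \<and>
      (\<forall>as \<beta> as' \<beta>'. (as, \<beta>) \<in> sem_trm arr M n \<longrightarrow> \<beta> \<le> \<beta>' \<longrightarrow> list_all2 (\<le>) as' as \<longrightarrow>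
         (as', \<beta>') \<in> sem_trm arr M n)"

text \<open>The delicate part is upward closure. For \<open>Lam\<close>, the larger type is written
  as the arrows of its own \<open>ext\<close>, and the filter model condition bounds each codomain
  below by a meet of codomains already available. For \<open>App\<close>, distributivity splits the
  larger type through \<open>Meet_snd_split\<close>. The bound on free variables is what gives every
  term the type \<open>top\<close>: a variable outside the context has an empty
  interpretation.\<close>

lemma sem_filter:
  fixes M :: "'d trm" and Q :: "'d tst"
  shows "\<forall>n. fv_trm M \<subseteq> {..<n} \<longrightarrow> filters M n"
    and "\<forall>n. fv_tst Q \<subseteq> {..<n} \<longrightarrow>
      (\<forall>as as'. as \<in> sem_tst arr Q n \<longrightarrow> list_all2 (\<le>) as' as \<longrightarrow> as' \<in> sem_tst arr Q n)"
proof (induction M and Q)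
  case (Var i)
  then show ?case
    unfolding filters_def by (auto simp: list_all2_conv_all_nth dest: order_trans)
next
  case (Lam M)
  show ?case
  proof (intro allI impI)
    fix n assume "fv_trm (Lam M) \<subseteq> {..<n}"
    then have "fv_trm M \<subseteq> {..<Suc n}" by (simp only: fv_Lam_subset_iff)
    with Lam have top: "\<And>as. length as = Suc n \<Longrightarrow> (as, top) \<in> sem_trm arr M (Suc n)"
      and inf: "\<And>as \<beta> \<gamma>. (as, \<beta>) \<in> sem_trm arr M (Suc n) \<Longrightarrow> (as, \<gamma>) \<in> sem_trm arr M (Suc n) \<Longrightarrow>
         (as, inf \<beta> \<gamma>) \<in> sem_trm arr M (Suc n)"
      and up: "\<And>as \<beta> as' \<beta>'. (as, \<beta>) \<in> sem_trm arr M (Suc n) \<Longrightarrow> \<beta> \<le> \<beta>' \<Longrightarrow>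
         list_all2 (\<le>) as' as \<Longrightarrow> (as', \<beta>') \<in> sem_trm arr M (Suc n)"
      unfolding filters_def by blast+
    have Meet: "(as, Meet B) \<in> sem_trm arr M (Suc n)"
      if "finite B" "length as = Suc n" "\<And>\<beta>. \<beta> \<in> B \<Longrightarrow> (as, \<beta>) \<in> sem_trm arr M (Suc n)" for as B
      using that by (induction B rule: finite_induct) (auto simp: top inf)
    have "(as', \<beta>') \<in> sem_trm arr (Lam M) n"
      if "(as, \<beta>) \<in> sem_trm arr (Lam M) n" "\<beta> \<le> \<beta>'" "list_all2 (\<le>) as' as" for as \<beta> as' \<beta>'
    proof -
      from that(1) obtain P where P: "\<beta> = arrows arr P" "length as = n" "finite P"
        "\<And>\<beta> \<gamma>. (\<beta>, \<gamma>) \<in> P \<Longrightarrow> (\<beta> # as, \<gamma>) \<in> sem_trm arr M (Suc n)" by auto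
      have len: "length as' = n"
        using P that by (auto dest: list_all2_lengthD)
      have "(b # as', c) \<in> sem_trm arr M (Suc n)" if bc: "(b, c) \<in> ext \<beta>'" for b c
      proof -
        have "arrows arr P \<le> arr b c"
          using P \<open>\<beta> \<le> \<beta>'\<close> ext_le_arr[OF bc] by simp
        then have c: "Meet {\<gamma> |\<beta> \<gamma>. (\<beta>, \<gamma>) \<in> P \<and> b \<le> \<beta>} \<le> c"
          using P by (simp add: arrows_le_arr_iff)
        have "(b # as', Meet {\<gamma> |\<beta> \<gamma>. (\<beta>, \<gamma>) \<in> P \<and> b \<le> \<beta>}) \<in> sem_trm arr M (Suc n)"
        proof (intro Meet finite_codomain P(3))
          show "(b # as', \<gamma>) \<in> sem_trm arr M (Suc n)"
            if "\<gamma> \<in> {\<gamma> |\<beta> \<gamma>. (\<beta>, \<gamma>) \<in> P \<and> b \<le> \<beta>}" for \<gamma>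
            using that up[OF P(4) order_refl, of _ \<gamma> "b # as'"] \<open>list_all2 (\<le>) as' as\<close> by auto
        qed (use len in simp)
        from up[OF this c] show ?thesis by (simp add: list.rel_refl)
      qed
      then have "(as', arrows arr (ext \<beta>')) \<in> sem_trm arr (Lam M) n"
        unfolding sem_trm.simps using len by auto
      then show ?thesis by (simp add: arrows_ext)
    qed
    moreover have "(as, inf \<beta> \<gamma>) \<in> sem_trm arr (Lam M) n"
      if "(as, \<beta>) \<in> sem_trm arr (Lam M) n" "(as, \<gamma>) \<in> sem_trm arr (Lam M) n" for as \<beta> \<gamma>
    proof -
      from that obtain P P' where P: "\<beta> = arrows arr P" "length as = n" "finite P"
        "\<And>\<beta> \<gamma>. (\<beta>, \<gamma>) \<in> P \<Longrightarrow> (\<beta> # as, \<gamma>) \<in> sem_trm arr M (Suc n)"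
        and P': "\<gamma> = arrows arr P'" "finite P'"
        "\<And>\<beta> \<gamma>. (\<beta>, \<gamma>) \<in> P' \<Longrightarrow> (\<beta> # as, \<gamma>) \<in> sem_trm arr M (Suc n)"
        unfolding sem_Lam_iff by blast
      have "(as, arrows arr (P \<union> P')) \<in> sem_trm arr (Lam M) n"
        unfolding sem_Lam_iff using P P' by blast
      with P P' show ?thesis by (simp add: arrows_Un)
    qed
    moreover have "(as, top) \<in> sem_trm arr (Lam M) n" if "length as = n" for as
      using that by (auto intro!: exI[of _ "{}"])
    ultimately show "filters (Lam M) n"
      unfolding filters_def by blast
  qed
next
  case (App M N)
  show ?case
  proof (intro allI impI)
    fix n assume fv: "fv_trm (App M N) \<subseteq> {..<n}"
    then have top: "\<And>as. length as = n \<Longrightarrow> (as, top) \<in> sem_trm arr M n"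
      "\<And>as. length as = n \<Longrightarrow> (as, top) \<in> sem_trm arr N n"
      and inf: "\<And>as \<beta> \<gamma>. (as, \<beta>) \<in> sem_trm arr M n \<Longrightarrow> (as, \<gamma>) \<in> sem_trm arr M n \<Longrightarrow>
         (as, inf \<beta> \<gamma>) \<in> sem_trm arr M n"
      "\<And>as \<beta> \<gamma>. (as, \<beta>) \<in> sem_trm arr N n \<Longrightarrow> (as, \<gamma>) \<in> sem_trm arr N n \<Longrightarrow>
         (as, inf \<beta> \<gamma>) \<in> sem_trm arr N n"
      and up: "\<And>as \<beta> as' \<beta>'. (as, \<beta>) \<in> sem_trm arr M n \<Longrightarrow> \<beta> \<le> \<beta>' \<Longrightarrow>
         list_all2 (\<le>) as' as \<Longrightarrow> (as', \<beta>') \<in> sem_trm arr M n"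
      "\<And>as \<beta> as' \<beta>'. (as, \<beta>) \<in> sem_trm arr N n \<Longrightarrow> \<beta> \<le> \<beta>' \<Longrightarrow>
         list_all2 (\<le>) as' as \<Longrightarrow> (as', \<beta>') \<in> sem_trm arr N n"
      using App unfolding filters_def by simp_all
    have "(as', \<beta>') \<in> sem_trm arr (App M N) n"
      if "(as, \<beta>) \<in> sem_trm arr (App M N) n" "\<beta> \<le> \<beta>'" "list_all2 (\<le>) as' as" for as \<beta> as' \<beta>'
    proof -
      from that(1) obtain P where P: "\<beta> = Meet (snd ` P)" "length as = n" "finite P"
        "(as, arrows arr P) \<in> sem_trm arr M n" "(as, Meet (fst ` P)) \<in> sem_trm arr N n" by auto
      have "Meet (snd ` P) \<le> \<beta>'" using P(1) \<open>\<beta> \<le> \<beta>'\<close> by simp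
      from Meet_snd_split[OF P(3) this] obtain P' where P': "finite P'" "\<beta>' = Meet (snd ` P')"
        "\<forall>\<gamma> \<beta>'. (\<gamma>, \<beta>') \<in> P' \<longrightarrow> (\<exists>\<beta>''. (\<gamma>, \<beta>'') \<in> P \<and> \<beta>'' \<le> \<beta>')"
        by (elim exE conjE)
      have "arrows arr P \<le> arrows arr P'"
        using P'(3) arrows_lower[OF P(3)] arr_le_arr_iff
        by (subst le_arrows_iff[OF P'(1)]) (fastforce dest: order_trans)
      moreover have "Meet (fst ` P) \<le> Meet (fst ` P')"
        using P P' by (intro Meet_le_Meet) (force)+
      moreover have "length as' = n"
        using P that by (auto dest: list_all2_lengthD)
      ultimately show ?thesis
        using P' up(1)[OF P(4) _ that(3)] up(2)[OF P(5) _ that(3)] by auto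
    qed
    moreover have "(as, inf \<beta> \<gamma>) \<in> sem_trm arr (App M N) n"
      if "(as, \<beta>) \<in> sem_trm arr (App M N) n" "(as, \<gamma>) \<in> sem_trm arr (App M N) n" for as \<beta> \<gamma>
    proof -
      from that obtain P P' where P: "\<beta> = Meet (snd ` P)" "length as = n" "finite P"
        "(as, arrows arr P) \<in> sem_trm arr M n" "(as, Meet (fst ` P)) \<in> sem_trm arr N n"
        and P': "\<gamma> = Meet (snd ` P')" "finite P'"
        "(as, arrows arr P') \<in> sem_trm arr M n" "(as, Meet (fst ` P')) \<in> sem_trm arr N n"
        unfolding sem_App_iff by blast
      have "inf \<beta> \<gamma> = Meet (snd ` (P \<union> P'))"
        using P P' by (simp add: image_Un Meet_Un)
      moreover have "(as, arrows arr (P \<union> P')) \<in> sem_trm arr M n"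
        "(as, Meet (fst ` (P \<union> P'))) \<in> sem_trm arr N n"
        using P P' inf by (simp_all add: arrows_Un image_Un Meet_Un)
      ultimately show ?thesis
        unfolding sem_App_iff using P P' by blast
    qed
    moreover have "(as, top) \<in> sem_trm arr (App M N) n" if "length as = n" for as
      using that top by (auto intro!: exI[of _ "{}"])
    ultimately show "filters (App M N) n"
      unfolding filters_def by blast
  qed
next
  case (TSum A)
  show ?case
  proof (intro allI impI)
    fix n assume "fv_trm (TSum A) \<subseteq> {..<n}"
    then have IH: "as' \<in> sem_tst arr Q n"
      if "(\<alpha>, Q) \<in># A" "as \<in> sem_tst arr Q n" "list_all2 (\<le>) as' as" for \<alpha> Q as as'
      using TSum[of "(\<alpha>, Q)" Q] that unfolding fv_TSum_subset_iff by fastforce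
    have "Meet {\<alpha>. \<exists>Q. (\<alpha>, Q) \<in># A \<and> as' \<in> sem_tst arr Q n}
        \<le> Meet {\<alpha>. \<exists>Q. (\<alpha>, Q) \<in># A \<and> as \<in> sem_tst arr Q n}" if "list_all2 (\<le>) as' as" for as as'
      using IH[OF _ _ that] by (intro Meet_le_Meet) auto
    then show "filters (TSum A) n"
      unfolding filters_def by (auto simp: sem_TSum_iff dest: list_all2_lengthD) (meson order_trans)
  qed
next
  case (Tau \<alpha> M)
  then show ?case by (auto simp: filters_def)
next
  case (QSum A)
  then show ?case by (fastforce simp: subset_eq)
next
  case (QProd A)
  then show ?case by (fastforce simp: subset_eq dest: list_all2_lengthD)
qed

lemma sem_top: "fv_trm M \<subseteq> {..<n} \<Longrightarrow> length as = n \<Longrightarrow> (as, top) \<in> sem_trm arr M n"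
  using sem_filter(1)[of M] unfolding filters_def by blast

lemma sem_inf:
  "fv_trm M \<subseteq> {..<n} \<Longrightarrow> (as, \<beta>) \<in> sem_trm arr M n \<Longrightarrow> (as, \<gamma>) \<in> sem_trm arr M n \<Longrightarrow>
     (as, inf \<beta> \<gamma>) \<in> sem_trm arr M n"
  using sem_filter(1)[of M] unfolding filters_def by blast

lemma sem_mono:
  "fv_trm M \<subseteq> {..<n} \<Longrightarrow> (as, \<beta>) \<in> sem_trm arr M n \<Longrightarrow> \<beta> \<le> \<beta>' \<Longrightarrow> list_all2 (\<le>) as' as \<Longrightarrow>
     (as', \<beta>') \<in> sem_trm arr M n"
  using sem_filter(1)[of M] unfolding filters_def by blast

lemma sem_up:
  "fv_trm M \<subseteq> {..<n} \<Longrightarrow> (as, \<beta>) \<in> sem_trm arr M n \<Longrightarrow> \<beta> \<le> \<beta>' \<Longrightarrow> (as, \<beta>') \<in> sem_trm arr M n"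
  by (erule sem_mono) (auto simp: list.rel_refl)

lemma sem_tst_mono:
  "fv_tst Q \<subseteq> {..<n} \<Longrightarrow> as \<in> sem_tst arr Q n \<Longrightarrow> list_all2 (\<le>) as' as \<Longrightarrow> as' \<in> sem_tst arr Q n"
  using sem_filter(2)[of Q] by blast

lemma sem_Meet:
  assumes "finite B" "fv_trm M \<subseteq> {..<n}" "length as = n" "\<And>\<beta>. \<beta> \<in> B \<Longrightarrow> (as, \<beta>) \<in> sem_trm arr M n"
  shows "(as, Meet B) \<in> sem_trm arr M n"
  using assms by (induction B rule: finite_induct) (auto simp: sem_top sem_inf)

end

section \<open>Subject expansion\<close>

definition insert_at :: "nat \<Rightarrow> 'a \<Rightarrow> 'a list \<Rightarrow> 'a list" where
  "insert_at k a as = take k as @ a # drop k as"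

lemma length_insert_at [simp]: "length (insert_at k a as) = Suc (length as)"
  by (simp add: insert_at_def)

lemma insert_at_0 [simp]: "insert_at 0 a as = a # as"
  by (simp add: insert_at_def)

lemma insert_at_Suc [simp]: "insert_at (Suc k) a (b # as) = b # insert_at k a as"
  by (simp add: insert_at_def)

lemma nth_insert_at:
  "k \<le> length as \<Longrightarrow>
     insert_at k a as ! i = (if i < k then as ! i else if i = k then a else as ! (i - 1))"
  by (auto simp: insert_at_def nth_append nth_Cons')

lemma insert_at_mono:
  "list_all2 R as bs \<Longrightarrow> R a b \<Longrightarrow> list_all2 R (insert_at k a as) (insert_at k b bs)"
  by (auto simp: insert_at_def intro!: list_all2_appendI list_all2_takeI list_all2_dropI)

lemma mem_map_prod_id_iff: "(\<alpha>, Q) \<in> map_prod id f ` A \<longleftrightarrow> (\<exists>Q'. (\<alpha>, Q') \<in> A \<and> Q = f Q')"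
  by (auto intro: rev_image_eqI)

lemma fv_lift:
  fixes M :: "'d trm" and Q :: "'d tst"
  shows "\<forall>n k. fv_trm M \<subseteq> {..<n} \<longrightarrow> fv_trm (lift_trm M k) \<subseteq> {..<Suc n}"
  "\<forall>n k. fv_tst Q \<subseteq> {..<n} \<longrightarrow> fv_tst (lift_tst Q k) \<subseteq> {..<Suc n}"
proof (induction M and Q)
  case (Lam M)
  then show ?case by (simp only: fv_Lam_subset_iff lift_trm.simps) blast
next
  case (TSum A)
  have "fv_tst (lift_tst Q k) \<subseteq> {..<Suc n}" if "(\<alpha>, Q) \<in># A" "fv_tst Q \<subseteq> {..<n}" for \<alpha> Q n k
    using TSum[OF that(1), of Q] that(2) by simp
  then show ?case
    by (simp add: fv_TSum_subset_iff mem_map_prod_id_iff del: fv_trm.simps) blast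
qed (simp_all add: UN_subset_iff)

lemma fv_subst:
  fixes M :: "'d trm" and Q :: "'d tst"
  shows "\<forall>n k N. fv_trm M \<subseteq> {..<Suc n} \<longrightarrow> k \<le> n \<longrightarrow> fv_trm N \<subseteq> {..<n} \<longrightarrow>
     fv_trm (subst_trm M k N) \<subseteq> {..<n}"
  "\<forall>n k N. fv_tst Q \<subseteq> {..<Suc n} \<longrightarrow> k \<le> n \<longrightarrow> fv_trm N \<subseteq> {..<n} \<longrightarrow>
     fv_tst (subst_tst Q k N) \<subseteq> {..<n}"
proof (induction M and Q)
  case (Var i)
  then show ?case by auto
next
  case (Lam M)
  then show ?case
    by (simp only: fv_Lam_subset_iff subst_trm.simps) (simp add: fv_lift)
next
  case (TSum A)
  have "fv_tst (subst_tst Q k N) \<subseteq> {..<n}"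
    if "(\<alpha>, Q) \<in># A" "fv_tst Q \<subseteq> {..<Suc n}" "k \<le> n" "fv_trm N \<subseteq> {..<n}" for \<alpha> Q n k N
    using TSum[OF that(1), of Q] that(2-) by simp
  then show ?case
    by (simp add: fv_TSum_subset_iff mem_map_prod_id_iff del: fv_trm.simps) blast
qed (simp_all add: UN_subset_iff)

context defim
begin

text \<open>The inserted value is never read, since no variable of a term lifted at \<open>k\<close>
  refers to position \<open>k\<close>.\<close>

lemma sem_lift:
  fixes M :: "'d trm" and Q :: "'d tst"
  shows "\<forall>k as \<beta>. k \<le> length as \<longrightarrow>
      ((insert_at k a as, \<beta>) \<in> sem_trm arr (lift_trm M k) (Suc (length as)) \<longleftrightarrow>
       (as, \<beta>) \<in> sem_trm arr M (length as))"
    and "\<forall>k as. k \<le> length as \<longrightarrow>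
      (insert_at k a as \<in> sem_tst arr (lift_tst Q k) (Suc (length as)) \<longleftrightarrow>
       as \<in> sem_tst arr Q (length as))"
proof (induction M and Q)
  case (Var i)
  then show ?case by (auto simp: nth_insert_at)
next
  case (Lam M)
  have "(b # insert_at k a as, c) \<in> sem_trm arr (lift_trm M (Suc k)) (Suc (Suc (length as)))
      \<longleftrightarrow> (b # as, c) \<in> sem_trm arr M (Suc (length as))"
    if "k \<le> length as" for k as b c
    using Lam[rule_format, of "Suc k" "b # as" c] that by simp
  then show ?case by (simp only: lift_trm.simps sem_Lam_iff length_insert_at) simp
next
  case (App M N)
  then show ?case by (simp only: lift_trm.simps sem_App_iff length_insert_at) simp
next
  case (TSum A)
  have "{\<alpha>. \<exists>Q. (\<alpha>, Q) \<in># image_mset (map_prod id (\<lambda>Q. lift_tst Q k)) A \<and>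
           insert_at k a as \<in> sem_tst arr Q (Suc (length as))}
      = {\<alpha>. \<exists>Q. (\<alpha>, Q) \<in># A \<and> as \<in> sem_tst arr Q (length as)}" if "k \<le> length as" for k as
  proof -
    have "insert_at k a as \<in> sem_tst arr (lift_tst Q k) (Suc (length as)) \<longleftrightarrow>
        as \<in> sem_tst arr Q (length as)" if "(\<alpha>, Q) \<in># A" for \<alpha> Q
      using TSum[OF that, of Q] \<open>k \<le> length as\<close> by simp
    then show ?thesis
      by (simp add: mem_map_prod_id_iff) blast
  qed
  then show ?case by (simp add: sem_TSum_iff)
next
  case (Tau \<alpha> M)
  then show ?case by simp
next
  case (QSum A)
  then show ?case by simp
next
  case (QProd A)
  then show ?case by simp
qed

text \<open>Every occurrence of the variable asks for some type of \<open>N\<close>. There are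
  finitely many such demands, their meet is again a type of \<open>N\<close>, and by antitonicity in
  the environment this one type serves all occurrences.\<close>

lemma sem_subst_expand:
  fixes M :: "'d trm" and Q :: "'d tst"
  shows "\<forall>k as \<gamma> N. (as, \<gamma>) \<in> sem_trm arr (subst_trm M k N) (length as) \<longrightarrow> k \<le> length as \<longrightarrow>
      fv_trm M \<subseteq> {..<Suc (length as)} \<longrightarrow> fv_trm N \<subseteq> {..<length as} \<longrightarrow>
      (\<exists>b. (as, b) \<in> sem_trm arr N (length as) \<and>
         (insert_at k b as, \<gamma>) \<in> sem_trm arr M (Suc (length as)))"
    and "\<forall>k as N. as \<in> sem_tst arr (subst_tst Q k N) (length as) \<longrightarrow> k \<le> length as \<longrightarrow>
      fv_tst Q \<subseteq> {..<Suc (length as)} \<longrightarrow> fv_trm N \<subseteq> {..<length as} \<longrightarrow>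
      (\<exists>b. (as, b) \<in> sem_trm arr N (length as) \<and>
         insert_at k b as \<in> sem_tst arr Q (Suc (length as)))"
proof (induction M and Q)
  case (Var i)
  show ?case
  proof (intro allI impI)
    fix k as \<gamma> N
    assume *: "(as, \<gamma>) \<in> sem_trm arr (subst_trm (Var i) k N) (length as)" "k \<le> length as"
      "fv_trm (Var i) \<subseteq> {..<Suc (length as)}" "fv_trm N \<subseteq> {..<length as}"
    show "\<exists>b. (as, b) \<in> sem_trm arr N (length as) \<and>
         (insert_at k b as, \<gamma>) \<in> sem_trm arr (Var i) (Suc (length as))"
    proof (cases "i = k")
      case True
      with * show ?thesis by (intro exI[of _ \<gamma>]) (simp add: nth_insert_at)
    next
      case False
      \<comment> \<open>This leaf makes no demand on \<open>N\<close>, so the weakest type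
        \<open>top\<close> is recorded.\<close>
      with * show ?thesis
        by (intro exI[of _ top]) (auto simp: nth_insert_at sem_top split: if_splits)
    qed
  qed
next
  case (Lam M)
  show ?case
  proof (intro allI impI)
    fix k as \<gamma> N
    assume *: "(as, \<gamma>) \<in> sem_trm arr (subst_trm (Lam M) k N) (length as)" "k \<le> length as"
      "fv_trm (Lam M) \<subseteq> {..<Suc (length as)}" "fv_trm N \<subseteq> {..<length as}"
    from * have M: "fv_trm M \<subseteq> {..<Suc (Suc (length as))}"
      by (simp only: fv_Lam_subset_iff)
    from * obtain P where P: "finite P" "\<gamma> = arrows arr P" "\<And>b c. (b, c) \<in> P \<Longrightarrow>
      (b # as, c) \<in> sem_trm arr (subst_trm M (Suc k) (lift_trm N 0)) (Suc (length as))"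
      unfolding subst_trm.simps sem_Lam_iff by blast
    have "\<exists>d. (as, d) \<in> sem_trm arr N (length as) \<and>
        (b # insert_at k d as, c) \<in> sem_trm arr M (Suc (Suc (length as)))" if "(b, c) \<in> P" for b c
    proof -
      from Lam[rule_format, of "b # as" c "Suc k" "lift_trm N 0"] P(3)[OF that] M * obtain d where
        "(b # as, d) \<in> sem_trm arr (lift_trm N 0) (Suc (length as))"
        "(b # insert_at k d as, c) \<in> sem_trm arr M (Suc (Suc (length as)))"
        by (auto simp: fv_lift)
      with sem_lift(1)[of b N, rule_format, of 0 as d] show ?thesis by auto
    qed
    then obtain d where d: "\<And>b c. (b, c) \<in> P \<Longrightarrow> (as, d b c) \<in> sem_trm arr N (length as)"
      "\<And>b c. (b, c) \<in> P \<Longrightarrow>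
         (b # insert_at k (d b c) as, c) \<in> sem_trm arr M (Suc (Suc (length as)))"
      by metis
    let ?d = "Meet ((\<lambda>(b, c). d b c) ` P)"
    have "(as, ?d) \<in> sem_trm arr N (length as)"
      using P(1) d(1) * by (intro sem_Meet) auto
    moreover have "(b # insert_at k ?d as, c) \<in> sem_trm arr M (Suc (Suc (length as)))"
      if "(b, c) \<in> P" for b c
    proof (rule sem_mono[OF M d(2)[OF that] order_refl])
      have "?d \<le> d b c"
        using P(1) that by (intro Meet_lower) auto
      then show "list_all2 (\<le>) (b # insert_at k ?d as) (b # insert_at k (d b c) as)"
        by (simp add: insert_at_mono list.rel_refl)
    qed
    ultimately show "\<exists>b. (as, b) \<in> sem_trm arr N (length as) \<and>
         (insert_at k b as, \<gamma>) \<in> sem_trm arr (Lam M) (Suc (length as))"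
      unfolding sem_Lam_iff using P by auto
  qed
next
  case (App M L)
  show ?case
  proof (intro allI impI)
    fix k as \<gamma> N
    assume *: "(as, \<gamma>) \<in> sem_trm arr (subst_trm (App M L) k N) (length as)" "k \<le> length as"
      "fv_trm (App M L) \<subseteq> {..<Suc (length as)}" "fv_trm N \<subseteq> {..<length as}"
    from * have fv: "fv_trm M \<subseteq> {..<Suc (length as)}" "fv_trm L \<subseteq> {..<Suc (length as)}" by auto
    from * obtain P where P: "finite P" "\<gamma> = Meet (snd ` P)"
      "(as, arrows arr P) \<in> sem_trm arr (subst_trm M k N) (length as)"
      "(as, Meet (fst ` P)) \<in> sem_trm arr (subst_trm L k N) (length as)"
      unfolding subst_trm.simps sem_App_iff by blast
    from App(1)[rule_format, OF P(3) *(2) fv(1) *(4)] App(2)[rule_format, OF P(4) *(2) fv(2) *(4)]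
    obtain b c where b: "(as, b) \<in> sem_trm arr N (length as)"
      "(insert_at k b as, arrows arr P) \<in> sem_trm arr M (Suc (length as))"
      and c: "(as, c) \<in> sem_trm arr N (length as)"
      "(insert_at k c as, Meet (fst ` P)) \<in> sem_trm arr L (Suc (length as))" by blast
    have "(insert_at k (inf b c) as, arrows arr P) \<in> sem_trm arr M (Suc (length as))"
      by (rule sem_mono[OF fv(1) b(2) order_refl]) (simp add: insert_at_mono list.rel_refl)
    moreover have "(insert_at k (inf b c) as, Meet (fst ` P)) \<in> sem_trm arr L (Suc (length as))"
      by (rule sem_mono[OF fv(2) c(2) order_refl]) (simp add: insert_at_mono list.rel_refl)
    ultimately show "\<exists>b. (as, b) \<in> sem_trm arr N (length as) \<and>
         (insert_at k b as, \<gamma>) \<in> sem_trm arr (App M L) (Suc (length as))"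
      unfolding sem_App_iff using P sem_inf[OF *(4) b(1) c(1)] by auto
  qed
next
  case (TSum A)
  show ?case
  proof (intro allI impI)
    fix k as \<gamma> N
    assume *: "(as, \<gamma>) \<in> sem_trm arr (subst_trm (TSum A) k N) (length as)" "k \<le> length as"
      "fv_trm (TSum A) \<subseteq> {..<Suc (length as)}" "fv_trm N \<subseteq> {..<length as}"
    let ?A = "{p \<in> set_mset A. as \<in> sem_tst arr (subst_tst (snd p) k N) (length as)}"
    have fv: "fv_tst (snd p) \<subseteq> {..<Suc (length as)}" if "p \<in># A" for p
      using *(3) that unfolding fv_TSum_subset_iff by (cases p) auto
    have "\<exists>b. (as, b) \<in> sem_trm arr N (length as) \<and>
        insert_at k b as \<in> sem_tst arr (snd p) (Suc (length as))" if "p \<in> ?A" for p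
      using TSum[of p "snd p", rule_format, of as k N] that fv[of p] * by (cases p) auto
    then have "\<forall>p\<in>?A. \<exists>b. (as, b) \<in> sem_trm arr N (length as) \<and>
        insert_at k b as \<in> sem_tst arr (snd p) (Suc (length as))" by (rule ballI)
    from bchoice[OF this] obtain b where
      "\<forall>p\<in>?A. (as, b p) \<in> sem_trm arr N (length as) \<and>
        insert_at k (b p) as \<in> sem_tst arr (snd p) (Suc (length as))" ..
    then have b: "(as, b p) \<in> sem_trm arr N (length as)"
      "insert_at k (b p) as \<in> sem_tst arr (snd p) (Suc (length as))" if "p \<in> ?A" for p
      using that by blast+
    let ?b = "Meet (b ` ?A)"
    have 1: "insert_at k ?b as \<in> sem_tst arr (snd p) (Suc (length as))" if "p \<in> ?A" for p
    proof (rule sem_tst_mono[OF fv b(2)[OF that]])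
      show "p \<in># A" using that by simp
      have "?b \<le> b p" using that by (intro Meet_lower) auto
      then show "list_all2 (\<le>) (insert_at k ?b as) (insert_at k (b p) as)"
        by (simp add: insert_at_mono list.rel_refl)
    qed
    have N: "(as, ?b) \<in> sem_trm arr N (length as)"
      using b(1) * by (intro sem_Meet) auto
    have "{\<alpha>. \<exists>Q. (\<alpha>, Q) \<in># image_mset (map_prod id (\<lambda>Q. subst_tst Q k N)) A \<and>
          as \<in> sem_tst arr Q (length as)}
        \<subseteq> {\<alpha>. \<exists>Q. (\<alpha>, Q) \<in># A \<and> insert_at k ?b as \<in> sem_tst arr Q (Suc (length as))}"
      using 1 by (simp add: mem_map_prod_id_iff) force
    then have "Meet {\<alpha>. \<exists>Q. (\<alpha>, Q) \<in># A \<and> insert_at k ?b as \<in> sem_tst arr Q (Suc (length as))}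
      \<le> Meet {\<alpha>. \<exists>Q. (\<alpha>, Q) \<in># image_mset (map_prod id (\<lambda>Q. subst_tst Q k N)) A \<and>
          as \<in> sem_tst arr Q (length as)}"
      by (rule Meet_antimono) simp
    also have "\<dots> \<le> \<gamma>"
      using *(1) by (simp only: subst_trm.simps sem_TSum_iff)
    finally have "(insert_at k ?b as, \<gamma>) \<in> sem_trm arr (TSum A) (Suc (length as))"
      by (simp only: sem_TSum_iff length_insert_at)
    with N show "\<exists>b. (as, b) \<in> sem_trm arr N (length as) \<and>
         (insert_at k b as, \<gamma>) \<in> sem_trm arr (TSum A) (Suc (length as))"
      by (intro exI[of _ ?b] conjI)
  qed
next
  case (Tau \<alpha> M)
  then show ?case by simp
next
  case (QSum A)
  show ?case
  proof (intro allI impI)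
    fix k as N
    assume *: "as \<in> sem_tst arr (subst_tst (QSum A) k N) (length as)" "k \<le> length as"
      "fv_tst (QSum A) \<subseteq> {..<Suc (length as)}" "fv_trm N \<subseteq> {..<length as}"
    then obtain Q where Q: "Q \<in># A" "as \<in> sem_tst arr (subst_tst Q k N) (length as)" by auto
    moreover from Q * have "fv_tst Q \<subseteq> {..<Suc (length as)}" by auto
    ultimately show "\<exists>b. (as, b) \<in> sem_trm arr N (length as) \<and>
         insert_at k b as \<in> sem_tst arr (QSum A) (Suc (length as))"
      using QSum[OF Q(1)] * by fastforce
  qed
next
  case (QProd A)
  show ?case
  proof (intro allI impI)
    fix k as N
    assume *: "as \<in> sem_tst arr (subst_tst (QProd A) k N) (length as)" "k \<le> length as"
      "fv_tst (QProd A) \<subseteq> {..<Suc (length as)}" "fv_trm N \<subseteq> {..<length as}"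
    have fv: "fv_tst Q \<subseteq> {..<Suc (length as)}" if "Q \<in># A" for Q
      using *(3) that by auto
    have "\<exists>b. (as, b) \<in> sem_trm arr N (length as) \<and>
        insert_at k b as \<in> sem_tst arr Q (Suc (length as))" if "Q \<in># A" for Q
      using QProd[OF that, rule_format, of as k N] that fv[of Q] * by auto
    then obtain b where b: "\<And>Q. Q \<in># A \<Longrightarrow> (as, b Q) \<in> sem_trm arr N (length as)"
      "\<And>Q. Q \<in># A \<Longrightarrow> insert_at k (b Q) as \<in> sem_tst arr Q (Suc (length as))"
      by metis
    let ?b = "Meet (b ` set_mset A)"
    have "insert_at k ?b as \<in> sem_tst arr Q (Suc (length as))" if "Q \<in># A" for Q
    proof (rule sem_tst_mono[OF fv b(2)[OF that]])
      show "Q \<in># A" using that by simp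
      have "?b \<le> b Q" using that by (intro Meet_lower) auto
      then show "list_all2 (\<le>) (insert_at k ?b as) (insert_at k (b Q) as)"
        by (simp add: insert_at_mono list.rel_refl)
    qed
    moreover have "(as, ?b) \<in> sem_trm arr N (length as)"
      using b(1) * by (intro sem_Meet) auto
    ultimately show "\<exists>b. (as, b) \<in> sem_trm arr N (length as) \<and>
         insert_at k b as \<in> sem_tst arr (QProd A) (Suc (length as))"
      by auto
  qed
qed

end

section \<open>Canonical sums and products, and sums of bar-taus applied to an argument\<close>

lemma set_mset_sum_image [simp]: "set_mset (\<Sum>x\<in>#A. f x) = (\<Union>x\<in>set_mset A. set_mset (f x))"
  by (induction A) auto

lemma qsum_single: "(\<Sum>Q\<in>#A. summands Q) = {#q#} \<Longrightarrow> qsum A = q"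
  and qsum_QSum: "size (\<Sum>Q\<in>#A. summands Q) \<noteq> 1 \<Longrightarrow> qsum A = QSum (\<Sum>Q\<in>#A. summands Q)"
  and qprod_single: "(\<Sum>Q\<in>#A. factors Q) = {#q#} \<Longrightarrow> qprod A = q"
  and qprod_QProd: "size (\<Sum>Q\<in>#A. factors Q) \<noteq> 1 \<Longrightarrow> qprod A = QProd (\<Sum>Q\<in>#A. factors Q)"
  by (simp_all add: qsum_def qprod_def)

lemma qsum_cases:
  obtains q where "(\<Sum>Q\<in>#A. summands Q) = {#q#}" "qsum A = q"
  | "size (\<Sum>Q\<in>#A. summands Q) \<noteq> 1" "qsum A = QSum (\<Sum>Q\<in>#A. summands Q)"
  by (metis qsum_single qsum_QSum size_1_singleton_mset)

lemma qprod_cases: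
  obtains q where "(\<Sum>Q\<in>#A. factors Q) = {#q#}" "qprod A = q"
  | "size (\<Sum>Q\<in>#A. factors Q) \<noteq> 1" "qprod A = QProd (\<Sum>Q\<in>#A. factors Q)"
  by (metis qprod_single qprod_QProd size_1_singleton_mset)

lemma fv_summands: "(\<Union>s\<in>set_mset (summands Q). fv_tst s) = fv_tst Q"
  and fv_factors: "(\<Union>s\<in>set_mset (factors Q). fv_tst s) = fv_tst Q"
  by (cases Q; simp add: summands_def factors_def)+

lemma fv_qsum: "fv_tst (qsum A) = (\<Union>Q\<in>set_mset A. fv_tst Q)"
proof -
  have "fv_tst (qsum A) = (\<Union>s\<in>set_mset (\<Sum>Q\<in>#A. summands Q). fv_tst s)"
    by (cases A rule: qsum_cases) (simp_all del: set_mset_sum_image)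
  then show ?thesis by (simp add: fv_summands)
qed

lemma fv_qprod: "fv_tst (qprod A) = (\<Union>Q\<in>set_mset A. fv_tst Q)"
proof -
  have "fv_tst (qprod A) = (\<Union>s\<in>set_mset (\<Sum>Q\<in>#A. factors Q). fv_tst s)"
    by (cases A rule: qprod_cases) (simp_all del: set_mset_sum_image)
  then show ?thesis by (simp add: fv_factors)
qed

lemma fv_tau: "fv_tst (tau \<alpha> M) \<subseteq> fv_trm M"
  by (simp add: tau_def)

lemma mem_bartau_iff: "(\<gamma>, R) \<in># bartau \<alpha> Q \<longleftrightarrow> \<gamma> \<noteq> top \<and> \<gamma> = \<alpha> \<and> R = Q"
  by (auto simp: bartau_def)

lemma set_mset_bareps: "set_mset (bareps \<alpha>) = (if \<alpha> = top then {} else {(\<alpha>, QProd {#})})"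
  by (simp add: bareps_def bartau_def)

lemma fv_bareps [simp]: "fv_trm (TSum (bareps \<alpha>)) = {}"
  by (simp add: bareps_def bartau_def)

text \<open>The contractum of the rule of the same name, as a multiset, so that it can in turn be
  applied to further arguments.\<close>

definition sum_app ::
  "('d::bounded_semilattice_inf_top \<Rightarrow> ('d \<times> 'd) set) \<Rightarrow> ('d \<times> 'd tst) multiset \<Rightarrow> 'd trm \<Rightarrow>
     ('d \<times> 'd tst) multiset" where
  "sum_app ext A N =
     (\<Sum>(\<alpha>, Q)\<in>#A. \<Sum>(\<beta>, \<gamma>)\<in>#mset_set (ext \<alpha>). bartau \<gamma> (qtimes Q (tau \<beta> N)))"

context defim
begin

lemma mem_sum_app_iff:
  "(\<gamma>, Q') \<in># sum_app ext A N \<longleftrightarrow> \<gamma> \<noteq> top \<and>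
     (\<exists>\<alpha> Q \<beta>. (\<alpha>, Q) \<in># A \<and> (\<beta>, \<gamma>) \<in> ext \<alpha> \<and> Q' = qtimes Q (tau \<beta> N))"
proof -
  have "(\<gamma>, Q') \<in># sum_app ext A N \<longleftrightarrow> (\<exists>(\<alpha>, Q)\<in>set_mset A. \<exists>(\<beta>, \<gamma>')\<in>ext \<alpha>.
      (\<gamma>, Q') \<in># bartau \<gamma>' (qtimes Q (tau \<beta> N)))"
    by (simp add: sum_app_def split_beta)
  also have "\<dots> \<longleftrightarrow> (\<exists>\<alpha> Q \<beta> \<gamma>'. (\<alpha>, Q) \<in># A \<and> (\<beta>, \<gamma>') \<in> ext \<alpha> \<and>
      (\<gamma>, Q') \<in># bartau \<gamma>' (qtimes Q (tau \<beta> N)))"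
    by blast
  finally show ?thesis
    by (simp only: mem_bartau_iff) (rule iffI; elim exE conjE; simp only:; intro conjI exI; assumption?; simp)
qed

lemma sem_summands: "sem_tst arr Q n = (\<Union>s\<in>set_mset (summands Q). sem_tst arr s n)"
  by (cases Q) (simp_all add: summands_def)

lemma sem_factors:
  "sem_tst arr Q n = {bs. length bs = n \<and> (\<forall>s\<in>#factors Q. bs \<in> sem_tst arr s n)}"
  using length_sem(2)[of Q] by (cases Q) (auto simp: factors_def)

lemma sem_qsum: "sem_tst arr (qsum A) n = (\<Union>Q\<in>set_mset A. sem_tst arr Q n)"
proof -
  have "sem_tst arr (qsum A) n = (\<Union>s\<in>set_mset (\<Sum>Q\<in>#A. summands Q). sem_tst arr s n)"
    by (cases A rule: qsum_cases) (simp_all del: set_mset_sum_image)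
  then show ?thesis by (simp add: sem_summands[of _ n, symmetric])
qed

lemma sem_qprod:
  "sem_tst arr (qprod A) n = {bs. length bs = n \<and> (\<forall>Q\<in>#A. bs \<in> sem_tst arr Q n)}"
proof -
  have "sem_tst arr (qprod A) n =
      {bs. length bs = n \<and> (\<forall>s\<in>#(\<Sum>Q\<in>#A. factors Q). bs \<in> sem_tst arr s n)}"
  proof (cases A rule: qprod_cases)
    case (1 q)
    then show ?thesis using length_sem(2)[of q] by (auto simp del: set_mset_sum_image)
  qed (simp del: set_mset_sum_image)
  moreover have "(\<forall>s\<in>#factors Q. bs \<in> sem_tst arr s n) \<longleftrightarrow> bs \<in> sem_tst arr Q n"
    if "length bs = n" for Q bs
    using sem_factors[of Q n] that by simp
  ultimately show ?thesis by (simp cong: conj_cong)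
qed

text \<open>For \<open>\<alpha> = top\<close> the left side holds in every environment of length
  \<open>n\<close>; that the right side does too is \<open>sem_top\<close>, which needs the bound on
  free variables.\<close>

lemma sem_tau:
  "fv_trm M \<subseteq> {..<n} \<Longrightarrow> bs \<in> sem_tst arr (tau \<alpha> M) n \<longleftrightarrow> (bs, \<alpha>) \<in> sem_trm arr M n"
  using sem_top[of M n bs] length_sem(1)[of M] by (auto simp: tau_def)

lemma sem_bareps: "(bs, \<gamma>) \<in> sem_trm arr (TSum (bareps \<alpha>)) n \<longleftrightarrow> length bs = n \<and> \<alpha> \<le> \<gamma>"
  by (auto simp: sem_TSum_iff set_mset_bareps top_unique)

lemma sem_App_sum_app:
  assumes fv: "fv_trm (App (TSum A) N) \<subseteq> {..<n}"
    and as: "(as, \<gamma>) \<in> sem_trm arr (TSum (sum_app ext A N)) n"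
  shows "(as, \<gamma>) \<in> sem_trm arr (App (TSum A) N) n"
proof -
  have len: "length as = n"
    using as by (simp add: sem_TSum_iff)
  let ?m = "Meet {\<alpha>. \<exists>Q. (\<alpha>, Q) \<in># A \<and> as \<in> sem_tst arr Q n}"
  \<comment> \<open>The pairs behind the successful summands of the contractum: the original test
    holds and \<open>N\<close> has the domain as a type. Pairs with codomain \<open>top\<close> are
    kept although \<open>sum_app\<close> drops them; they leave the meet of the codomains
    unchanged.\<close>
  define P where "P = {(b, c). \<exists>\<alpha> Q. (\<alpha>, Q) \<in># A \<and> as \<in> sem_tst arr Q n \<and> (b, c) \<in> ext \<alpha> \<and>
    (as, b) \<in> sem_trm arr N n}"
  have "P \<subseteq> (\<Union>p\<in>set_mset A. ext (fst p))"
    unfolding P_def by force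
  then have fin: "finite P" by (rule finite_subset) simp
  have "?m \<le> arr b c" if "(b, c) \<in> P" for b c
  proof -
    from that obtain \<alpha> Q where *: "(\<alpha>, Q) \<in># A" "as \<in> sem_tst arr Q n" "(b, c) \<in> ext \<alpha>"
      unfolding P_def by blast
    then have "?m \<le> \<alpha>" by (intro Meet_lower) auto
    also have "\<dots> \<le> arr b c" using * by (intro ext_le_arr)
    finally show ?thesis .
  qed
  then have "?m \<le> arrows arr P" using le_arrows_iff[OF fin] by blast
  then have "(as, arrows arr P) \<in> sem_trm arr (TSum A) n"
    using len by (simp add: sem_TSum_iff)
  moreover have "(as, Meet (fst ` P)) \<in> sem_trm arr N n"
    using fv len fin by (intro sem_Meet) (auto simp: P_def)
  ultimately have "(as, Meet (snd ` P)) \<in> sem_trm arr (App (TSum A) N) n"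
    using fin len by (auto simp: sem_App_iff simp del: sem_trm.simps)
  moreover have "Meet (snd ` P) \<le> \<gamma>"
  proof -
    have "Meet (snd ` P) \<le> Meet {\<alpha>. \<exists>Q. (\<alpha>, Q) \<in># sum_app ext A N \<and> as \<in> sem_tst arr Q n}"
    proof (rule Meet_antimono)
      show "{\<alpha>. \<exists>Q. (\<alpha>, Q) \<in># sum_app ext A N \<and> as \<in> sem_tst arr Q n} \<subseteq> snd ` P"
        using fv by (force simp: mem_sum_app_iff P_def sem_qprod sem_tau image_iff)
    qed (use fin in simp)
    also have "\<dots> \<le> \<gamma>" using as by (simp add: sem_TSum_iff)
    finally show ?thesis .
  qed
  ultimately show ?thesis using sem_up[OF fv] by blast
qed

section \<open>Expansion along the rules and in contexts\<close>

lemma rule_trm_expand: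
  assumes "rule_trm ext M M'" "fv_trm M \<subseteq> {..<n}"
  shows "fv_trm M' \<subseteq> {..<n} \<and> sem_trm arr M' n \<subseteq> sem_trm arr M n"
  using assms
proof cases
  case (beta L N)
  then have fv: "fv_trm L \<subseteq> {..<Suc n}" "fv_trm N \<subseteq> {..<n}"
    using assms(2) fv_Lam_subset_iff[of L n] by simp_all
  have "(as, \<gamma>) \<in> sem_trm arr (App (Lam L) N) n" if "(as, \<gamma>) \<in> sem_trm arr (subst_trm L 0 N) n" for as \<gamma>
  proof -
    have len: "length as = n" using that length_sem(1)[of "subst_trm L 0 N"] by blast
    with that fv sem_subst_expand(1)[of L, rule_format, of as \<gamma> 0 N] obtain b where
      b: "(as, b) \<in> sem_trm arr N n" "(b # as, \<gamma>) \<in> sem_trm arr L (Suc n)" by auto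
    then have "(as, arrows arr {(b, \<gamma>)}) \<in> sem_trm arr (Lam L) n"
      using len unfolding sem_Lam_iff by blast
    then show ?thesis
      unfolding sem_App_iff using b len by (intro conjI exI[of _ "{(b, \<gamma>)}"]) simp_all
  qed
  with beta fv show ?thesis by (auto simp: fv_subst)
next
  case (sum_app A N)
  then have "M' = TSum (sum_app ext A N)" by (simp add: sum_app_def)
  moreover have "fv_trm (TSum (sum_app ext A N)) \<subseteq> {..<n}"
    using assms(2) fv_tau sum_app unfolding fv_TSum_subset_iff
    by (fastforce simp: mem_sum_app_iff fv_qprod)
  ultimately show ?thesis
    using sem_App_sum_app[of A N n] assms(2) sum_app by auto
next
  case (bartau_sum \<alpha> A)
  have "fv_trm M' \<subseteq> {..<n}"
    using assms(2) bartau_sum by auto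
  moreover have "sem_trm arr M' n \<subseteq> sem_trm arr M n"
  proof (intro subrelI)
    fix as \<gamma> assume *: "(as, \<gamma>) \<in> sem_trm arr M' n"
    have "Meet {\<beta>. \<exists>Q. (\<beta>, Q) \<in># {#(\<alpha>, QSum A)#} \<and> as \<in> sem_tst arr Q n}
        \<le> Meet {\<beta>. \<exists>Q. (\<beta>, Q) \<in># {#(\<alpha>, Q). Q \<in># A#} \<and> as \<in> sem_tst arr Q n}"
      by (rule Meet_antimono) auto
    with * show "(as, \<gamma>) \<in> sem_trm arr M n"
      unfolding bartau_sum sem_TSum_iff by (blast intro: order_trans)
  qed
  ultimately show ?thesis by blast
qed

text \<open>In the case \<open>tau_lam\<close>, the types of the bar-epsilon of index b are exactly
  those above b. Whatever type \<open>sem_subst_expand\<close> returns for the bound variable can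
  thus be lowered to b, and the pairs of \<open>ext \<alpha>\<close> reassemble to \<alpha>. In the
  other two cases the successful summand of the contractum names the subfamily, or the choice of one
  summand per factor, that succeeds in the redex.\<close>

lemma rule_tst_expand:
  assumes "rule_tst ext Q Q'" "fv_tst Q \<subseteq> {..<n}"
  shows "fv_tst Q' \<subseteq> {..<n} \<and> sem_tst arr Q' n \<subseteq> sem_tst arr Q n"
  using assms
proof cases
  case (tau_lam \<alpha> L)
  then have fv: "fv_trm L \<subseteq> {..<Suc n}"
    using assms(2) fv_Lam_subset_iff[of L n] by simp
  then have fv': "fv_trm (subst_trm L 0 (TSum (bareps \<beta>))) \<subseteq> {..<n}" for \<beta>
    by (simp add: fv_subst del: fv_trm.simps)
  have "as \<in> sem_tst arr Q n" if as: "as \<in> sem_tst arr Q' n" for as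
  proof -
    have len: "length as = n" using that length_sem(2)[of Q'] by blast
    have "(b # as, c) \<in> sem_trm arr L (Suc n)" if "(b, c) \<in> ext \<alpha>" for b c
    proof -
      have "(as, c) \<in> sem_trm arr (subst_trm L 0 (TSum (bareps b))) n"
        using as that fv' unfolding tau_lam sem_qprod by (force simp: sem_tau)
      with len fv sem_subst_expand(1)[of L, rule_format, of as c 0 "TSum (bareps b)"] obtain b' where
        "(as, b') \<in> sem_trm arr (TSum (bareps b)) n" "(b' # as, c) \<in> sem_trm arr L (Suc n)"
        by (auto simp del: fv_trm.simps)
      then show ?thesis
        by - (rule sem_mono[OF fv _ order_refl, of "b' # as"], auto simp: sem_bareps list.rel_refl)
    qed
    then have "(as, arrows arr (ext \<alpha>)) \<in> sem_trm arr (Lam L) n"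
      unfolding sem_Lam_iff using len finite_ext by blast
    then show ?thesis by (simp add: arrows_ext tau_lam)
  qed
  moreover have "fv_tst Q' \<subseteq> {..<n}"
    using fv' fv_tau unfolding tau_lam fv_qprod by fastforce
  ultimately show ?thesis by blast
next
  case (tau_sum \<alpha> xs)
  let ?I = "{I. I \<subseteq> {..<length xs} \<and> Meet ((\<lambda>i. fst (xs ! i)) ` I) \<le> \<alpha>}"
  have fin: "finite ?I" by simp
  have fin': "finite I" if "I \<in> ?I" for I
    using that by (auto intro: finite_subset)
  have fv: "fv_tst (snd (xs ! i)) \<subseteq> {..<n}" if "I \<in> ?I" "i \<in> I" for i I
  proof -
    have "xs ! i \<in># mset xs" using that by (auto intro: nth_mem)
    then have "(fst (xs ! i), snd (xs ! i)) \<in># mset xs" by simp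
    then show ?thesis
      using assms(2) unfolding tau_sum fv_tst.simps fv_TSum_subset_iff by blast
  qed
  have "fv_tst Q' \<subseteq> {..<n}"
    unfolding tau_sum fv_qsum using fv fin fin' by (auto simp: fv_qprod)
  moreover have "as \<in> sem_tst arr Q n" if as: "as \<in> sem_tst arr Q' n" for as
  proof -
    from as obtain I where I: "I \<in> ?I" "length as = n" "\<And>i. i \<in> I \<Longrightarrow> as \<in> sem_tst arr (snd (xs ! i)) n"
      unfolding tau_sum sem_qsum using fin fin' by (auto simp: sem_qprod)
    have "Meet {\<beta>. \<exists>Q. (\<beta>, Q) \<in># mset xs \<and> as \<in> sem_tst arr Q n} \<le> Meet ((\<lambda>i. fst (xs ! i)) ` I)"
      using I by (intro Meet_antimono finite_sem_TSum) (force simp: subset_eq)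
    also have "\<dots> \<le> \<alpha>" using I(1) by simp
    finally show ?thesis
      unfolding tau_sum using I(2) by (simp add: sem_TSum_iff)
  qed
  ultimately show ?thesis by blast
next
  case (prod_sum Qs qss)
  have choice: "length qs = length Qs \<and> (\<forall>i<length Qs. qs ! i \<in># summands (Qs ! i))"
    if "qs \<in> set (product_lists qss)" for qs
    using that prod_sum(3) by (auto simp: product_lists_set list_all2_conv_all_nth)
  have 1: "\<exists>Q\<in>set Qs. q \<in># summands Q" if "qs \<in> set (product_lists qss)" "q \<in> set qs" for q qs
    using choice[OF that(1)] that(2) by (metis in_set_conv_nth)
  have 2: "\<exists>q\<in>set qs. q \<in># summands Q" if "qs \<in> set (product_lists qss)" "Q \<in> set Qs" for Q qs
    using choice[OF that(1)] that(2) by (metis in_set_conv_nth)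
  have "fv_tst q \<subseteq> {..<n}" if "qs \<in> set (product_lists qss)" "q \<in> set qs" for q qs
  proof -
    from 1[OF that] obtain Q' where "Q' \<in> set Qs" "q \<in># summands Q'" by blast
    with fv_summands[of Q'] assms(2) show ?thesis unfolding prod_sum by auto
  qed
  then have "fv_tst Q' \<subseteq> {..<n}"
    unfolding prod_sum fv_qsum by (auto simp: fv_qprod)
  moreover have "as \<in> sem_tst arr Q n" if as: "as \<in> sem_tst arr Q' n" for as
  proof -
    from as obtain qs where qs: "qs \<in> set (product_lists qss)" "length as = n"
      "\<And>q. q \<in> set qs \<Longrightarrow> as \<in> sem_tst arr q n"
      unfolding prod_sum sem_qsum by (auto simp: sem_qprod)
    have "as \<in> sem_tst arr R n" if "R \<in> set Qs" for R
      using 2[OF qs(1) that] qs(3) sem_summands[of R n] by blast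
    with qs show ?thesis unfolding prod_sum by simp
  qed
  ultimately show ?thesis by blast
qed

lemma sem_TSum_add_iff:
  "(as, \<gamma>) \<in> sem_trm arr (TSum (A + B)) n \<longleftrightarrow> (\<exists>\<alpha> \<beta>. (as, \<alpha>) \<in> sem_trm arr (TSum A) n \<and>
     (as, \<beta>) \<in> sem_trm arr (TSum B) n \<and> inf \<alpha> \<beta> \<le> \<gamma>)"
proof -
  have "{\<alpha>. \<exists>Q. (\<alpha>, Q) \<in># A + B \<and> as \<in> sem_tst arr Q n} =
    {\<alpha>. \<exists>Q. (\<alpha>, Q) \<in># A \<and> as \<in> sem_tst arr Q n} \<union> {\<alpha>. \<exists>Q. (\<alpha>, Q) \<in># B \<and> as \<in> sem_tst arr Q n}"
    by auto
  then show ?thesis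
    by (simp add: sem_TSum_iff Meet_Un) (meson inf_mono order_refl order_trans)
qed

lemma red_expand:
  shows "red_trm ext M M' \<Longrightarrow>
      \<forall>n. fv_trm M \<subseteq> {..<n} \<longrightarrow> fv_trm M' \<subseteq> {..<n} \<and> sem_trm arr M' n \<subseteq> sem_trm arr M n"
    and "red_tst ext Q Q' \<Longrightarrow>
      \<forall>n. fv_tst Q \<subseteq> {..<n} \<longrightarrow> fv_tst Q' \<subseteq> {..<n} \<and> sem_tst arr Q' n \<subseteq> sem_tst arr Q n"
proof (induction rule: red_trm_red_tst.inducts)
  case (1 M M')
  then show ?case using rule_trm_expand by blast
next
  case (2 M M')
  have "sem_trm arr (Lam M') n \<subseteq> sem_trm arr (Lam M) n"
    if "sem_trm arr M' (Suc n) \<subseteq> sem_trm arr M (Suc n)" for n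
    using that by (intro subrelI) (simp only: sem_Lam_iff, blast)
  with 2 show ?case unfolding fv_Lam_subset_iff by blast
next
  case (3 M M' N)
  have "sem_trm arr (App M' N) n \<subseteq> sem_trm arr (App M N) n"
    if "sem_trm arr M' n \<subseteq> sem_trm arr M n" for n
    using that by (intro subrelI) (simp only: sem_App_iff, blast)
  with 3 show ?case by simp
next
  case (4 N N' M)
  have "sem_trm arr (App M N') n \<subseteq> sem_trm arr (App M N) n"
    if "sem_trm arr N' n \<subseteq> sem_trm arr N n" for n
    using that by (intro subrelI) (simp only: sem_App_iff, blast)
  with 4 show ?case by simp
next
  case (5 Q Q' \<alpha>)
  have "sem_trm arr (TSum {#(\<alpha>, Q')#}) n \<subseteq> sem_trm arr (TSum {#(\<alpha>, Q)#}) n"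
    if "sem_tst arr Q' n \<subseteq> sem_tst arr Q n" for n
  proof (intro subrelI)
    fix as \<gamma> assume *: "(as, \<gamma>) \<in> sem_trm arr (TSum {#(\<alpha>, Q')#}) n"
    have "Meet {\<beta>. \<exists>R. (\<beta>, R) \<in># {#(\<alpha>, Q)#} \<and> as \<in> sem_tst arr R n}
        \<le> Meet {\<beta>. \<exists>R. (\<beta>, R) \<in># {#(\<alpha>, Q')#} \<and> as \<in> sem_tst arr R n}"
      using that by (intro Meet_antimono) auto
    with * show "(as, \<gamma>) \<in> sem_trm arr (TSum {#(\<alpha>, Q)#}) n"
      unfolding sem_TSum_iff by (blast intro: order_trans)
  qed
  with 5 show ?case by simp
next
  case (6 A A' B)
  have "sem_trm arr (TSum (A' + B)) n \<subseteq> sem_trm arr (TSum (A + B)) n"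
    if "sem_trm arr (TSum A') n \<subseteq> sem_trm arr (TSum A) n" for n
    using that by (intro subrelI) (simp only: sem_TSum_add_iff, blast)
  with 6 show ?case
    by (simp add: fv_TSum_subset_iff all_conj_distrib imp_conjR del: fv_trm.simps)
next
  case (7 Q Q')
  then show ?case using rule_tst_expand by blast
next
  case (8 M M' \<alpha>)
  then show ?case by auto
next
  case (9 Q Q' P)
  then show ?case by (simp add: fv_qsum sem_qsum) blast
next
  case (10 Q Q' P)
  then show ?case by (simp add: fv_qprod sem_qprod) blast
qed

lemma hred_imp_red:
  shows "hred_trm ext M M' \<Longrightarrow> red_trm ext M M'"
    and "hred_tst ext Q Q' \<Longrightarrow> red_tst ext Q Q'"
  by (induction rule: hred_trm_hred_tst.inducts) (auto intro: red_trm_red_tst.intros)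

lemma hreds_trm_expand:
  "(hred_trm ext)\<^sup>*\<^sup>* M M' \<Longrightarrow> fv_trm M \<subseteq> {..<n} \<Longrightarrow>
     fv_trm M' \<subseteq> {..<n} \<and> sem_trm arr M' n \<subseteq> sem_trm arr M n"
  by (induction rule: rtranclp_induct) (use hred_imp_red red_expand in blast)+

lemma hreds_tst_expand:
  "(hred_tst ext)\<^sup>*\<^sup>* Q Q' \<Longrightarrow> fv_tst Q \<subseteq> {..<n} \<Longrightarrow>
     fv_tst Q' \<subseteq> {..<n} \<and> sem_tst arr Q' n \<subseteq> sem_tst arr Q n"
  by (induction rule: rtranclp_induct) (use hred_imp_red red_expand in blast)+

end

lemma finite_fv:
  fixes M :: "'d trm" and Q :: "'d tst"
  shows "finite (fv_trm M)" and "finite (fv_tst Q)"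
proof (induction M and Q)
  case (Lam M)
  have "{i. Suc i \<in> fv_trm M} = Suc -` fv_trm M" by auto
  with Lam show ?case by (simp add: finite_vimageI)
next
  case (TSum A)
  have "finite (fv_tst (snd p))" if "p \<in># A" for p
    using TSum[OF that, of "snd p"] by (cases p) simp
  then show ?case by simp
qed simp_all

lemma fv_bound:
  obtains n where "fv_trm M \<subseteq> {..<n}"
  using finite_fv(1)[of M] unfolding finite_nat_set_iff_bounded by blast

section \<open>Head normal forms have a nontrivial interpretation\<close>

definition arrs :: "('d \<Rightarrow> 'd \<Rightarrow> 'd) \<Rightarrow> 'd list \<Rightarrow> 'd \<Rightarrow> 'd" where
  "arrs arr \<delta>s \<gamma> = foldr arr \<delta>s \<gamma>"

lemma arrs_simps [simp]:
  "arrs arr [] \<gamma> = \<gamma>" "arrs arr (\<delta> # \<delta>s) \<gamma> = arr \<delta> (arrs arr \<delta>s \<gamma>)"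
  by (simp_all add: arrs_def)

lemma arrs_append: "arrs arr (\<delta>s @ \<epsilon>s) \<gamma> = arrs arr \<delta>s (arrs arr \<epsilon>s \<gamma>)"
  by (simp add: arrs_def)

context defim
begin

lemma sem_foldl_App:
  assumes "(as, arrs arr (replicate (length Ms) top) \<beta>) \<in> sem_trm arr H n"
    "\<forall>M\<in>set Ms. fv_trm M \<subseteq> {..<n}" "length as = n"
  shows "(as, \<beta>) \<in> sem_trm arr (foldl App H Ms) n"
  using assms
proof (induction Ms arbitrary: H)
  case (Cons M Ms)
  let ?b = "arrs arr (replicate (length Ms) top) \<beta>"
  have "(as, ?b) \<in> sem_trm arr (App H M) n"
    unfolding sem_App_iff using Cons.prems by (intro conjI exI[of _ "{(top, ?b)}"]) (simp_all add: sem_top)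
  with Cons show ?case by simp
qed simp

lemma fv_foldl_App: "fv_trm (foldl App H Ms) = fv_trm H \<union> (\<Union>M\<in>set Ms. fv_trm M)"
  by (induction Ms arbitrary: H) auto

text \<open>All variables receive the type \<open>top\<close> \<rightarrow> ... \<rightarrow>
  \<open>top\<close> \<rightarrow> \<beta>, with one arrow per argument. The head then yields
  \<beta> whatever its arguments are, since each has the type \<open>top\<close>.\<close>

lemma sem_spine:
  assumes "fv_trm (foldl App (Var x) Ms) \<subseteq> {..<n}"
  shows "\<exists>as. length as = n \<and> (as, \<beta>) \<in> sem_trm arr (foldl App (Var x) Ms) n"
proof -
  let ?as = "replicate n (arrs arr (replicate (length Ms) top) \<beta>)"
  have "(?as, \<beta>) \<in> sem_trm arr (foldl App (Var x) Ms) n"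
    using assms by - (rule sem_foldl_App, auto simp: fv_foldl_App)
  then show ?thesis by (intro exI[of _ ?as]) simp
qed

text \<open>Environments for the single factors are combined by pointwise meet; by antitonicity the
  smaller environment satisfies every factor.\<close>

lemma sem_prod_nonempty:
  assumes "\<forall>P\<in>#A. fv_tst P \<subseteq> {..<n} \<and> sem_tst arr P n \<noteq> {}"
  shows "\<exists>bs. length bs = n \<and> (\<forall>P\<in>#A. bs \<in> sem_tst arr P n)"
  using assms
proof (induction A)
  case empty
  show ?case by (intro exI[of _ "replicate n undefined"]) simp
next
  case (add P A)
  then have "\<exists>bs. length bs = n \<and> (\<forall>P\<in>#A. bs \<in> sem_tst arr P n)" by simp
  moreover from add.prems have "\<exists>cs. cs \<in> sem_tst arr P n" by (simp add: ex_in_conv)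
  ultimately obtain bs cs where
    *: "length bs = n" "\<forall>P\<in>#A. bs \<in> sem_tst arr P n" "cs \<in> sem_tst arr P n"
    by (elim exE conjE)
  then have len: "length cs = n" using length_sem(2) by blast
  let ?bs = "map2 inf bs cs"
  have le: "list_all2 (\<le>) ?bs bs" "list_all2 (\<le>) ?bs cs"
    using * len by (auto simp: list_all2_conv_all_nth)
  have "?bs \<in> sem_tst arr P n"
    using add.prems *(3) le(2) by - (rule sem_tst_mono[of P n cs], auto)
  moreover have "?bs \<in> sem_tst arr R n" if "R \<in># A" for R
    using add.prems *(2) le(1) that by - (rule sem_tst_mono[of R n bs], auto)
  ultimately show ?case
    using * len by (intro exI[of _ ?bs]) auto
qed

lemma sem_hn_prod:
  assumes "hn_prod Q" "fv_tst Q \<subseteq> {..<n}"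
  shows "sem_tst arr Q n \<noteq> {}"
proof -
  from assms(1) obtain A where A: "Q = qprod A"
    "\<forall>P\<in>#A. \<exists>\<alpha> x Ms. P = Tau \<alpha> (foldl App (Var x) Ms)" unfolding hn_prod_def by blast
  have "fv_tst P \<subseteq> {..<n} \<and> sem_tst arr P n \<noteq> {}" if P: "P \<in># A" for P
  proof -
    from A P obtain \<alpha> x Ms where *: "P = Tau \<alpha> (foldl App (Var x) Ms)" by blast
    have fv: "fv_tst P \<subseteq> {..<n}"
      using assms(2) P unfolding A(1) fv_qprod by blast
    with sem_spine[of x Ms n \<alpha>] show ?thesis by (auto simp: *)
  qed
  then have "\<exists>bs. length bs = n \<and> (\<forall>P\<in>#A. bs \<in> sem_tst arr P n)"
    by (intro sem_prod_nonempty) blast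
  then show ?thesis unfolding A(1) sem_qprod by blast
qed

lemma sem_mhnf_tst: "mhnf_tst Q \<Longrightarrow> fv_tst Q \<subseteq> {..<n} \<Longrightarrow> sem_tst arr Q n \<noteq> {}"
  unfolding mhnf_tst_def using sem_hn_prod by (auto simp: sem_qsum fv_qsum)

lemma sem_Lam_nontop:
  assumes "(b # as, \<beta>) \<in> sem_trm arr M (Suc n)" "\<beta> \<noteq> top"
  shows "\<exists>\<gamma>. (as, \<gamma>) \<in> sem_trm arr (Lam M) n \<and> \<gamma> \<noteq> top"
proof -
  have "length as = n" using length_sem(1)[of M] assms(1) by fastforce
  then have "(as, arrows arr {(b, \<beta>)}) \<in> sem_trm arr (Lam M) n"
    unfolding sem_Lam_iff using assms by blast
  with assms(2) show ?thesis by auto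
qed

lemma sem_Lams_nontop:
  assumes "\<And>n. fv_trm M \<subseteq> {..<n} \<Longrightarrow> \<exists>as \<beta>. (as, \<beta>) \<in> sem_trm arr M n \<and> \<beta> \<noteq> top"
    "fv_trm ((Lam ^^ k) M) \<subseteq> {..<n}"
  shows "\<exists>as \<beta>. (as, \<beta>) \<in> sem_trm arr ((Lam ^^ k) M) n \<and> \<beta> \<noteq> top"
  using assms(2)
proof (induction k arbitrary: n)
  case 0
  then show ?case using assms(1) by simp
next
  case (Suc k)
  then have "fv_trm ((Lam ^^ k) M) \<subseteq> {..<Suc n}"
    using fv_Lam_subset_iff[of "(Lam ^^ k) M" n] by simp
  with Suc.IH obtain bs \<beta> where *: "(bs, \<beta>) \<in> sem_trm arr ((Lam ^^ k) M) (Suc n)" "\<beta> \<noteq> top"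
    by blast
  then obtain b as where "bs = b # as"
    using length_sem(1)[of "(Lam ^^ k) M"] by (metis length_Suc_conv)
  with * have "\<exists>\<gamma>. (as, \<gamma>) \<in> sem_trm arr (Lam ((Lam ^^ k) M)) n \<and> \<gamma> \<noteq> top"
    by (intro sem_Lam_nontop) simp_all
  then show ?case by auto
qed

text \<open>A spine headed by a variable can take any type, so one type other than
  \<open>top\<close> must exist in the model. A sum of bar-taus brings such a type with it as an
  index. Abstractions preserve the property because an arrow into a type other than
  \<open>top\<close> is not \<open>top\<close>.\<close>

lemma sem_mhnf_trm:
  assumes "mhnf_trm M" "fv_trm M \<subseteq> {..<n}" and nontrivial: "\<exists>\<alpha>::'d. \<alpha> \<noteq> top"
  shows "\<exists>as \<beta>. (as, \<beta>) \<in> sem_trm arr M n \<and> \<beta> \<noteq> top"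
  using assms(1) unfolding mhnf_trm_def
proof (elim disjE exE conjE)
  fix k y Ms assume M: "M = (Lam ^^ k) (foldl App (Var y) Ms)"
  show ?thesis
    unfolding M
  proof (rule sem_Lams_nontop)
    show "\<exists>as \<beta>. (as, \<beta>) \<in> sem_trm arr (foldl App (Var y) Ms) n \<and> \<beta> \<noteq> top"
      if "fv_trm (foldl App (Var y) Ms) \<subseteq> {..<n}" for n
      using sem_spine[OF that] nontrivial by blast
  qed (use assms(2) M in blast)
next
  fix k \<alpha> Q B assume M: "M = (Lam ^^ k) (TSum ({#(\<alpha>, Q)#} + B))" and \<alpha>: "\<alpha> \<noteq> top" and Q: "hn_prod Q"
  show ?thesis
    unfolding M
  proof (rule sem_Lams_nontop)
    show "\<exists>as \<beta>. (as, \<beta>) \<in> sem_trm arr (TSum ({#(\<alpha>, Q)#} + B)) n \<and> \<beta> \<noteq> top"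
      if fv: "fv_trm (TSum ({#(\<alpha>, Q)#} + B)) \<subseteq> {..<n}" for n
    proof -
      from fv have "fv_tst Q \<subseteq> {..<n}" by auto
      from sem_hn_prod[OF Q this] obtain bs where bs: "bs \<in> sem_tst arr Q n" by blast
      then have "length bs = n" using length_sem(2) by blast
      moreover have "Meet {\<beta>. \<exists>R. (\<beta>, R) \<in># {#(\<alpha>, Q)#} + B \<and> bs \<in> sem_tst arr R n} \<le> \<alpha>"
        using bs by (intro Meet_lower finite_sem_TSum) auto
      ultimately show ?thesis using \<alpha> unfolding sem_TSum_iff by blast
    qed
  qed (use assms(2) M in blast)
qed

section \<open>Sensibility yields a realizer\<close>

lemma wf_bareps: "TSum (bareps \<alpha>) \<in> Terms"
  by (auto simp: Terms_def bareps_def bartau_def)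

definition sem_realizer :: "'d \<Rightarrow> 'd trm set" where
  "sem_realizer \<alpha> = {M \<in> Terms. \<forall>n as. length as = n \<longrightarrow> fv_trm M \<subseteq> {..<n} \<longrightarrow>
     (as, \<alpha>) \<in> sem_trm arr M n}"

text \<open>The bar-epsilon of index \<alpha> is a generic realizer of \<alpha>: its types are
  exactly those above \<alpha>. Applying \<open>M\<close> to it therefore reveals whether
  \<open>M\<close> has the arrow type.\<close>

lemma sem_realizer_arr: "sem_realizer (arr \<alpha> \<beta>) = fun_space (sem_realizer \<alpha>) (sem_realizer \<beta>)"
proof (intro equalityI subsetI)
  fix M assume M: "M \<in> sem_realizer (arr \<alpha> \<beta>)"
  have "App M N \<in> sem_realizer \<beta>" if N: "N \<in> sem_realizer \<alpha>" for N
    unfolding sem_realizer_def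
  proof (intro CollectI conjI allI impI)
    show "App M N \<in> Terms" using M N by (simp add: sem_realizer_def Terms_def)
    fix n and as :: "'d list"
    assume "length as = n" "fv_trm (App M N) \<subseteq> {..<n}"
    with M N show "(as, \<beta>) \<in> sem_trm arr (App M N) n"
      unfolding sem_App_iff by (intro conjI exI[of _ "{(\<alpha>, \<beta>)}"]) (auto simp: sem_realizer_def)
  qed
  then show "M \<in> fun_space (sem_realizer \<alpha>) (sem_realizer \<beta>)"
    using M by (simp add: fun_space_def sem_realizer_def)
next
  fix M assume M: "M \<in> fun_space (sem_realizer \<alpha>) (sem_realizer \<beta>)"
  let ?N = "TSum (bareps \<alpha>) :: 'd trm"
  have "?N \<in> sem_realizer \<alpha>"
    by (simp add: sem_realizer_def wf_bareps sem_bareps del: fv_trm.simps)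
  with M have MN: "App M ?N \<in> sem_realizer \<beta>" "M \<in> Terms" by (auto simp: fun_space_def)
  show "M \<in> sem_realizer (arr \<alpha> \<beta>)"
    unfolding sem_realizer_def
  proof (intro CollectI conjI allI impI)
    fix n and as :: "'d list"
    assume as: "length as = n" "fv_trm M \<subseteq> {..<n}"
    then have "fv_trm (App M ?N) \<subseteq> {..<n}"
      by (simp del: fv_trm.simps(4))
    with as have "(as, \<beta>) \<in> sem_trm arr (App M ?N) n"
      using MN(1) unfolding sem_realizer_def by blast
    then obtain P where P: "finite P" "\<beta> = Meet (snd ` P)" "(as, arrows arr P) \<in> sem_trm arr M n"
      "\<alpha> \<le> Meet (fst ` P)"
      unfolding sem_App_iff sem_bareps by blast
    have "arrows arr P \<le> arr \<alpha> \<beta>"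
    proof -
      \<comment> \<open>All domains of \<open>P\<close> lie above \<alpha>, so every pair counts in
        the filter model condition.\<close>
      have "{\<delta> |\<gamma> \<delta>. (\<gamma>, \<delta>) \<in> P \<and> \<alpha> \<le> \<gamma>} = snd ` P"
        using P(1,4) by (force simp: le_Meet_iff)
      with P show ?thesis by (simp add: arrows_le_arr_iff)
    qed
    with P(3) as(2) show "(as, arr \<alpha> \<beta>) \<in> sem_trm arr M n" by (blast intro: sem_up)
  qed (fact MN(2))
qed

lemma sem_realizer_N_neg: "N_neg \<alpha> \<subseteq> sem_realizer \<alpha>"
proof
  fix M assume "M \<in> N_neg \<alpha>"
  then obtain b B where M: "M = TSum ((\<Sum>\<beta>\<in>#b. bareps \<beta>) + B)" "Meet (set_mset b) \<le> \<alpha>" "TSum B \<in> Terms"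
    by (auto simp: N_neg_def)
  have "M \<in> Terms"
    using M(3) by (auto simp: M(1) Terms_def set_mset_bareps split: if_splits)
  moreover have "(as, \<alpha>) \<in> sem_trm arr M n" if "length as = n" for as n
  proof -
    have "Meet {\<beta>. \<exists>Q. (\<beta>, Q) \<in># (\<Sum>\<beta>\<in>#b. bareps \<beta>) + B \<and> as \<in> sem_tst arr Q n} \<le> Meet (set_mset b)"
    proof (rule Meet_le_Meet[OF finite_sem_TSum])
      fix \<beta> assume "\<beta> \<in># b" "\<beta> \<noteq> top"
      then have "(\<beta>, QProd {#}) \<in># (\<Sum>\<beta>\<in>#b. bareps \<beta>) + B"
        by (auto simp: set_mset_bareps intro!: bexI[of _ \<beta>])
      with that show "\<exists>a\<in>{\<beta>. \<exists>Q. (\<beta>, Q) \<in># (\<Sum>\<beta>\<in>#b. bareps \<beta>) + B \<and> as \<in> sem_tst arr Q n}. a \<le> \<beta>"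
        by (intro bexI[of _ \<beta>] CollectI exI[of _ "QProd {#}"]) auto
    qed auto
    also note M(2)
    finally show ?thesis using that unfolding M(1) sem_TSum_iff by blast
  qed
  ultimately show "M \<in> sem_realizer \<alpha>" by (simp add: sem_realizer_def)
qed

lemma mhnf_empty_prod: "mhnf_tst (QProd {#} :: 'd tst)"
proof -
  have "hn_prod (QProd {#} :: 'd tst)"
    unfolding hn_prod_def by (intro exI[of _ "{#}"]) (simp add: qprod_def)
  moreover have "(QProd {#} :: 'd tst) = qplus (QProd {#}) (QSum {#})"
    by (rule qsum_single[symmetric]) (simp add: summands_def)
  ultimately show ?thesis unfolding mhnf_tst_def by blast
qed

text \<open>For an index above \<alpha> the test \<open>Tau\<close> holds in some environment, and
  sensibility turns a nonempty interpretation into convergence. The index \<open>top\<close> is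
  treated apart because \<open>tau\<close> then gives the empty product, a head normal form.\<close>

lemma sem_realizer_N_pos:
  assumes "sensible arr ext"
  shows "sem_realizer \<alpha> \<subseteq> N_pos ext \<alpha>"
proof
  fix M assume M: "M \<in> sem_realizer \<alpha>"
  have "converges_tst ext (tau \<beta> M)" if "\<alpha> \<le> \<beta>" for \<beta>
  proof (cases "\<beta> = top")
    case True
    then show ?thesis
      using mhnf_empty_prod by (auto simp: tau_def converges_tst_def)
  next
    case False
    obtain n where n: "fv_trm M \<subseteq> {..<n}" by (rule fv_bound)
    let ?as = "replicate n top :: 'd list"
    have "(?as, \<alpha>) \<in> sem_trm arr M n"
    proof -
      have "\<forall>n as. length as = n \<longrightarrow> fv_trm M \<subseteq> {..<n} \<longrightarrow> (as, \<alpha>) \<in> sem_trm arr M n"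
        using M by (simp add: sem_realizer_def)
      from this[rule_format, OF length_replicate n] show ?thesis .
    qed
    then have "?as \<in> sem_tst arr (Tau \<beta> M) n"
      using sem_up[OF n _ that] by simp
    moreover have "Tau \<beta> M \<in> Tests"
      using M False by (simp add: sem_realizer_def Terms_def Tests_def)
    moreover have "fv_tst (Tau \<beta> M) \<subseteq> {..<n}" using n by simp
    ultimately have "converges_tst ext (Tau \<beta> M)"
      using assms unfolding sensible_def by blast
    with False show ?thesis by (simp add: tau_def)
  qed
  then show "M \<in> N_pos ext \<alpha>"
    using M by (simp add: N_pos_def sem_realizer_def)
qed

lemma S_realizer_sem_realizer:
  assumes "sensible arr ext"
  shows "S_realizer arr ext sem_realizer"
  unfolding S_realizer_def
proof (intro conjI allI impI)
  fix \<alpha> \<beta> :: 'd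
  show "saturated ext (sem_realizer \<alpha>)"
    unfolding saturated_def
  proof (intro conjI ballI allI impI)
    fix M N assume M: "M \<in> Terms" "red_trm ext M N" "N \<in> sem_realizer \<alpha>"
    have "(as, \<alpha>) \<in> sem_trm arr M n" if "length as = n" "fv_trm M \<subseteq> {..<n}" for n as
      using red_expand(1)[OF M(2), rule_format, OF that(2)] M(3) that(1)
      unfolding sem_realizer_def by blast
    with M(1) show "M \<in> sem_realizer \<alpha>" by (simp add: sem_realizer_def)
  qed (simp add: sem_realizer_def)
  show "sem_realizer (inf \<alpha> \<beta>) = sem_realizer \<alpha> \<inter> sem_realizer \<beta>"
  proof (intro equalityI subsetI IntI)
    fix M assume "M \<in> sem_realizer (inf \<alpha> \<beta>)"
    then show "M \<in> sem_realizer \<alpha>" "M \<in> sem_realizer \<beta>"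
      unfolding sem_realizer_def by (blast intro: sem_up inf_le1 inf_le2)+
  next
    fix M assume "M \<in> sem_realizer \<alpha> \<inter> sem_realizer \<beta>"
    then show "M \<in> sem_realizer (inf \<alpha> \<beta>)"
      unfolding sem_realizer_def by (blast intro: sem_inf)
  qed
  show "sem_realizer (arr \<alpha> \<beta>) = fun_space (sem_realizer \<alpha>) (sem_realizer \<beta>)"
    by (rule sem_realizer_arr)
  show "sem_realizer top = Terms"
    unfolding sem_realizer_def by (auto intro: sem_top)
  show "N_neg \<alpha> \<subseteq> sem_realizer \<alpha>"
    by (rule sem_realizer_N_neg)
  show "sem_realizer \<alpha> \<subseteq> N_pos ext \<alpha>"
    by (rule sem_realizer_N_pos[OF assms])
qed

end

section \<open>Canonical forms\<close>

lemma Tests_simps: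
  "Tau \<alpha> M \<in> Tests \<longleftrightarrow> \<alpha> \<noteq> top \<and> M \<in> Terms"
  "QSum A \<in> Tests \<longleftrightarrow> size A \<noteq> 1 \<and> (\<forall>Q\<in>#A. \<not> is_QSum Q \<and> Q \<in> Tests)"
  "QProd A \<in> Tests \<longleftrightarrow> size A \<noteq> 1 \<and> (\<forall>Q\<in>#A. \<not> is_QProd Q \<and> Q \<in> Tests)"
  by (auto simp: Tests_def Terms_def)

lemma Terms_simps:
  "Var i \<in> Terms"
  "Lam M \<in> Terms \<longleftrightarrow> M \<in> Terms"
  "App M N \<in> Terms \<longleftrightarrow> M \<in> Terms \<and> N \<in> Terms"
  "TSum A \<in> Terms \<longleftrightarrow> (\<forall>\<alpha> Q. (\<alpha>, Q) \<in># A \<longrightarrow> \<alpha> \<noteq> top \<and> Q \<in> Tests)"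
  by (auto simp: Tests_def Terms_def)

lemma summands_nonsum: "\<not> is_QSum Q \<Longrightarrow> summands Q = {#Q#}"
  and factors_nonprod: "\<not> is_QProd Q \<Longrightarrow> factors Q = {#Q#}"
  by (cases Q; simp add: summands_def factors_def)+

lemma summands_QSum [simp]: "summands (QSum A) = A"
  and factors_QProd [simp]: "factors (QProd A) = A"
  by (simp_all add: summands_def factors_def)

lemma Tests_summands:
  assumes "Q \<in> Tests" "s \<in># summands Q"
  shows "s \<in> Tests" "\<not> is_QSum s"
  using assms by (cases Q; auto simp: summands_def Tests_simps)+

lemma Tests_factors:
  assumes "Q \<in> Tests" "s \<in># factors Q"
  shows "s \<in> Tests" "\<not> is_QProd s"
  using assms by (cases Q; auto simp: factors_def Tests_simps)+

lemma sum_mset_singletons: "(\<And>x. x \<in># A \<Longrightarrow> f x = {#x#}) \<Longrightarrow> (\<Sum>x\<in>#A. f x) = A"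
  by (induction A) auto

lemma qsum_summands: "Q \<in> Tests \<Longrightarrow> qsum (summands Q) = Q"
proof (cases Q)
  case (QSum A)
  assume "Q \<in> Tests"
  then have *: "size A \<noteq> 1" "\<And>R. R \<in># A \<Longrightarrow> summands R = {#R#}"
    by (auto simp: QSum Tests_simps summands_nonsum)
  have "(\<Sum>R\<in>#A. summands R) = A" by (rule sum_mset_singletons) (rule *)
  with *(1) show ?thesis using qsum_QSum[of A] by (simp add: QSum)
qed (simp_all add: summands_def qsum_def)

lemma qprod_factors: "Q \<in> Tests \<Longrightarrow> qprod (factors Q) = Q"
proof (cases Q)
  case (QProd A)
  assume "Q \<in> Tests"
  then have *: "size A \<noteq> 1" "\<And>R. R \<in># A \<Longrightarrow> factors R = {#R#}"
    by (auto simp: QProd Tests_simps factors_nonprod)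
  have "(\<Sum>R\<in>#A. factors R) = A" by (rule sum_mset_singletons) (rule *)
  with *(1) show ?thesis using qprod_QProd[of A] by (simp add: QProd)
qed (simp_all add: factors_def qprod_def)

lemma qsum_cong: "(\<Sum>Q\<in>#A. summands Q) = (\<Sum>Q\<in>#B. summands Q) \<Longrightarrow> qsum A = qsum B"
  and qprod_cong: "(\<Sum>Q\<in>#A. factors Q) = (\<Sum>Q\<in>#B. factors Q) \<Longrightarrow> qprod A = qprod B"
  by (simp_all add: qsum_def qprod_def)

lemma qsum_Tests: assumes "\<forall>Q\<in>#A. Q \<in> Tests" shows "qsum A \<in> Tests"
proof (cases A rule: qsum_cases)
  case (1 q)
  then have "q \<in># (\<Sum>Q\<in>#A. summands Q)" by simp
  then have "q \<in> Tests" using assms by (auto dest: Tests_summands)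
  with 1 show ?thesis by simp
next
  case 2
  with assms show ?thesis by (auto simp: Tests_simps dest: Tests_summands)
qed

lemma qprod_Tests: assumes "\<forall>Q\<in>#A. Q \<in> Tests" shows "qprod A \<in> Tests"
proof (cases A rule: qprod_cases)
  case (1 q)
  then have "q \<in># (\<Sum>Q\<in>#A. factors Q)" by simp
  then have "q \<in> Tests" using assms by (auto dest: Tests_factors)
  with 1 show ?thesis by simp
next
  case 2
  with assms show ?thesis by (auto simp: Tests_simps dest: Tests_factors)
qed

lemma summands_qsum:
  assumes "\<forall>Q\<in>#A. Q \<in> Tests" shows "summands (qsum A) = (\<Sum>Q\<in>#A. summands Q)"
proof (cases A rule: qsum_cases)
  case (1 q)
  then have "q \<in># (\<Sum>Q\<in>#A. summands Q)" by simp
  then have "\<not> is_QSum q" using assms by (auto dest: Tests_summands)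
  with 1 show ?thesis by (simp add: summands_nonsum)
qed simp

lemma factors_qprod:
  assumes "\<forall>Q\<in>#A. Q \<in> Tests" shows "factors (qprod A) = (\<Sum>Q\<in>#A. factors Q)"
proof (cases A rule: qprod_cases)
  case (1 q)
  then have "q \<in># (\<Sum>Q\<in>#A. factors Q)" by simp
  then have "\<not> is_QProd q" using assms by (auto dest: Tests_factors)
  with 1 show ?thesis by (simp add: factors_nonprod)
qed simp

lemma is_QSum_lift [simp]: "is_QSum (lift_tst Q k) = is_QSum Q"
  and is_QProd_lift [simp]: "is_QProd (lift_tst Q k) = is_QProd Q"
  and is_QSum_subst [simp]: "is_QSum (subst_tst Q k N) = is_QSum Q"
  and is_QProd_subst [simp]: "is_QProd (subst_tst Q k N) = is_QProd Q"
  by (cases Q; simp)+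

lemma lift_Terms:
  fixes M :: "'d::bounded_semilattice_inf_top trm" and Q :: "'d tst"
  shows "\<forall>k. M \<in> Terms \<longrightarrow> lift_trm M k \<in> Terms"
    and "\<forall>k. Q \<in> Tests \<longrightarrow> lift_tst Q k \<in> Tests"
proof (induction M and Q)
  case (TSum A)
  have "lift_tst Q k \<in> Tests" if "(\<alpha>, Q) \<in># A" "Q \<in> Tests" for \<alpha> Q k
    using TSum[OF that(1), of Q] that(2) by simp
  then show ?case by (simp add: Terms_simps mem_map_prod_id_iff) blast
qed (simp_all add: Terms_simps Tests_simps)

lemma subst_Terms:
  fixes M :: "'d::bounded_semilattice_inf_top trm" and Q :: "'d tst"
  shows "\<forall>k N. M \<in> Terms \<longrightarrow> N \<in> Terms \<longrightarrow> subst_trm M k N \<in> Terms"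
    and "\<forall>k N. Q \<in> Tests \<longrightarrow> N \<in> Terms \<longrightarrow> subst_tst Q k N \<in> Tests"
proof (induction M and Q)
  case (TSum A)
  have "subst_tst Q k N \<in> Tests" if "(\<alpha>, Q) \<in># A" "Q \<in> Tests" "N \<in> Terms" for \<alpha> Q k N
    using TSum[OF that(1), of Q] that(2,3) by simp
  then show ?case by (simp add: Terms_simps mem_map_prod_id_iff) blast
qed (simp_all add: Terms_simps Tests_simps lift_Terms)

lemma tau_Tests: "M \<in> Terms \<Longrightarrow> tau \<alpha> M \<in> Tests"
  by (simp add: tau_def Tests_simps)

lemma product_lists_summands:
  assumes "list_all2 (\<lambda>Q qs. summands Q = mset qs) Qs qss"
  shows "qs \<in> set (product_lists qss) \<longleftrightarrow> list_all2 (\<lambda>q Q. q \<in># summands Q) qs Qs"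
  using assms by (auto simp: product_lists_set list_all2_conv_all_nth)

section \<open>Convergence of tests, syntax-directed\<close>

fun head_var :: "'d trm \<Rightarrow> bool" where
  "head_var (Var i) = True"
| "head_var (App M N) = head_var M"
| "head_var _ = False"

lemma head_var_foldl [simp]: "head_var (foldl App M Ms) = head_var M"
  by (induction Ms arbitrary: M) auto

lemma head_var_spine: "head_var M \<Longrightarrow> \<exists>x Ms. M = foldl App (Var x) Ms"
proof (induction M rule: head_var.induct)
  case (1 i)
  then show ?case by (intro exI[of _ i] exI[of _ "[]"]) simp
next
  case (2 M N)
  then obtain x Ms where "M = foldl App (Var x) Ms" by auto
  then show ?case by (intro exI[of _ x] exI[of _ "Ms @ [N]"]) simp
qed simp_all

text \<open>The deterministic core of head reduction: it works at the head of an application, never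
  under an abstraction or inside a sum of bar-taus. On applications it agrees with head
  reduction.\<close>

inductive whd ::
  "('d::bounded_semilattice_inf_top \<Rightarrow> ('d \<times> 'd) set) \<Rightarrow> 'd trm \<Rightarrow> 'd trm \<Rightarrow> bool"
  for ext where
  whd_beta: "whd ext (App (Lam M) N) (subst_trm M 0 N)"
| whd_sum: "whd ext (App (TSum A) N) (TSum (sum_app ext A N))"
| whd_App: "whd ext M M' \<Longrightarrow> whd ext (App M N) (App M' N)"

inductive_cases whd_LamE: "whd ext (Lam M) M'"
inductive_cases whd_TSumE: "whd ext (TSum A) M'"
inductive_cases whd_VarE: "whd ext (Var i) M'"

lemma whd_det: "whd ext M M' \<Longrightarrow> whd ext M M'' \<Longrightarrow> M' = M''"
proof (induction arbitrary: M'' rule: whd.induct)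
  case (whd_beta M N)
  then show ?case by cases (auto elim: whd_LamE)
next
  case (whd_sum A N)
  then show ?case by cases (auto elim: whd_TSumE)
next
  case (whd_App M M' N)
  from whd_App.prems show ?case
  proof cases
    case (whd_App M\<^sub>1)
    then show ?thesis using whd_App.IH by simp
  qed (use whd_App.hyps in \<open>auto elim: whd_LamE whd_TSumE\<close>)
qed

lemma whd_is_App: "whd ext M M' \<Longrightarrow> is_App M"
  by (auto elim: whd.cases)

lemma head_var_not_whd: "head_var M \<Longrightarrow> \<not> whd ext M M'"
proof (induction M arbitrary: M' rule: head_var.induct)
  case (2 M N)
  show ?case
  proof
    assume "whd ext (App M N) M'"
    then show False using 2 by cases auto
  qed
qed (auto elim: whd_VarE)

lemma whd_hred: "whd ext M M' \<Longrightarrow> hred_trm ext M M'"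
proof (induction rule: whd.induct)
  case (whd_sum A N)
  show ?case unfolding sum_app_def by (intro hred_trm_hred_tst.intros(1) rule_trm.sum_app)
qed (auto intro: hred_trm_hred_tst.intros rule_trm.beta dest: whd_is_App)

inductive tau_step ::
  "('d::bounded_semilattice_inf_top \<Rightarrow> ('d \<times> 'd) set) \<Rightarrow> 'd \<Rightarrow> 'd trm \<Rightarrow> 'd tst \<Rightarrow> bool"
  for ext where
  tau_whd: "whd ext M M' \<Longrightarrow> tau_step ext \<alpha> M (Tau \<alpha> M')"
| tau_rule: "rule_tst ext (Tau \<alpha> M) Q \<Longrightarrow> tau_step ext \<alpha> M Q"

lemma tau_step_hred: "tau_step ext \<alpha> M Q \<Longrightarrow> hred_tst ext (Tau \<alpha> M) Q"
  by (induction rule: tau_step.induct)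
    (auto intro: hred_trm_hred_tst.intros whd_hred dest: whd_is_App)

text \<open>The index counts the nested head reductions of tests \<open>\<tau>\<^bsub>\<alpha>\<^esub>(M)\<close> only, so that products and
  sums, canonical or not, can be decomposed at constant index.\<close>

inductive cv ::
  "('d::bounded_semilattice_inf_top \<Rightarrow> ('d \<times> 'd) set) \<Rightarrow> nat \<Rightarrow> 'd tst \<Rightarrow> bool"
  for ext where
  cv_QSum: "Q \<in># A \<Longrightarrow> cv ext n Q \<Longrightarrow> cv ext n (QSum A)"
| cv_QProd: "(\<And>Q. Q \<in># A \<Longrightarrow> cv ext n Q) \<Longrightarrow> cv ext n (QProd A)"
| cv_var: "head_var M \<Longrightarrow> cv ext n (Tau \<alpha> M)"
| cv_step: "tau_step ext \<alpha> M Q \<Longrightarrow> cv ext n Q \<Longrightarrow> cv ext (Suc n) (Tau \<alpha> M)"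

inductive_cases cv_TauE: "cv ext n (Tau \<alpha> M)"

lemma cv_QSum_iff: "cv ext n (QSum A) \<longleftrightarrow> (\<exists>Q\<in>#A. cv ext n Q)"
  by (auto intro: cv_QSum elim: cv.cases)

lemma cv_QProd_iff: "cv ext n (QProd A) \<longleftrightarrow> (\<forall>Q\<in>#A. cv ext n Q)"
  by (auto intro: cv_QProd elim: cv.cases)

lemma cv_mono: "cv ext n Q \<Longrightarrow> n \<le> m \<Longrightarrow> cv ext m Q"
proof (induction arbitrary: m rule: cv.induct)
  case (cv_step \<alpha> M Q n)
  then obtain m' where "m = Suc m'" "n \<le> m'" by (cases m) auto
  with cv_step show ?case by (auto intro: cv.cv_step)
qed (auto intro: cv.intros)

lemma cv_summands: "cv ext n Q \<longleftrightarrow> (\<exists>s\<in>#summands Q. cv ext n s)"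
  by (cases Q) (simp_all add: summands_def cv_QSum_iff)

lemma cv_factors: "cv ext n Q \<longleftrightarrow> (\<forall>s\<in>#factors Q. cv ext n s)"
  by (cases Q) (simp_all add: factors_def cv_QProd_iff)

lemma cv_qsum_iff: "cv ext n (qsum A) \<longleftrightarrow> (\<exists>Q\<in>#A. cv ext n Q)"
proof -
  have "cv ext n (qsum A) \<longleftrightarrow> (\<exists>s\<in>#(\<Sum>Q\<in>#A. summands Q). cv ext n s)"
    by (cases A rule: qsum_cases) (simp_all add: cv_QSum_iff del: set_mset_sum_image)
  then show ?thesis by (simp add: cv_summands[symmetric])
qed

lemma cv_qprod_iff: "cv ext n (qprod A) \<longleftrightarrow> (\<forall>Q\<in>#A. cv ext n Q)"
proof -
  have "cv ext n (qprod A) \<longleftrightarrow> (\<forall>s\<in>#(\<Sum>Q\<in>#A. factors Q). cv ext n s)"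
    by (cases A rule: qprod_cases) (simp_all add: cv_QProd_iff del: set_mset_sum_image)
  then show ?thesis by (simp add: cv_factors[symmetric])
qed

lemma cv_Tau_step: "cv ext n (Tau \<alpha> M) \<Longrightarrow> \<not> head_var M \<Longrightarrow>
    \<exists>m Q. n = Suc m \<and> tau_step ext \<alpha> M Q \<and> cv ext m Q"
  by (erule cv_TauE; blast)

lemma prod_sum_cv:
  assumes "list_all2 (\<lambda>Q qs. summands Q = mset qs) Qs qss"
    "cv ext n (qsum (mset (map (\<lambda>qs. qprod (mset qs)) (product_lists qss))))"
  shows "cv ext n (QProd (mset Qs))"
proof -
  from assms(2) obtain qs where "qs \<in> set (product_lists qss)" "\<forall>q\<in>set qs. cv ext n q"
    by (auto simp: cv_qsum_iff cv_qprod_iff)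
  then have "\<exists>q\<in>#summands Q. cv ext n q" if "Q \<in> set Qs" for Q
    using that unfolding product_lists_summands[OF assms(1)]
    by (metis in_set_conv_nth list_all2_conv_all_nth)
  then show ?thesis by (simp add: cv_QProd_iff cv_summands[symmetric])
qed

text \<open>Head expansion preserves \<open>cv\<close>, possibly with a larger index. The first
  claim serves the context \<open>Tau\<close>, which admits head steps of applications only, and
  these are weak head steps. In a product the indices of the factors are brought to a common value
  by \<open>cv_mono\<close>.\<close>

lemma hred_expand_cv:
  shows "hred_trm ext M M' \<Longrightarrow> is_App M \<longrightarrow> whd ext M M'"
    and "hred_tst ext Q Q' \<Longrightarrow> \<forall>n. cv ext n Q' \<longrightarrow> (\<exists>m. cv ext m Q)"
proof (induction rule: hred_trm_hred_tst.inducts)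
  case (1 M M')
  then show ?case
  proof cases
    case (sum_app A N)
    then show ?thesis using whd_sum[of ext A N] by (simp add: sum_app_def)
  qed (auto intro: whd_beta)
next
  case (6 Q Q')
  then show ?case
  proof cases
    case (prod_sum Qs qss)
    then show ?thesis using prod_sum_cv by blast
  qed (use 6 cv_step tau_rule in blast)+
next
  case (7 M M' \<alpha>)
  then show ?case by (blast intro: cv_step tau_whd)
next
  case (8 Q Q' P)
  then show ?case by (auto simp: cv_qsum_iff)
next
  case (9 Q Q' P)
  show ?case
  proof (intro allI impI)
    fix n assume "cv ext n (qtimes Q' P)"
    with 9 obtain m where "cv ext m Q" "cv ext n P" by (auto simp: cv_qprod_iff)
    then have "cv ext (max m n) Q" "cv ext (max m n) P" by (auto intro: cv_mono)
    then show "\<exists>m. cv ext m (qtimes Q P)" by (auto simp: cv_qprod_iff)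
  qed
qed (auto intro: whd_App)

lemma mhnf_cv: "mhnf_tst Q \<Longrightarrow> cv ext n Q"
  unfolding mhnf_tst_def hn_prod_def
  by (force simp: cv_qsum_iff cv_qprod_iff intro: cv_var)

lemma converges_cv:
  assumes "converges_tst ext Q"
  obtains n where "cv ext n Q"
proof -
  from assms obtain P where "(hred_tst ext)\<^sup>*\<^sup>* Q P" "mhnf_tst P"
    by (auto simp: converges_tst_def)
  then have "\<exists>n. cv ext n Q"
  proof (induction rule: converse_rtranclp_induct)
    case base
    then show ?case using mhnf_cv by blast
  next
    case (step Q Q')
    then show ?case using hred_expand_cv(2) by blast
  qed
  with that show ?thesis by blast
qed

section \<open>Syntax-directed convergence implies convergence\<close>

context defim
begin

lemma sum_app_Terms:
  assumes "TSum A \<in> Terms" "N \<in> Terms" shows "TSum (sum_app ext A N) \<in> Terms"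
proof -
  have "\<gamma> \<noteq> top \<and> Q' \<in> Tests" if Q': "(\<gamma>, Q') \<in># sum_app ext A N" for \<gamma> Q'
  proof -
    from Q' obtain \<alpha> Q \<beta> where *: "\<gamma> \<noteq> top" "(\<alpha>, Q) \<in># A" "Q' = qtimes Q (tau \<beta> N)"
      unfolding mem_sum_app_iff by (elim exE conjE)
    then have "Q \<in> Tests" using assms(1) by (auto simp: Terms_simps)
    with * assms(2) show ?thesis by (auto intro!: qprod_Tests tau_Tests)
  qed
  then show ?thesis by (simp add: Terms_simps)
qed

lemma whd_Terms: "whd ext M M' \<Longrightarrow> M \<in> Terms \<Longrightarrow> M' \<in> Terms"
  by (induction rule: whd.induct) (simp_all add: Terms_simps(2,3) subst_Terms sum_app_Terms)

lemma tau_step_Tests: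
  assumes "tau_step ext \<alpha> M Q" "Tau \<alpha> M \<in> Tests" shows "Q \<in> Tests"
  using assms
proof cases
  case (tau_whd M')
  with assms show ?thesis by (simp add: Tests_simps whd_Terms)
next
  case tau_rule
  then show ?thesis
  proof cases
    case (tau_lam L)
    with assms(2) have "L \<in> Terms" by (simp add: Tests_simps Terms_simps)
    then show ?thesis
      unfolding tau_lam by (auto intro!: qprod_Tests tau_Tests simp: subst_Terms wf_bareps)
  next
    case (tau_sum xs)
    have *: "snd (xs ! i) \<in> Tests" if "i < length xs" for i
    proof -
      have "(fst (xs ! i), snd (xs ! i)) \<in># mset xs" using that by simp
      with assms(2) show ?thesis unfolding tau_sum Tests_simps Terms_simps by blast
    qed
    have "qprod {#snd (xs ! i). i \<in># mset_set I#} \<in> Tests" if "I \<subseteq> {..<length xs}" for I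
      using that finite_subset[OF that] by (intro qprod_Tests) (auto intro: *)
    then show ?thesis unfolding tau_sum by (intro qsum_Tests) auto
  qed
qed

text \<open>A head step followed by the choice of one summand. Reaching a may-head-normal form
  requires a single summand to become head normal, so the others can be set aside; and after the
  choice the test is again no sum, as the contexts of products and bar-taus demand.\<close>

inductive may :: "'d tst \<Rightarrow> 'd tst \<Rightarrow> bool" where
  "\<not> is_QSum Q \<Longrightarrow> Q \<in> Tests \<Longrightarrow> R \<in> Tests \<Longrightarrow> hred_tst ext Q R \<Longrightarrow> Q' \<in># summands R \<Longrightarrow> may Q Q'"

definition good :: "'d tst \<Rightarrow> bool" where
  "good Q \<longleftrightarrow> (\<exists>Q'\<in>#summands Q. \<exists>H. may\<^sup>*\<^sup>* Q' H \<and> hn_prod H)"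

lemma good_step: "\<not> is_QSum Q \<Longrightarrow> Q \<in> Tests \<Longrightarrow> R \<in> Tests \<Longrightarrow> hred_tst ext Q R \<Longrightarrow> good R \<Longrightarrow> good Q"
  unfolding good_def by (auto simp: summands_nonsum intro: may.intros converse_rtranclp_into_rtranclp)

lemma good_qsum:
  assumes "\<forall>Q\<in>#A. Q \<in> Tests" "Q \<in># A" "good Q" shows "good (qsum A)"
  using assms(2,3) unfolding good_def summands_qsum[OF assms(1)] by auto

text \<open>At equal index the size decides, as flattening a product or choosing a summand keeps the
  index. A head step lowers the index and may enlarge the test.\<close>

definition worklist_less :: "((nat \<times> 'd tst) \<times> (nat \<times> 'd tst)) set" where
  "worklist_less = inv_image (less_than <*lex*> less_than) (\<lambda>(n, Q). (n, size Q))"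

lemma wf_worklist: "wf (mult worklist_less)"
  unfolding worklist_less_def by (intro wf_mult wf_inv_image wf_lex_prod wf_less_than)

lemma size_multiset_mem: "x \<in># A \<Longrightarrow> f x < size_multiset f A"
  by (auto dest!: multi_member_split)

lemma worklist_less_iff:
  "((n, Q), (m, P)) \<in> worklist_less \<longleftrightarrow> n < m \<or> n = m \<and> size Q < size P"
  by (auto simp: worklist_less_def)

lemma worklist_less_component:
  "q \<in># A \<Longrightarrow> ((n, q), (n, QProd A)) \<in> worklist_less"
  "q \<in># A \<Longrightarrow> ((n, q), (n, QSum A)) \<in> worklist_less"
  using size_multiset_mem[of q A size] by (simp_all add: worklist_less_iff)

lemma sum_mset_factors_nonprod:
  "\<forall>Q\<in>#A. \<not> is_QProd Q \<Longrightarrow> (\<Sum>Q\<in>#A. factors Q) = A"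
  by (rule sum_mset_singletons) (simp add: factors_nonprod)

text \<open>All factors of a product have to be developed together, since distributing a product over a
  sum develops every sum among its factors: hence a whole multiset of pending tests, with the
  multiset order on their indices and sizes.\<close>

lemma good_worklist:
  "\<forall>(n, Q)\<in>#W. cv ext n Q \<and> Q \<in> Tests \<Longrightarrow> good (qprod (image_mset snd W))"
proof (induction W rule: wf_induct_rule[OF wf_worklist])
  case (1 W)
  have cv: "cv ext n Q" "Q \<in> Tests" if "(n, Q) \<in># W" for n Q
    using 1(2) that by auto
  \<comment> \<open>The multiset order in the form used below: a nonempty part \<open>I\<close> of
    the worklist is traded for smaller entries \<open>J\<close>.\<close>
  have IH: "good (qprod (image_mset snd (K + J)))"
    if "W = K + I" "I \<noteq> {#}" "\<And>n Q. (n, Q) \<in># J \<Longrightarrow> cv ext n Q \<and> Q \<in> Tests"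
      "\<And>j. j \<in># J \<Longrightarrow> \<exists>i\<in>#I. (j, i) \<in> worklist_less" for K I J
  proof (rule 1(1))
    show "(K + J, W) \<in> mult worklist_less"
      unfolding that(1) by (rule one_step_implies_mult) (use that in auto)
    show "\<forall>(n, Q)\<in>#K + J. cv ext n Q \<and> Q \<in> Tests"
      using cv that(1,3) by auto
  qed
  let ?B = "image_mset snd W"
  have B_Tests: "\<forall>Q\<in>#?B. Q \<in> Tests" using cv(2) by auto
  consider (prod) "\<exists>p\<in>#W. is_QProd (snd p)"
    | (sum) "\<forall>Q\<in>#?B. \<not> is_QProd Q" "\<exists>p\<in>#W. is_QSum (snd p)"
    | (taus) "\<forall>Q\<in>#?B. \<not> is_QProd Q" "\<forall>Q\<in>#?B. \<not> is_QSum Q"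
    by auto
  then show ?case
  proof cases
    case prod
    then obtain p where "p \<in># W" "is_QProd (snd p)" by blast
    then obtain n C where prod: "(n, QProd C) \<in># W"
      by (cases p; cases "snd p") auto
    then obtain W\<^sub>0 where W: "W = W\<^sub>0 + {#(n, QProd C)#}"
      by (metis add_mset_add_single multi_member_split)
    from cv[OF prod] have C: "cv ext n (QProd C)" "QProd C \<in> Tests" by auto
    \<comment> \<open>Flattening an inner product shrinks the worklist but leaves the canonical
      product unchanged, so no reduction step corresponds to it.\<close>
    have "good (qprod (image_mset snd (W\<^sub>0 + image_mset (Pair n) C)))"
      using C by (intro IH[OF W]) (auto simp: Tests_simps cv_QProd_iff worklist_less_component)
    moreover have "(\<Sum>Q\<in>#C. factors Q) = C"
      using C by (intro sum_mset_factors_nonprod) (simp add: Tests_simps)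
    then have "qprod (image_mset snd (W\<^sub>0 + image_mset (Pair n) C)) = qprod ?B"
      unfolding W by (intro qprod_cong) (simp add: multiset.map_comp comp_def)
    ultimately show ?thesis by simp
  next
    case nonprod: sum
    then obtain p where "p \<in># W" "is_QSum (snd p)" by blast
    then obtain n C where "(n, QSum C) \<in># W"
      by (cases p; cases "snd p") auto
    note sum = nonprod(1) this
    show ?thesis
    proof (cases "size W = 1")
      \<comment> \<open>A sum that is the only pending test is itself the whole product, with
        nothing to distribute; goodness of one summand is goodness of the sum.\<close>
      case True
      with sum have W: "W = {#} + {#(n, QSum C)#}"
        by (metis add.left_neutral size_1_singleton_mset set_mset_add_mset_insert set_mset_empty singletonD)
      from cv[OF sum(2)] obtain q where q: "q \<in># C" "cv ext n q" "q \<in> Tests" "\<not> is_QSum q" "QSum C \<in> Tests"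
        by (auto simp: cv_QSum_iff Tests_simps)
      have "good (qprod (image_mset snd ({#} + {#(n, q)#})))"
        using q by (intro IH[OF W]) (auto simp: worklist_less_component)
      moreover have "qprod {#q#} = q"
        using qprod_factors[OF q(3)] qprod_cong[of "{#q#}" "factors q"] Tests_factors[OF q(3)]
        by (simp add: sum_mset_factors_nonprod)
      moreover have "qprod {#QSum C#} = QSum C"
        by (rule qprod_single) (simp add: factors_def)
      ultimately show ?thesis
        using q unfolding W good_def by (auto simp: summands_nonsum)
    next
      case False
      \<comment> \<open>A converging summand is chosen in every pending test at once, because the
        distribution rule opens all sums together.\<close>
      define f where "f = (\<lambda>(n, Q). (n :: nat, SOME q. q \<in># summands Q \<and> cv ext n q))"
      have f: "snd (f p) \<in># summands (snd p)" "cv ext (fst p) (snd (f p))" "fst (f p) = fst p"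
        if "p \<in># W" for p
      proof -
        have "\<exists>q. q \<in># summands (snd p) \<and> cv ext (fst p) q"
          using cv(1)[of "fst p" "snd p"] that cv_summands by fastforce
        from someI_ex[OF this]
        show "snd (f p) \<in># summands (snd p)" "cv ext (fst p) (snd (f p))" "fst (f p) = fst p"
          by (simp_all add: f_def split_beta)
      qed
      let ?K = "{#p \<in># W. \<not> is_QSum (snd p)#}" and ?I = "{#p \<in># W. is_QSum (snd p)#}"
      \<comment> \<open>Entries that are no sums are fixed by \<open>f\<close>, so that exactly the
        sums are replaced, each by a smaller entry.\<close>
      have fK: "image_mset f ?K = ?K"
      proof -
        have "f p = p" if "p \<in># ?K" for p
          using f[of p] that by (auto simp: summands_nonsum prod_eq_iff)
        then have "image_mset f ?K = image_mset (\<lambda>p. p) ?K" by (rule image_mset_cong)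
        then show ?thesis by simp
      qed
      have "good (qprod (image_mset snd (?K + image_mset f ?I)))"
      proof (rule IH)
        show "W = ?K + ?I" by (metis multiset_partition add.commute)
        show "?I \<noteq> {#}" using sum(2) by (auto simp: filter_mset_eq_conv intro!: bexI[of _ "(n, QSum C)"])
        show "cv ext m Q \<and> Q \<in> Tests" if mem: "(m, Q) \<in># image_mset f ?I" for m Q
        proof -
          from mem obtain p where "p \<in># W" "(m, Q) = f p" by auto
          with f[of p] cv(2)[of "fst p" "snd p"] Tests_summands(1)[of "snd p" Q] show ?thesis
            by (metis fst_conv prod.collapse snd_conv)
        qed
        show "\<exists>i\<in>#?I. (j, i) \<in> worklist_less" if mem: "j \<in># image_mset f ?I" for j
        proof -
          from mem obtain p where p: "p \<in># ?I" "j = f p" by auto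
          then obtain m A where "p = (m, QSum A)" by (cases p; cases "snd p") auto
          with p f[of p] show ?thesis
            by (intro bexI[of _ p]) (cases "f p"; auto intro: worklist_less_component)+
        qed
      qed
      also have "?K + image_mset f ?I = image_mset f W"
        by (metis fK image_mset_union multiset_partition add.commute)
      finally have good: "good (qprod (image_mset snd (image_mset f W)))" .
      obtain ws where ws: "mset ws = W" using ex_mset by blast
      define Qs where "Qs = map snd ws"
      have Qs: "mset Qs = ?B" by (simp add: Qs_def ws[symmetric])
      define qss where "qss = map (\<lambda>Q. SOME qs. mset qs = summands Q) Qs"
      have qss: "list_all2 (\<lambda>Q qs. summands Q = mset qs) Qs qss"
        by (simp add: qss_def list_all2_conv_all_nth someI_ex[OF ex_mset])
      let ?R = "qsum (mset (map (\<lambda>qs. qprod (mset qs)) (product_lists qss)))"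
      have "size ?B \<noteq> 1" using False by simp
      then have B: "qprod ?B = QProd (mset Qs)"
        using sum(1) qprod_QProd[of ?B] by (simp add: Qs sum_mset_factors_nonprod)
      have hred: "hred_tst ext (qprod ?B) ?R"
        unfolding B
      proof (intro hred_trm_hred_tst.intros(6) rule_tst.prod_sum qss)
        have "QSum C \<in># mset Qs" unfolding Qs using sum(2) by (force intro: rev_image_eqI)
        then show "\<exists>Q\<in>set Qs. is_QSum Q" by force
      qed
      \<comment> \<open>The chosen summands form one of the products in the distributed sum, so the
        goodness obtained from the induction hypothesis reaches that sum.\<close>
      have choice: "map (snd \<circ> f) ws \<in> set (product_lists qss)"
        unfolding product_lists_summands[OF qss]
        using f(1) by (auto simp: Qs_def list_all2_conv_all_nth ws[symmetric])
      have R: "\<forall>Q\<in>#mset (map (\<lambda>qs. qprod (mset qs)) (product_lists qss)). Q \<in> Tests"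
      proof -
        have "q \<in> Tests" if "qs \<in> set (product_lists qss)" "q \<in> set qs" for q qs
        proof -
          have "\<exists>Q\<in>set Qs. q \<in># summands Q"
            using that unfolding product_lists_summands[OF qss]
            by (metis in_set_conv_nth list_all2_conv_all_nth)
          moreover have "set Qs = set_mset ?B" using Qs by (metis set_mset_mset)
          ultimately show ?thesis using B_Tests Tests_summands(1) by blast
        qed
        then show ?thesis by (auto intro!: qprod_Tests)
      qed
      have "good ?R"
      proof (rule good_qsum[OF R])
        show "qprod (mset (map (snd \<circ> f) ws)) \<in># mset (map (\<lambda>qs. qprod (mset qs)) (product_lists qss))"
          using imageI[OF choice, of "\<lambda>qs. qprod (mset qs)"] by simp
        show "good (qprod (mset (map (snd \<circ> f) ws)))"
          using good by (simp add: ws[symmetric] multiset.map_comp)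
      qed
      moreover have "\<not> is_QSum (qprod ?B)" by (simp only: B) simp
      ultimately show ?thesis
        using good_step qprod_Tests[OF B_Tests] qsum_Tests[OF R] hred by blast
    qed
  next
    case taus
    have B: "(\<Sum>Q\<in>#?B. factors Q) = ?B"
      by (rule sum_mset_factors_nonprod) (rule taus(1))
    have nonsum: "\<not> is_QSum (qprod ?B)"
    proof (cases ?B rule: qprod_cases)
      case (1 q)
      then show ?thesis using B taus(2) by simp
    qed (simp del: set_mset_sum_image)
    have Tau: "\<exists>\<alpha> M. Q = Tau \<alpha> M" if "Q \<in># ?B" for Q
    proof -
      have "\<not> is_QProd Q" "\<not> is_QSum Q" using that taus by blast+
      then show ?thesis by (cases Q) auto
    qed
    show ?thesis
    proof (cases "\<forall>p\<in>#W. \<forall>\<alpha> M. snd p = Tau \<alpha> M \<longrightarrow> head_var M")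
      case True
      have "hn_prod (qprod ?B)"
        unfolding hn_prod_def
      proof (intro exI[of _ ?B] conjI refl ballI)
        fix P assume P: "P \<in># ?B"
        from Tau[OF this] obtain \<alpha> M where "P = Tau \<alpha> M" by blast
        with P True head_var_spine[of M] show "\<exists>\<alpha> x Ms. P = Tau \<alpha> (foldl App (Var x) Ms)" by force
      qed
      with nonsum show ?thesis by (auto simp: good_def summands_nonsum)
    next
      case False
      then obtain n \<alpha> M where M: "(n, Tau \<alpha> M) \<in># W" "\<not> head_var M" by auto
      from cv_Tau_step[OF cv(1)[OF M(1)] M(2)] obtain m Q where
        Q: "n = Suc m" "tau_step ext \<alpha> M Q" "cv ext m Q" by blast
      have T: "Tau \<alpha> M \<in> Tests" using cv(2) M(1) by blast
      have QT: "Q \<in> Tests" using tau_step_Tests[OF Q(2) T] .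
      from M obtain W\<^sub>0 where W: "W = W\<^sub>0 + {#(n, Tau \<alpha> M)#}"
        by (metis add_mset_add_single multi_member_split)
      let ?P = "qprod (image_mset snd W\<^sub>0)"
      have W0: "\<forall>R\<in>#image_mset snd W\<^sub>0. R \<in> Tests" using B_Tests unfolding W by simp
      have P: "?P \<in> Tests" by (rule qprod_Tests[OF W0])
      have times: "qprod (image_mset snd (W\<^sub>0 + {#(k, R)#})) = qtimes R ?P" for k R
        using factors_qprod[OF W0] by (intro qprod_cong) simp
      have "good (qprod (image_mset snd (W\<^sub>0 + {#(m, Q)#})))"
        using Q QT by (intro IH[OF W]) (auto simp: worklist_less_iff)
      \<comment> \<open>The factor makes its head step in the context of the remaining ones, which
        is allowed since a \<open>Tau\<close> is no sum.\<close>
      moreover have "hred_tst ext (qtimes (Tau \<alpha> M) ?P) (qtimes Q ?P)"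
        using tau_step_hred[OF Q(2)] T P by (intro hred_trm_hred_tst.intros(9)) auto
      moreover have "qtimes (Tau \<alpha> M) ?P \<in> Tests" "qtimes Q ?P \<in> Tests"
        using T P QT by (auto intro: qprod_Tests)
      moreover have "qprod ?B = qtimes (Tau \<alpha> M) ?P" unfolding W by (rule times)
      ultimately show ?thesis
        using good_step nonsum unfolding times by metis
    qed
  qed
qed

lemma cv_good: "cv ext n Q \<Longrightarrow> Q \<in> Tests \<Longrightarrow> good Q"
  using good_worklist[of "image_mset (Pair n) (factors Q)"] Tests_factors[of Q] cv_factors[of ext n Q]
  by (simp add: multiset.map_comp comp_def qprod_factors)

section \<open>From one good summand to convergence of tests and of sums of bar-taus\<close>

lemma qplus_decomp:
  assumes "Q \<in> Tests" "P \<in> Tests" "summands Q = add_mset q S"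
  obtains R where "R \<in> Tests" "qplus Q P = qplus q R"
proof
  have ts: "\<forall>s\<in>#S + summands P. s \<in> Tests \<and> \<not> is_QSum s"
    using assms Tests_summands[of Q] Tests_summands[of P] by auto
  then show "qsum (S + summands P) \<in> Tests"
    by (intro qsum_Tests) auto
  have "(\<Sum>s\<in>#S + summands P. summands s) = S + summands P"
    by (rule sum_mset_singletons) (use ts in \<open>simp add: summands_nonsum\<close>)
  with ts have "summands (qsum (S + summands P)) = S + summands P"
    by (metis summands_qsum)
  moreover have "\<not> is_QSum q"
    using assms Tests_summands[of Q q] by simp
  ultimately show "qplus Q P = qplus q (qsum (S + summands P))"
    by (intro qsum_cong) (simp add: assms(3) summands_nonsum)
qed

text \<open>The summands set aside by \<open>may\<close> are collected in \<open>P'\<close>; every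
  step is performed next to those already collected.\<close>

lemma may_hred_qplus:
  "may\<^sup>*\<^sup>* Q H \<Longrightarrow> Q \<in> Tests \<Longrightarrow> P \<in> Tests \<Longrightarrow>
     \<exists>P'. (hred_tst ext)\<^sup>*\<^sup>* (qplus Q P) (qplus H P')"
proof (induction arbitrary: P rule: converse_rtranclp_induct)
  case base
  then show ?case by blast
next
  case (step Q Q')
  from step(1) obtain R where R: "R \<in> Tests" "hred_tst ext Q R" "Q' \<in># summands R"
    by (auto elim: may.cases)
  then obtain S where S: "summands R = add_mset Q' S" by (meson multi_member_split)
  from qplus_decomp[OF R(1) step.prems(2) S] obtain P' where
    P': "P' \<in> Tests" "qplus R P = qplus Q' P'" by blast
  have "hred_tst ext (qplus Q P) (qplus Q' P')"
    using hred_trm_hred_tst.intros(8)[OF R(2) step.prems] by (simp add: P'(2))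
  moreover have "Q' \<in> Tests" using R Tests_summands by blast
  with step.IH[of P'] P'(1) obtain P'' where "(hred_tst ext)\<^sup>*\<^sup>* (qplus Q' P') (qplus H P'')" by blast
  ultimately show ?case by (meson converse_rtranclp_into_rtranclp)
qed

lemma cv_converges_tst:
  assumes "cv ext n Q" "Q \<in> Tests"
  shows "converges_tst ext Q"
proof -
  from cv_good[OF assms] obtain Q' H where
    H: "Q' \<in># summands Q" "may\<^sup>*\<^sup>* Q' H" "hn_prod H" by (auto simp: good_def)
  then obtain S where S: "summands Q = add_mset Q' S" by (meson multi_member_split)
  \<comment> \<open>\<open>Q\<close> is read as \<open>Q\<close> plus the empty sum, so that
    \<open>qplus_decomp\<close> can single out the summand \<open>Q'\<close>.\<close>
  have "QSum {#} \<in> Tests" by (simp add: Tests_simps)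
  from qplus_decomp[OF assms(2) this S] obtain R where
    R: "R \<in> Tests" "qplus Q (QSum {#}) = qplus Q' R" by blast
  have "qplus Q (QSum {#}) = qsum (summands Q)"
    using Tests_summands(2)[OF assms(2)]
    by (intro qsum_cong) (simp add: sum_mset_singletons summands_nonsum)
  then have Q: "Q = qplus Q' R" using R(2) qsum_summands[OF assms(2)] by simp
  have "Q' \<in> Tests" using H(1) assms(2) Tests_summands by blast
  from may_hred_qplus[OF H(2) this R(1)] obtain P' where
    "(hred_tst ext)\<^sup>*\<^sup>* Q (qplus H P')" unfolding Q by blast
  with H(3) show ?thesis unfolding converges_tst_def mhnf_tst_def by blast
qed

text \<open>When the reduct \<open>R\<close> is a sum, head reduction may not continue below the
  bar-tau; \<open>bartau_sum\<close> first splits the bar-tau along that sum.\<close>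

lemma hred_TSum_step:
  assumes "\<not> is_QSum Q" "hred_tst ext Q R" "Q' \<in># summands R"
  shows "\<exists>B'. (hred_trm ext)\<^sup>*\<^sup>* (TSum (add_mset (\<alpha>, Q) B)) (TSum (add_mset (\<alpha>, Q') B'))"
proof -
  have "hred_trm ext (TSum ({#(\<alpha>, Q)#} + B)) (TSum ({#(\<alpha>, R)#} + B))"
    by (intro hred_trm_hred_tst.intros(4,5) assms)
  moreover have "\<exists>B'. (hred_trm ext)\<^sup>*\<^sup>* (TSum ({#(\<alpha>, R)#} + B)) (TSum (add_mset (\<alpha>, Q') B'))"
  proof (cases "is_QSum R")
    case True
    then obtain A where R: "R = QSum A" by (cases R) auto
    then obtain S where S: "A = add_mset Q' S" using assms(3) by (auto dest: multi_member_split)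
    have "hred_trm ext (TSum ({#(\<alpha>, R)#} + B)) (TSum ({#(\<alpha>, Q). Q \<in># A#} + B))"
      unfolding R by (intro hred_trm_hred_tst.intros rule_trm.bartau_sum)
    then show ?thesis unfolding S by (intro exI[of _ "{#(\<alpha>, Q). Q \<in># S#} + B"]) auto
  next
    case False
    with assms(3) show ?thesis by (auto simp: summands_nonsum)
  qed
  ultimately show ?thesis by (auto intro: converse_rtranclp_into_rtranclp)
qed

lemma may_hred_TSum:
  "may\<^sup>*\<^sup>* Q H \<Longrightarrow> \<exists>B'. (hred_trm ext)\<^sup>*\<^sup>* (TSum (add_mset (\<alpha>, Q) B)) (TSum (add_mset (\<alpha>, H) B'))"
proof (induction arbitrary: B rule: converse_rtranclp_induct)
  case base
  then show ?case by blast
next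
  case (step Q Q')
  from step(1) obtain B' where
    "(hred_trm ext)\<^sup>*\<^sup>* (TSum (add_mset (\<alpha>, Q) B)) (TSum (add_mset (\<alpha>, Q') B'))"
    using hred_TSum_step by (elim may.cases) blast
  with step.IH[of B'] show ?case by (meson rtranclp_trans)
qed

lemma cv_converges_TSum:
  assumes "cv ext n Q" "Q \<in> Tests" "\<alpha> \<noteq> top"
  shows "converges_trm ext (TSum (add_mset (\<alpha>, Q) B))"
proof -
  from cv_good[OF assms(1,2)] obtain Q' H where
    H: "Q' \<in># summands Q" "may\<^sup>*\<^sup>* Q' H" "hn_prod H" by (auto simp: good_def)
  have "\<exists>B'. (hred_trm ext)\<^sup>*\<^sup>* (TSum (add_mset (\<alpha>, Q) B)) (TSum (add_mset (\<alpha>, Q') B'))"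
  proof (cases "is_QSum Q")
    case True
    then obtain A where Q: "Q = QSum A" by (cases Q) auto
    then obtain S where S: "A = add_mset Q' S" using H(1) by (auto dest: multi_member_split)
    have "hred_trm ext (TSum ({#(\<alpha>, Q)#} + B)) (TSum ({#(\<alpha>, Q). Q \<in># A#} + B))"
      unfolding Q by (intro hred_trm_hred_tst.intros rule_trm.bartau_sum)
    then show ?thesis unfolding S by (intro exI[of _ "{#(\<alpha>, Q). Q \<in># S#} + B"]) auto
  next
    case False
    with H(1) show ?thesis by (auto simp: summands_nonsum)
  qed
  then obtain B' where "(hred_trm ext)\<^sup>*\<^sup>* (TSum (add_mset (\<alpha>, Q) B)) (TSum (add_mset (\<alpha>, Q') B'))" by blast
  moreover from may_hred_TSum[OF H(2)] obtain B'' where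
    "(hred_trm ext)\<^sup>*\<^sup>* (TSum (add_mset (\<alpha>, Q') B')) (TSum (add_mset (\<alpha>, H) B''))" by blast
  ultimately have "(hred_trm ext)\<^sup>*\<^sup>* (TSum (add_mset (\<alpha>, Q) B)) (TSum (add_mset (\<alpha>, H) B''))"
    by (rule rtranclp_trans)
  moreover have "mhnf_trm (TSum (add_mset (\<alpha>, H) B''))"
    unfolding mhnf_trm_def
    using H(3) assms(3) by (intro disjI2 exI[of _ 0] exI[of _ \<alpha>] exI[of _ H] exI[of _ B'']) simp
  ultimately show ?thesis unfolding converges_trm_def by blast
qed

end

section \<open>Simulation of terms by coded terms\<close>

text \<open>These are the terms that every realizer contains by way of \<open>N_neg\<close>. They
  are closed, and the coding introduces no other sums of bar-taus.\<close>

definition const :: "'d::bounded_semilattice_inf_top list \<Rightarrow> 'd trm" where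
  "const \<kappa>s = TSum (\<Sum>\<kappa>\<in>#mset \<kappa>s. bareps \<kappa>)"

lemma const_single: "const [\<kappa>] = TSum (bareps \<kappa>)"
  by (simp add: const_def)

lemma mem_bareps_iff: "(\<alpha>, Q) \<in># bareps \<kappa> \<longleftrightarrow> \<alpha> = \<kappa> \<and> \<kappa> \<noteq> top \<and> Q = QProd {#}"
  by (auto simp: set_mset_bareps)

lemma const_closed [simp]: "lift_trm (const \<kappa>s) k = const \<kappa>s" "subst_trm (const \<kappa>s) k N = const \<kappa>s"
  by (induction \<kappa>s) (simp_all add: const_def bareps_def bartau_def)

lemma const_Terms: "const \<kappa>s \<in> Terms"
  by (auto simp: const_def Terms_simps Tests_simps mem_bareps_iff)

lemma foldl_App_lift: "lift_trm (foldl App H Xs) k = foldl App (lift_trm H k) (map (\<lambda>X. lift_trm X k) Xs)"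
  and foldl_App_subst:
    "subst_trm (foldl App H Xs) k N = foldl App (subst_trm H k N) (map (\<lambda>X. subst_trm X k N) Xs)"
  by (induction Xs arbitrary: H) simp_all

lemma spine_cases:
  obtains (Var) i Ms where "M = foldl App (Var i) Ms"
  | (Lam) L where "M = Lam L"
  | (beta) L N Ms where "M = foldl App (App (Lam L) N) Ms"
  | (TSum) A Ms where "M = foldl App (TSum A) Ms"
proof -
  have "\<exists>H Ms. M = foldl App H Ms \<and> \<not> is_App H"
  proof (induction M rule: head_var.induct)
    case (2 M N)
    then obtain H Ms where "M = foldl App H Ms" "\<not> is_App H" by blast
    then show ?case by (intro exI[of _ H] exI[of _ "Ms @ [N]"]) simp
  next
    case (1 i)
    show ?case by (intro exI[of _ "Var i"] exI[of _ "[]"]) simp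
  next
    case ("3_1" L)
    show ?case by (intro exI[of _ "Lam L"] exI[of _ "[]"]) simp
  next
    case ("3_2" A)
    show ?case by (intro exI[of _ "TSum A"] exI[of _ "[]"]) simp
  qed
  then obtain H Ms where *: "M = foldl App H Ms" "\<not> is_App H" by blast
  show thesis
  proof (cases H)
    case (Lam L)
    with * that(2,3) show thesis by (cases Ms) auto
  qed (use * that in auto)
qed

lemma whd_foldl: "whd ext M M' \<Longrightarrow> whd ext (foldl App M Ls) (foldl App M' Ls)"
  by (induction Ls arbitrary: M M') (auto intro: whd_App)

lemma tau_step_whd:
  assumes "whd ext M M'" "tau_step ext \<alpha> M Q" shows "Q = Tau \<alpha> M'"
  using assms(2)
proof cases
  case (tau_whd M'')
  with assms(1) show ?thesis using whd_det by blast
next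
  case tau_rule
  with whd_is_App[OF assms(1)] show ?thesis by (auto elim: rule_tst.cases)
qed

text \<open>Since \<open>whd\<close> is deterministic and excludes the rules for \<open>Tau\<close>,
  the step recorded in the derivation of \<open>cv\<close> is the given one. Hence weak head steps
  strictly lower the index.\<close>

lemma cv_whd:
  assumes "cv ext n (Tau \<alpha> M)" "whd ext M M'"
  obtains m where "n = Suc m" "cv ext m (Tau \<alpha> M')"
  using cv_Tau_step[OF assms(1)] head_var_not_whd[of M ext M'] tau_step_whd[OF assms(2)] assms(2)
  by blast

definition conv ::
  "('d::bounded_semilattice_inf_top \<Rightarrow> ('d \<times> 'd) set) \<Rightarrow> 'd tst \<Rightarrow> bool" where
  "conv ext Q \<longleftrightarrow> (\<exists>n. cv ext n Q)"

lemma conv_uniform: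
  assumes "finite X" "\<And>x. x \<in> X \<Longrightarrow> conv ext (f x)"
  shows "\<exists>n. \<forall>x\<in>X. cv ext n (f x)"
  using assms
proof (induction X rule: finite_induct)
  case (insert x X)
  then obtain n m where "\<forall>x\<in>X. cv ext n (f x)" "cv ext m (f x)"
    unfolding conv_def by (metis insert_iff)
  then have "\<forall>y\<in>insert x X. cv ext (max n m) (f y)"
    by (auto intro: cv_mono)
  then show ?case ..
qed simp

lemma conv_qprod: "(\<And>Q. Q \<in># A \<Longrightarrow> conv ext Q) \<Longrightarrow> conv ext (qprod A)"
  using conv_uniform[of "set_mset A" ext "\<lambda>Q. Q"] by (auto simp: conv_def cv_qprod_iff)

lemma conv_QProd: "(\<And>Q. Q \<in># A \<Longrightarrow> conv ext Q) \<Longrightarrow> conv ext (QProd A)"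
  using conv_uniform[of "set_mset A" ext "\<lambda>Q. Q"] by (auto simp: conv_def cv_QProd_iff)

lemma conv_QSum: "Q \<in># A \<Longrightarrow> conv ext Q \<Longrightarrow> conv ext (QSum A)"
  by (auto simp: conv_def cv_QSum_iff)

lemma conv_qsum: "Q \<in># A \<Longrightarrow> conv ext Q \<Longrightarrow> conv ext (qsum A)"
  by (auto simp: conv_def cv_qsum_iff)

lemma conv_step: "tau_step ext \<alpha> M Q \<Longrightarrow> conv ext Q \<Longrightarrow> conv ext (Tau \<alpha> M)"
  by (auto simp: conv_def intro: cv_step)

lemma conv_tau_top: "conv ext (tau top M)"
  unfolding tau_def conv_def by (auto simp: cv_QProd_iff)

context defim
begin

section \<open>Sums of bar-taus applied to several arguments\<close>

lemma arrs_top_iff [simp]: "arrs arr \<delta>s \<gamma> = top \<longleftrightarrow> \<gamma> = top"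
  by (induction \<delta>s) auto

lemma arrs_le_arrs:
  "length \<alpha>s = length \<delta>s \<Longrightarrow> \<gamma> \<noteq> top \<Longrightarrow> arrs arr \<alpha>s \<beta> \<le> arrs arr \<delta>s \<gamma> \<Longrightarrow>
     list_all2 (\<le>) \<delta>s \<alpha>s \<and> \<beta> \<le> \<gamma>"
  by (induction \<alpha>s \<delta>s rule: list_induct2) (auto simp: arr_le_arr_iff)

text \<open>Each argument refines a summand \<alpha> into the pairs of \<open>ext \<alpha>\<close>,
  and the last step selects summands whose meet lies below b. Tracing a selected summand back
  through the pairs it came from gives an iterated arrow above the original index. All convergence
  found on the way has an index below \<open>n\<close>, as inductions on \<open>n\<close>
  require.\<close>

lemma cv_TSum_spine:
  assumes "cv ext n (Tau b (foldl App (TSum A) Ls))"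
  shows "\<exists>m<n. \<exists>T. finite T \<and> Meet T \<le> b \<and> (\<forall>c\<in>T. \<exists>\<alpha> Q ds. (\<alpha>, Q) \<in># A \<and> cv ext m Q \<and>
     list_all2 (\<lambda>d L. cv ext m (tau d L)) ds Ls \<and> \<alpha> \<le> arrs arr ds c)"
  using assms
proof (induction Ls arbitrary: A n)
  case Nil
  then obtain m Q where Q: "n = Suc m" "tau_step ext b (TSum A) Q" "cv ext m Q"
    using cv_Tau_step[of ext n b "TSum A"] by auto
  from Q(2) have "rule_tst ext (Tau b (TSum A)) Q"
    by cases (auto elim: whd_TSumE)
  then show ?case
  proof cases
    case (tau_sum xs)
    let ?I = "{I. I \<subseteq> {..<length xs} \<and> Meet ((\<lambda>i. fst (xs ! i)) ` I) \<le> b}"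
    have "finite ?I" by simp
    with Q(3) obtain I where I: "I \<in> ?I" "cv ext m (qprod {#snd (xs ! i). i \<in># mset_set I#})"
      unfolding tau_sum cv_qsum_iff by auto
    then have fin: "finite I" by (auto intro: finite_subset)
    have "\<exists>\<alpha> Q ds. (\<alpha>, Q) \<in># A \<and> cv ext m Q \<and>
       list_all2 (\<lambda>d L. cv ext m (tau d L)) ds [] \<and> \<alpha> \<le> arrs arr ds (fst (xs ! i))" if "i \<in> I" for i
    proof (intro exI conjI)
      show "(fst (xs ! i), snd (xs ! i)) \<in># A" using that I by (auto simp: tau_sum)
      show "cv ext m (snd (xs ! i))" using that I(2) fin by (simp add: cv_qprod_iff)
      show "list_all2 (\<lambda>d L. cv ext m (tau d L)) [] []" by simp
    qed simp
    then show ?thesis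
      using I(1) fin Q(1) by (intro exI[of _ m] conjI exI[of _ "(\<lambda>i. fst (xs ! i)) ` I"]) auto
  qed
next
  case (Cons L Ls)
  have "whd ext (foldl App (TSum A) (L # Ls)) (foldl App (TSum (sum_app ext A L)) Ls)"
    by (simp add: whd_foldl whd_sum)
  from cv_whd[OF Cons.prems this] obtain n' where
    n': "n = Suc n'" "cv ext n' (Tau b (foldl App (TSum (sum_app ext A L)) Ls))" by blast
  from Cons.IH[OF this(2)] obtain m T where m: "m < n'" "finite T" "Meet T \<le> b" and
    T: "\<And>c. c \<in> T \<Longrightarrow> \<exists>\<gamma> Q ds. (\<gamma>, Q) \<in># sum_app ext A L \<and> cv ext m Q \<and>
     list_all2 (\<lambda>d L. cv ext m (tau d L)) ds Ls \<and> \<gamma> \<le> arrs arr ds c" by (elim exE conjE) blast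
  have "\<exists>\<alpha> Q ds. (\<alpha>, Q) \<in># A \<and> cv ext m Q \<and>
     list_all2 (\<lambda>d L. cv ext m (tau d L)) ds (L # Ls) \<and> \<alpha> \<le> arrs arr ds c" if "c \<in> T" for c
  proof -
    from T[OF that] obtain \<gamma> Q ds where *: "(\<gamma>, Q) \<in># sum_app ext A L" "cv ext m Q"
      "list_all2 (\<lambda>d L. cv ext m (tau d L)) ds Ls" "\<gamma> \<le> arrs arr ds c" by (elim exE conjE)
    then obtain \<alpha> Q' \<beta> where **: "(\<alpha>, Q') \<in># A" "(\<beta>, \<gamma>) \<in> ext \<alpha>" "Q = qtimes Q' (tau \<beta> L)"
      unfolding mem_sum_app_iff by (elim exE conjE)
    have "\<alpha> \<le> arr \<beta> \<gamma>" by (rule ext_le_arr[OF **(2)])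
    also have "\<dots> \<le> arr \<beta> (arrs arr ds c)" using *(4) by (simp add: arr_le_arr_iff)
    finally have "\<alpha> \<le> arrs arr (\<beta> # ds) c" by simp
    moreover have "cv ext m Q'" "list_all2 (\<lambda>d L. cv ext m (tau d L)) (\<beta> # ds) (L # Ls)"
      using * ** by (simp_all add: cv_qprod_iff)
    ultimately show ?thesis using **(1) by blast
  qed
  with m n' show ?case by (intro exI[of _ m] conjI exI[of _ T]) auto
qed

lemma cv_const_spine:
  assumes "cv ext n (Tau b (foldl App (const \<kappa>s) Ls))"
  obtains m T where "m < n" "finite T" "Meet T \<le> b" "\<And>c. c \<in> T \<Longrightarrow> \<exists>\<kappa>\<in>set \<kappa>s. \<exists>ds.
     list_all2 (\<lambda>d L. cv ext m (tau d L)) ds Ls \<and> \<kappa> \<le> arrs arr ds c"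
proof -
  have 1: "\<alpha> \<in> set \<kappa>s" if "(\<alpha>, Q) \<in># (\<Sum>\<kappa>\<in>#mset \<kappa>s. bareps \<kappa>)" for \<alpha> Q
    using that by (auto simp: mem_bareps_iff)
  from cv_TSum_spine[OF assms[unfolded const_def]] obtain m T where
    *: "m < n" "finite T" "Meet T \<le> b" "\<forall>c\<in>T. \<exists>\<alpha> Q ds. (\<alpha>, Q) \<in># (\<Sum>\<kappa>\<in>#mset \<kappa>s. bareps \<kappa>) \<and> cv ext m Q \<and>
     list_all2 (\<lambda>d L. cv ext m (tau d L)) ds Ls \<and> \<alpha> \<le> arrs arr ds c"
    by (elim exE conjE)
  show thesis by (rule that[OF *(1-3)]) (use *(4) 1 in meson)
qed

text \<open>The construction opposite to \<open>cv_TSum_spine\<close>, from the meet of all indices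
  with converging tests. The filter model condition moves the bound past one argument: it selects
  the pairs whose domain lies above d, and there the test of the argument converges by
  hypothesis.\<close>

lemma conv_TSum_spine:
  assumes "finite T" "Meet T \<le> b"
    and "\<And>c. c \<in> T \<Longrightarrow> c \<noteq> top \<Longrightarrow> \<exists>ds. list_all2 (\<lambda>d M. \<forall>b\<ge>d. conv ext (tau b M)) ds Ms \<and>
       Meet {\<alpha>. \<exists>Q. (\<alpha>, Q) \<in># A \<and> conv ext Q} \<le> arrs arr ds c"
  shows "conv ext (Tau b (foldl App (TSum A) Ms))"
  using assms(3)
proof (induction Ms arbitrary: A)
  case Nil
  let ?s = "Meet {\<alpha>. \<exists>Q. (\<alpha>, Q) \<in># A \<and> conv ext Q}"
  have "?s \<le> c" if "c \<in> T" for c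
    using Nil[OF that] by (cases "c = top") auto
  then have "?s \<le> Meet T" using le_Meet_iff[OF assms(1)] by blast
  also note assms(2)
  finally have s: "?s \<le> b" .
  obtain xs where xs: "mset xs = A" using ex_mset by blast
  \<comment> \<open>All positions with a converging test are taken: this subfamily has the least
    meet.\<close>
  define I where "I = {i. i < length xs \<and> conv ext (snd (xs ! i))}"
  have fin: "finite I" by (simp add: I_def)
  have "Meet ((\<lambda>i. fst (xs ! i)) ` I) \<le> ?s"
  proof (rule Meet_antimono)
    show "{\<alpha>. \<exists>Q. (\<alpha>, Q) \<in># A \<and> conv ext Q} \<subseteq> (\<lambda>i. fst (xs ! i)) ` I"
    proof
      fix \<alpha> assume "\<alpha> \<in> {\<alpha>. \<exists>Q. (\<alpha>, Q) \<in># A \<and> conv ext Q}"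
      then obtain Q where "(\<alpha>, Q) \<in> set xs" "conv ext Q" using xs by auto
      then obtain i where "i < length xs" "xs ! i = (\<alpha>, Q)" by (auto simp: in_set_conv_nth)
      with \<open>conv ext Q\<close> show "\<alpha> \<in> (\<lambda>i. fst (xs ! i)) ` I"
        by (intro image_eqI[of _ _ i]) (auto simp: I_def)
    qed
  qed (use fin in simp)
  with s have I: "I \<in> {I. I \<subseteq> {..<length xs} \<and> Meet ((\<lambda>i. fst (xs ! i)) ` I) \<le> b}"
    by (auto simp: I_def)
  let ?R = "qsum {#qprod {#snd (xs ! i). i \<in># mset_set I#}.
        I \<in># mset_set {I. I \<subseteq> {..<length xs} \<and> b \<ge> Meet ((\<lambda>i. fst (xs ! i)) ` I)}#}"
  have "conv ext (qprod {#snd (xs ! i). i \<in># mset_set I#})"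
    using fin by (intro conv_qprod) (auto simp: I_def)
  then have "conv ext ?R"
    using I by (intro conv_qsum[of "qprod {#snd (xs ! i). i \<in># mset_set I#}"]) auto
  moreover have "tau_step ext b (TSum A) ?R"
    unfolding xs[symmetric] by (intro tau_rule rule_tst.tau_sum)
  ultimately show ?case by (auto intro: conv_step)
next
  case (Cons M Ms)
  let ?S = "{\<alpha>. \<exists>Q. (\<alpha>, Q) \<in># A \<and> conv ext Q}"
  let ?S' = "{\<alpha>. \<exists>Q. (\<alpha>, Q) \<in># sum_app ext A M \<and> conv ext Q}"
  let ?P = "\<Union>\<alpha>\<in>?S. ext \<alpha>"
  have finP: "finite ?P" by (intro finite_UN_I finite_sem_TSum finite_ext)
  have P: "arrows arr ?P \<le> Meet ?S" by (intro arrows_Union_ext_le finite_sem_TSum)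
  have "conv ext (Tau b (foldl App (TSum (sum_app ext A M)) Ms))"
  proof (rule Cons.IH)
    fix c assume c: "c \<in> T" "c \<noteq> top"
    from Cons.prems[OF this] obtain ds' where ds': "list_all2 (\<lambda>d M. \<forall>b\<ge>d. conv ext (tau b M)) ds' (M # Ms)"
      "Meet ?S \<le> arrs arr ds' c" by (elim exE conjE)
    then obtain d ds where ds: "ds' = d # ds" "\<And>b. d \<le> b \<Longrightarrow> conv ext (tau b M)"
      "list_all2 (\<lambda>d M. \<forall>b\<ge>d. conv ext (tau b M)) ds Ms"
      by (auto simp: list_all2_Cons2)
    have "arrows arr ?P \<le> arr d (arrs arr ds c)"
      using P ds'(2) by (simp add: ds(1))
    then have "Meet {\<gamma> |\<beta> \<gamma>. (\<beta>, \<gamma>) \<in> ?P \<and> d \<le> \<beta>} \<le> arrs arr ds c"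
      by (simp only: arrows_le_arr_iff[OF finP])
    moreover have "Meet ?S' \<le> Meet {\<gamma> |\<beta> \<gamma>. (\<beta>, \<gamma>) \<in> ?P \<and> d \<le> \<beta>}"
    proof (rule Meet_le_Meet[OF finite_sem_TSum finite_codomain[OF finP]])
      fix \<gamma> assume "\<gamma> \<in> {\<gamma> |\<beta> \<gamma>. (\<beta>, \<gamma>) \<in> ?P \<and> d \<le> \<beta>}" "\<gamma> \<noteq> top"
      then obtain \<alpha> \<beta> Q where *: "(\<alpha>, Q) \<in># A" "conv ext Q" "(\<beta>, \<gamma>) \<in> ext \<alpha>" "d \<le> \<beta>" by blast
      have "(\<gamma>, qtimes Q (tau \<beta> M)) \<in># sum_app ext A M"
        unfolding mem_sum_app_iff using * \<open>\<gamma> \<noteq> top\<close> by (intro conjI exI) simp_all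
      moreover have "conv ext (qtimes Q (tau \<beta> M))"
        using *(2) ds(2)[OF *(4)] by (intro conv_qprod) auto
      ultimately show "\<exists>a\<in>?S'. a \<le> \<gamma>" by (intro bexI[of _ \<gamma>] CollectI exI conjI) simp_all
    qed
    ultimately show "\<exists>ds. list_all2 (\<lambda>d M. \<forall>b\<ge>d. conv ext (tau b M)) ds Ms \<and> Meet ?S' \<le> arrs arr ds c"
      using ds(3) by (intro exI[of _ ds] conjI) (simp, rule order_trans)
  qed
  moreover have "whd ext (foldl App (TSum A) (M # Ms)) (foldl App (TSum (sum_app ext A M)) Ms)"
    by (simp add: whd_foldl whd_sum)
  ultimately show ?case by (blast intro: conv_step tau_whd)
qed

text \<open>The \<open>i\<close>-th summand of \<open>sel \<alpha>s\<close> returns \<open>\<alpha>s ! i\<close> as soon as its \<open>i\<close>-th argument has type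
  \<open>\<alpha>s ! i\<close>, whatever the other arguments.\<close>

definition sel_type :: "'d list \<Rightarrow> nat \<Rightarrow> 'd" where
  "sel_type \<alpha>s i = arrs arr ((replicate (length \<alpha>s) top)[i := \<alpha>s ! i]) (\<alpha>s ! i)"

definition sel :: "'d list \<Rightarrow> 'd trm" where
  "sel \<alpha>s = const (map (sel_type \<alpha>s) [0..<length \<alpha>s])"

text \<open>The code of a product: all \<open>n\<close> arguments are demanded at the type \<alpha>
  that is to be returned. For \<open>n = 0\<close> it is the bar-epsilon of index \<alpha>.\<close>

definition prod_const :: "nat \<Rightarrow> 'd \<Rightarrow> 'd trm" where
  "prod_const n \<alpha> = const [arrs arr (replicate n \<alpha>) \<alpha>]"

lemma sel_closed [simp]: "lift_trm (sel \<alpha>s) k = sel \<alpha>s" "subst_trm (sel \<alpha>s) k N = sel \<alpha>s"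
  and prod_const_closed [simp]: "lift_trm (prod_const n \<alpha>) k = prod_const n \<alpha>"
    "subst_trm (prod_const n \<alpha>) k N = prod_const n \<alpha>"
  by (simp_all add: sel_def prod_const_def)

text \<open>\<open>rel k P M\<close>: \<open>P\<close> arises from \<open>M\<close> by coding its tests, where the variables below \<open>k\<close> are bound
  further outside and the other variables of \<open>M\<close> stand for arbitrary terms: a term with such a head
  variable converges anyway. \<open>code k X Q \<alpha>\<close>: the term \<open>X\<close> has type \<open>\<alpha>\<close> if the test \<open>Q\<close> succeeds.
  The point of the coding is that a test \<open>\<tau>\<^bsub>\<beta>\<^esub>(M)\<close> turns into an application of a constant of type
  \<open>\<beta> \<rightarrow> \<alpha>\<close> to \<open>M\<close>, for which a realizer has to return a realizer.\<close>

inductive rel :: "nat \<Rightarrow> 'd trm \<Rightarrow> 'd trm \<Rightarrow> bool"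
  and code :: "nat \<Rightarrow> 'd trm \<Rightarrow> 'd tst \<Rightarrow> 'd \<Rightarrow> bool" where
  rel_bound: "i < k \<Longrightarrow> rel k (Var i) (Var i)"
| rel_free: "k \<le> i \<Longrightarrow> rel k P (Var i)"
| rel_Lam: "rel (Suc k) P M \<Longrightarrow> rel k (Lam P) (Lam M)"
| rel_App: "rel k P M \<Longrightarrow> rel k P' M' \<Longrightarrow> rel k (App P P') (App M M')"
| rel_bareps: "\<beta>' \<le> \<beta> \<Longrightarrow> rel k (const [\<beta>]) (TSum (bareps \<beta>'))"
| rel_TSum: "length Xs = length As \<Longrightarrow>
    (\<And>i. i < length As \<Longrightarrow> code k (Xs ! i) (snd (As ! i)) (fst (As ! i))) \<Longrightarrow>
    rel k (foldl App (sel (map fst As)) Xs) (TSum (mset As))"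
| code_Tau: "rel k P M \<Longrightarrow> \<beta> \<noteq> top \<Longrightarrow> code k (App (const [arr \<beta> \<alpha>]) P) (Tau \<beta> M) \<alpha>"
| code_QProd: "length Xs = length Qs \<Longrightarrow>
    (\<And>i. i < length Qs \<Longrightarrow> code k (Xs ! i) (Qs ! i) \<alpha>) \<Longrightarrow>
    code k (foldl App (prod_const (length Qs) \<alpha>) Xs) (QProd (mset Qs)) \<alpha>"
| code_QSum: "length Xs = length Qs \<Longrightarrow>
    (\<And>i. i < length Qs \<Longrightarrow> code k (Xs ! i) (Qs ! i) \<alpha>) \<Longrightarrow>
    code k (foldl App (sel (replicate (length Qs) \<alpha>)) Xs) (QSum (mset Qs)) \<alpha>"

section \<open>Closure of the coding relations under lifting, substitution and application\<close>

inductive_cases rel_LamE: "rel k P (Lam M)"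
inductive_cases rel_AppE: "rel k P (App M N)"

text \<open>The equations as premises let the rule apply after lifting or substitution has been
  mapped over the family; likewise for the next two lemmas.\<close>

lemma rel_TSum':
  assumes "A = mset As" "\<alpha>s = map fst As" "length Xs = length As"
    "\<And>i. i < length As \<Longrightarrow> code k (Xs ! i) (snd (As ! i)) (fst (As ! i))"
  shows "rel k (foldl App (sel \<alpha>s) Xs) (TSum A)"
  unfolding assms(1,2) by (rule rel_TSum[OF assms(3,4)])

lemma code_QProd':
  assumes "A = mset Qs" "n = length Qs" "length Xs = length Qs"
    "\<And>i. i < length Qs \<Longrightarrow> code k (Xs ! i) (Qs ! i) \<alpha>"
  shows "code k (foldl App (prod_const n \<alpha>) Xs) (QProd A) \<alpha>"
  unfolding assms(1,2) by (rule code_QProd[OF assms(3,4)])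

lemma code_QSum':
  assumes "A = mset Qs" "n = length Qs" "length Xs = length Qs"
    "\<And>i. i < length Qs \<Longrightarrow> code k (Xs ! i) (Qs ! i) \<alpha>"
  shows "code k (foldl App (sel (replicate n \<alpha>)) Xs) (QSum A) \<alpha>"
  unfolding assms(1,2) by (rule code_QSum[OF assms(3,4)])

lemma bareps_closed [simp]:
  "image_mset (map_prod id (\<lambda>Q. lift_tst Q i)) (bareps \<alpha>) = bareps \<alpha>"
  "image_mset (map_prod id (\<lambda>Q. subst_tst Q i N)) (bareps \<alpha>) = bareps \<alpha>"
  by (simp_all add: bareps_def bartau_def)

lemma rel_lift:
  shows "rel k P M \<Longrightarrow> \<forall>i\<le>k. rel (Suc k) (lift_trm P i) (lift_trm M i)"
    and "code k X Q \<alpha> \<Longrightarrow> \<forall>i\<le>k. code (Suc k) (lift_trm X i) (lift_tst Q i) \<alpha>"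
proof (induction rule: rel_code.inducts)
  case (rel_TSum Xs As k)
  show ?case
  proof (intro allI impI)
    fix i assume "i \<le> k"
    with rel_TSum show "rel (Suc k) (lift_trm (foldl App (sel (map fst As)) Xs) i)
        (lift_trm (TSum (mset As)) i)"
      unfolding foldl_App_lift sel_closed lift_trm.simps
      by (intro rel_TSum'[of _ "map (map_prod id (\<lambda>Q. lift_tst Q i)) As"]) simp_all
  qed
next
  case (code_QProd Xs Qs k \<alpha>)
  show ?case
  proof (intro allI impI)
    fix i assume "i \<le> k"
    with code_QProd show "code (Suc k) (lift_trm (foldl App (prod_const (length Qs) \<alpha>) Xs) i)
        (lift_tst (QProd (mset Qs)) i) \<alpha>"
      unfolding foldl_App_lift prod_const_closed lift_tst.simps
      by (intro code_QProd'[of _ "map (\<lambda>Q. lift_tst Q i) Qs"]) simp_all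
  qed
next
  case (code_QSum Xs Qs k \<alpha>)
  show ?case
  proof (intro allI impI)
    fix i assume "i \<le> k"
    with code_QSum show "code (Suc k) (lift_trm (foldl App (sel (replicate (length Qs) \<alpha>)) Xs) i)
        (lift_tst (QSum (mset Qs)) i) \<alpha>"
      unfolding foldl_App_lift sel_closed lift_tst.simps
      by (intro code_QSum'[of _ "map (\<lambda>Q. lift_tst Q i) Qs"]) simp_all
  qed
qed (auto intro: rel_code.intros)

lemma rel_subst_aux:
  shows "rel m P M \<Longrightarrow> \<forall>k i P' M'. m = Suc k \<longrightarrow> i \<le> k \<longrightarrow> rel k P' M' \<longrightarrow>
      rel k (subst_trm P i P') (subst_trm M i M')"
    and "code m X Q \<alpha> \<Longrightarrow> \<forall>k i P' M'. m = Suc k \<longrightarrow> i \<le> k \<longrightarrow> rel k P' M' \<longrightarrow>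
      code k (subst_trm X i P') (subst_tst Q i M') \<alpha>"
proof (induction rule: rel_code.inducts)
  case (rel_TSum Xs As m)
  show ?case
  proof (intro allI impI)
    fix k i P' M' assume "m = Suc k" "i \<le> k" "rel k P' M'"
    with rel_TSum show "rel k (subst_trm (foldl App (sel (map fst As)) Xs) i P')
        (subst_trm (TSum (mset As)) i M')"
      unfolding foldl_App_subst sel_closed subst_trm.simps
      by (intro rel_TSum'[of _ "map (map_prod id (\<lambda>Q. subst_tst Q i M')) As"]) simp_all
  qed
next
  case (code_QProd Xs Qs m \<alpha>)
  show ?case
  proof (intro allI impI)
    fix k i P' M' assume "m = Suc k" "i \<le> k" "rel k P' M'"
    with code_QProd show "code k (subst_trm (foldl App (prod_const (length Qs) \<alpha>) Xs) i P')
        (subst_tst (QProd (mset Qs)) i M') \<alpha>"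
      unfolding foldl_App_subst prod_const_closed subst_tst.simps
      by (intro code_QProd'[of _ "map (\<lambda>Q. subst_tst Q i M') Qs"]) simp_all
  qed
next
  case (code_QSum Xs Qs m \<alpha>)
  show ?case
  proof (intro allI impI)
    fix k i P' M' assume "m = Suc k" "i \<le> k" "rel k P' M'"
    with code_QSum show "code k (subst_trm (foldl App (sel (replicate (length Qs) \<alpha>)) Xs) i P')
        (subst_tst (QSum (mset Qs)) i M') \<alpha>"
      unfolding foldl_App_subst sel_closed subst_tst.simps
      by (intro code_QSum'[of _ "map (\<lambda>Q. subst_tst Q i M') Qs"]) simp_all
  qed
next
  case (rel_Lam m P M)
  then show ?case by (auto intro!: rel_code.rel_Lam simp: rel_lift)
qed (auto intro: rel_code.intros)

lemma rel_subst:
  "rel (Suc k) P M \<Longrightarrow> rel k P' M' \<Longrightarrow> i \<le> k \<Longrightarrow> rel k (subst_trm P i P') (subst_trm M i M')"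
  using rel_subst_aux(1) by blast

text \<open>The outermost bound variable is instantiated on the left only. In \<open>M\<close> it
  counts as free from then on, and a free variable is related to every term.\<close>

lemma rel_subst_left_aux:
  shows "rel m P M \<Longrightarrow> \<forall>k P'. m = Suc k \<longrightarrow> rel k (subst_trm P k P') M"
    and "code m X Q \<alpha> \<Longrightarrow> \<forall>k P'. m = Suc k \<longrightarrow> code k (subst_trm X k P') Q \<alpha>"
proof (induction rule: rel_code.inducts)
  case (rel_TSum Xs As m)
  show ?case
  proof (intro allI impI)
    fix k P' assume "m = Suc k"
    with rel_TSum show "rel k (subst_trm (foldl App (sel (map fst As)) Xs) k P') (TSum (mset As))"
      unfolding foldl_App_subst sel_closed by (intro rel_code.rel_TSum) simp_all
  qed
next
  case (code_QProd Xs Qs m \<alpha>)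
  show ?case
  proof (intro allI impI)
    fix k P' assume "m = Suc k"
    with code_QProd show "code k (subst_trm (foldl App (prod_const (length Qs) \<alpha>) Xs) k P')
        (QProd (mset Qs)) \<alpha>"
      unfolding foldl_App_subst prod_const_closed by (intro rel_code.code_QProd) simp_all
  qed
next
  case (code_QSum Xs Qs m \<alpha>)
  show ?case
  proof (intro allI impI)
    fix k P' assume "m = Suc k"
    with code_QSum show "code k (subst_trm (foldl App (sel (replicate (length Qs) \<alpha>)) Xs) k P')
        (QSum (mset Qs)) \<alpha>"
      unfolding foldl_App_subst sel_closed by (intro rel_code.code_QSum) simp_all
  qed
next
  case (rel_bound i m)
  then show ?case by (auto intro: rel_code.intros)
qed (auto intro: rel_code.intros)

lemma rel_subst_left: "rel (Suc k) P M \<Longrightarrow> rel k (subst_trm P k P') M"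
  using rel_subst_left_aux(1) by blast

lemma rel_foldl:
  "rel k P H \<Longrightarrow> list_all2 (rel k) Ls Ms \<Longrightarrow> rel k (foldl App P Ls) (foldl App H Ms)"
proof (induction Ls arbitrary: P H Ms)
  case (Cons L Ls)
  from Cons.prems(2) obtain M Ms' where Ms: "Ms = M # Ms'" "rel k L M" "list_all2 (rel k) Ls Ms'"
    by (auto simp: list_all2_Cons1)
  show ?case
    using Cons.IH[OF rel_App[OF Cons.prems(1) Ms(2)] Ms(3)] by (simp add: Ms(1))
qed simp

lemma rel_spine:
  assumes "rel k P (foldl App H Ms)"
  obtains P\<^sub>0 Ls where "P = foldl App P\<^sub>0 Ls" "rel k P\<^sub>0 H" "list_all2 (rel k) Ls Ms"
proof -
  have "\<exists>P\<^sub>0 Ls. P = foldl App P\<^sub>0 Ls \<and> rel k P\<^sub>0 H \<and> list_all2 (rel k) Ls Ms"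
    using assms
  proof (induction Ms arbitrary: P rule: rev_induct)
    case Nil
    then show ?case by (intro exI[of _ P] exI[of _ "[]"]) simp
  next
    case (snoc M Ms)
    then obtain P' P'' where *: "P = App P' P''" "rel k P' (foldl App H Ms)" "rel k P'' M"
      by (auto elim: rel_AppE)
    with snoc.IH obtain P\<^sub>0 Ls where "P' = foldl App P\<^sub>0 Ls" "rel k P\<^sub>0 H" "list_all2 (rel k) Ls Ms"
      by blast
    with * show ?case
      by (intro exI[of _ P\<^sub>0] exI[of _ "Ls @ [P'']"]) (auto intro: list_all2_appendI)
  qed
  with that show thesis by blast
qed

lemma rel_whd_beta:
  assumes "rel 0 P (foldl App (App (Lam L) N) Ms)"
  obtains P' where "whd ext P P'" "rel 0 P' (foldl App (subst_trm L 0 N) Ms)"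
proof -
  from assms obtain P\<^sub>0 Ls where P: "P = foldl App P\<^sub>0 Ls" "rel 0 P\<^sub>0 (App (Lam L) N)"
    "list_all2 (rel 0) Ls Ms" by (rule rel_spine)
  from P(2) obtain L' N' where L: "P\<^sub>0 = App (Lam L') N'" "rel (Suc 0) L' L" "rel 0 N' N"
    by (auto elim!: rel_AppE rel_LamE)
  show thesis
  proof (rule that)
    show "whd ext P (foldl App (subst_trm L' 0 N') Ls)"
      unfolding P L by (intro whd_foldl whd_beta)
    show "rel 0 (foldl App (subst_trm L' 0 N') Ls) (foldl App (subst_trm L 0 N) Ms)"
      by (intro rel_foldl rel_subst L P) simp
  qed
qed

section \<open>Convergence at abstractions and at selectors\<close>

lemma cv_Lam:
  assumes "cv ext n (Tau b (Lam P))"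
  obtains m where "n = Suc m"
    "\<And>\<beta> \<gamma>. (\<beta>, \<gamma>) \<in> ext b \<Longrightarrow> cv ext m (tau \<gamma> (subst_trm P 0 (const [\<beta>])))"
proof -
  from cv_Tau_step[OF assms] obtain m Q where *: "n = Suc m" "tau_step ext b (Lam P) Q" "cv ext m Q"
    by auto
  from *(2) have "rule_tst ext (Tau b (Lam P)) Q"
    by cases (auto elim: whd_LamE)
  then have "Q = qprod {#tau \<gamma> (subst_trm P 0 (TSum (bareps \<beta>))). (\<beta>, \<gamma>) \<in># mset_set (ext b)#}"
    by cases auto
  with * have "cv ext m (tau \<gamma> (subst_trm P 0 (const [\<beta>])))" if "(\<beta>, \<gamma>) \<in> ext b" for \<beta> \<gamma>
    using that by (force simp: cv_qprod_iff const_single)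
  with *(1) that show thesis by blast
qed

lemma conv_Lam:
  assumes "\<And>\<beta> \<gamma>. (\<beta>, \<gamma>) \<in> ext b \<Longrightarrow> conv ext (tau \<gamma> (subst_trm M 0 (TSum (bareps \<beta>))))"
  shows "conv ext (Tau b (Lam M))"
proof (rule conv_step)
  show "tau_step ext b (Lam M)
      (qprod {#tau \<gamma> (subst_trm M 0 (TSum (bareps \<beta>))). (\<beta>, \<gamma>) \<in># mset_set (ext b)#})"
    by (intro tau_rule rule_tst.tau_lam)
  show "conv ext (qprod {#tau \<gamma> (subst_trm M 0 (TSum (bareps \<beta>))). (\<beta>, \<gamma>) \<in># mset_set (ext b)#})"
    using assms by (intro conv_qprod) auto
qed

lemma Meet_remove_top: "finite T \<Longrightarrow> Meet (T - {top}) = Meet T"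
  for T :: "'d set"
  by (intro antisym Meet_le_Meet) auto

lemma le_of_Meet_le:
  assumes "finite T" "Meet T \<le> b" "\<And>c. c \<in> T \<Longrightarrow> c \<noteq> top \<Longrightarrow> \<alpha> \<le> c"
  shows "\<alpha> \<le> b"
proof -
  have "\<alpha> \<le> c" if "c \<in> T" for c
    using assms(3)[OF that] by (cases "c = top") auto
  then have "\<alpha> \<le> Meet T" using le_Meet_iff[OF assms(1)] by blast
  also note assms(2)
  finally show ?thesis .
qed

lemma Meet_le_nontop:
  assumes "finite T" "Meet T \<le> b" "b \<noteq> top"
  obtains c where "c \<in> T" "c \<noteq> top"
  using assms Meet_eq_top_iff[OF assms(1)] top_unique by metis

text \<open>A type c other than \<open>top\<close> stems from the summand of one position i.
  Comparing iterated arrows, that summand restricts only the i-th of the first arguments, the others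
  being demanded at \<open>top\<close>; what remains relates the i-th type to the further arguments
  \<open>Ls\<close>.\<close>

lemma cv_sel_spine:
  assumes "cv ext n (Tau b (foldl App (sel \<alpha>s) (Xs @ Ls)))" "length Xs = length \<alpha>s"
  obtains m T where "m < n" "finite T" "Meet T \<le> b" "\<And>c. c \<in> T \<Longrightarrow> c \<noteq> top \<Longrightarrow>
     \<exists>i<length \<alpha>s. \<exists>d es. \<alpha>s ! i \<noteq> top \<and> d \<le> \<alpha>s ! i \<and> cv ext m (tau d (Xs ! i)) \<and>
       list_all2 (\<lambda>e L. cv ext m (tau e L)) es Ls \<and> \<alpha>s ! i \<le> arrs arr es c"
proof -
  from cv_const_spine[OF assms(1)[unfolded sel_def]] obtain m T where
    mT: "m < n" "finite T" "Meet T \<le> b" and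
    T: "\<And>c. c \<in> T \<Longrightarrow> \<exists>\<kappa>\<in>set (map (sel_type \<alpha>s) [0..<length \<alpha>s]). \<exists>ds.
     list_all2 (\<lambda>d L. cv ext m (tau d L)) ds (Xs @ Ls) \<and> \<kappa> \<le> arrs arr ds c" by blast
  show thesis
  proof (rule that[OF mT])
    fix c assume c: "c \<in> T" "c \<noteq> top"
    from T[OF c(1)] obtain i ds' where i: "i < length \<alpha>s"
      "list_all2 (\<lambda>d L. cv ext m (tau d L)) ds' (Xs @ Ls)" "sel_type \<alpha>s i \<le> arrs arr ds' c" by auto
    from i(2) obtain ds es where ds: "ds' = ds @ es" "length ds = length Xs"
      "list_all2 (\<lambda>d L. cv ext m (tau d L)) ds Xs" "list_all2 (\<lambda>d L. cv ext m (tau d L)) es Ls"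
      unfolding list_all2_append2 by blast
    from i(3) have le: "list_all2 (\<le>) ds ((replicate (length \<alpha>s) top)[i := \<alpha>s ! i]) \<and> \<alpha>s ! i \<le> arrs arr es c"
      unfolding sel_type_def ds(1) arrs_append using c(2) ds(2) assms(2) by (intro arrs_le_arrs) simp_all
    then have "ds ! i \<le> \<alpha>s ! i"
      using list_all2_nthD2[of "(\<le>)" ds "(replicate (length \<alpha>s) top)[i := \<alpha>s ! i]" i] i(1) by simp
    moreover have "\<alpha>s ! i \<noteq> top"
      using le c(2) by (auto simp: top_unique)
    moreover have "cv ext m (tau (ds ! i) (Xs ! i))"
      using ds(3) i(1) ds(2) assms(2) by (auto simp: list_all2_conv_all_nth)
    ultimately show "\<exists>i<length \<alpha>s. \<exists>d es. \<alpha>s ! i \<noteq> top \<and> d \<le> \<alpha>s ! i \<and> cv ext m (tau d (Xs ! i)) \<and>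
       list_all2 (\<lambda>e L. cv ext m (tau e L)) es Ls \<and> \<alpha>s ! i \<le> arrs arr es c"
      using i(1) ds(4) le by blast
  qed
qed

text \<open>The families \<open>B\<close> are forced by abstractions: a pair of \<open>ext b'\<close> need not be above a single pair of
  \<open>ext b\<close>, even if \<open>b \<le> b'\<close>, but above a meet of such pairs.\<close>

lemma simulation:
  "(\<forall>M B b'. finite B \<longrightarrow> (\<forall>b\<in>B. \<exists>P. rel 0 P M \<and> cv ext n (tau b P)) \<longrightarrow> Meet B \<le> b' \<longrightarrow>
      conv ext (tau b' M)) \<and>
   (\<forall>X Q \<alpha> b. code 0 X Q \<alpha> \<longrightarrow> b \<noteq> top \<longrightarrow> cv ext n (tau b X) \<longrightarrow> conv ext Q \<and> \<alpha> \<le> b)"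
proof (induction n rule: less_induct)
  case (less n)
  have IH: "conv ext (tau b' M)"
    if "m < n" "finite B" "\<And>b. b \<in> B \<Longrightarrow> \<exists>P. rel 0 P M \<and> cv ext m (tau b P)" "Meet B \<le> b'" for m M B b'
    using conjunct1[OF less.IH[OF that(1)], rule_format, OF that(2) _ that(4)] that(3) by simp
  have IH1: "conv ext (tau b' M)" if "m < n" "rel 0 P M" "cv ext m (tau b P)" "b \<le> b'" for m M P b b'
    using IH[OF that(1), of "{b}" M b'] that(2-) by auto
  have IHs: "list_all2 (\<lambda>d M. \<forall>b\<ge>d. conv ext (tau b M)) ds Ms"
    if "m < n" "list_all2 (\<lambda>d L. cv ext m (tau d L)) ds Ls" "list_all2 (rel 0) Ls Ms" for m ds Ls Ms
    using list_all2_trans[OF _ that(2,3), of "\<lambda>d M. \<forall>b\<ge>d. conv ext (tau b M)"] IH1[OF that(1)] by blast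
  have IHc: "conv ext Q" if "m < n" "code 0 X Q \<alpha>" "d \<le> \<alpha>" "\<alpha> \<noteq> top" "cv ext m (tau d X)" for m X Q \<alpha> d
  proof -
    have "d \<noteq> top" using that(3,4) by (auto simp: top_unique)
    from conjunct2[OF less.IH[OF that(1)], rule_format, OF that(2) this that(5)]
    show ?thesis by simp
  qed
  show ?case
  proof (rule conjI; intro allI impI)
    fix M B b'
    assume B: "finite B" "\<forall>b\<in>B. \<exists>P. rel 0 P M \<and> cv ext n (tau b P)" "Meet B \<le> b'"
    show "conv ext (tau b' M)"
    proof (cases "b' = top")
      case True
      then show ?thesis by (simp add: conv_tau_top)
    next
      case b': False
      \<comment> \<open>Without \<open>top\<close>, every \<open>tau\<close> at a member of the
        family is a genuine \<open>Tau\<close>. As \<open>b' \<noteq> top\<close>, some member is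
        left, and from it the index is seen to be a successor where this is needed.\<close>
      let ?B = "B - {top}"
      have fin: "finite ?B" and le: "Meet ?B \<le> b'"
        using B by (simp_all add: Meet_remove_top)
      from Meet_le_nontop[OF fin le b'] obtain b\<^sub>0 where b\<^sub>0: "b\<^sub>0 \<in> ?B" by blast
      have "\<forall>b\<in>?B. \<exists>P. rel 0 P M \<and> cv ext n (Tau b P)"
      proof
        fix b assume "b \<in> ?B"
        with B(2) obtain P where "rel 0 P M" "cv ext n (tau b P)" "b \<noteq> top" by blast
        then show "\<exists>P. rel 0 P M \<and> cv ext n (Tau b P)" by (auto simp: tau_def)
      qed
      from bchoice[OF this] obtain P where
        P': "\<forall>b\<in>?B. rel 0 (P b) M \<and> cv ext n (Tau b (P b))" ..
      have P: "rel 0 (P b) M" "cv ext n (Tau b (P b))" if "b \<in> ?B" for b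
        using P' that by blast+
      have "conv ext (Tau b' M)"
      proof (cases M rule: spine_cases)
        case (Var i Ms)
        then show ?thesis unfolding conv_def by (intro exI[of _ 0] cv_var) simp
      next
        case (Lam L)
        have "\<exists>P'. P b = Lam P' \<and> rel (Suc 0) P' L" if "b \<in> ?B" for b
          using P(1)[OF that] unfolding Lam by (auto elim: rel_LamE)
        then obtain P' where P'': "\<And>b. b \<in> ?B \<Longrightarrow> P b = Lam (P' b)" "\<And>b. b \<in> ?B \<Longrightarrow> rel (Suc 0) (P' b) L"
          by metis
        obtain m where m: "n = Suc m"
          using P(2)[OF b\<^sub>0] unfolding P''(1)[OF b\<^sub>0] by (rule cv_Lam)
        have cv: "cv ext m (tau \<gamma> (subst_trm (P' b) 0 (const [\<beta>])))"
          if b: "b \<in> ?B" "(\<beta>, \<gamma>) \<in> ext b" for b \<beta> \<gamma>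
          using P(2)[OF b(1)] b(2) unfolding P''(1)[OF b(1)] m by (auto elim: cv_Lam)
        show ?thesis
          unfolding Lam
        proof (rule conv_Lam)
          fix \<beta>' \<gamma>' assume bg: "(\<beta>', \<gamma>') \<in> ext b'"
          \<comment> \<open>The pairs of all members are pooled. Those whose domain lies above
            \<beta>' supply the family for the body: their codomains have a meet below
            \<gamma>'.\<close>
          let ?E = "\<Union>b\<in>?B. ext b"
          have finE: "finite ?E" using fin by (intro finite_UN_I) simp_all
          have "arrows arr ?E \<le> Meet ?B" by (rule arrows_Union_ext_le[OF fin])
          also note le
          also note ext_le_arr[OF bg]
          finally have Meet: "Meet {\<gamma> |\<beta> \<gamma>. (\<beta>, \<gamma>) \<in> ?E \<and> \<beta>' \<le> \<beta>} \<le> \<gamma>'"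
            by (simp only: arrows_le_arr_iff[OF finE])
          show "conv ext (tau \<gamma>' (subst_trm L 0 (TSum (bareps \<beta>'))))"
          proof (rule IH[OF _ finite_codomain[OF finE] _ Meet])
            show "m < n" using m by simp
            fix \<gamma> assume "\<gamma> \<in> {\<gamma> |\<beta> \<gamma>. (\<beta>, \<gamma>) \<in> ?E \<and> \<beta>' \<le> \<beta>}"
            then obtain b \<beta> where b: "b \<in> ?B" "(\<beta>, \<gamma>) \<in> ext b" "\<beta>' \<le> \<beta>" by blast
            then show "\<exists>P. rel 0 P (subst_trm L 0 (TSum (bareps \<beta>'))) \<and> cv ext m (tau \<gamma> P)"
              \<comment> \<open>The two sides receive different bar-epsilons: index \<beta> for the
                coded body, from a pair of \<open>ext b\<close>, and the smaller index \<beta>' for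
                \<open>L\<close>, from \<open>ext b'\<close>. The inequality in
                \<open>rel_bareps\<close> is there for this.\<close>
              using cv rel_subst[OF P''(2) rel_bareps] by blast
          qed
        qed
      next
        case (beta L N Ms)
        let ?M = "foldl App (subst_trm L 0 N) Ms"
        have "\<exists>P'. rel 0 P' ?M \<and> (\<exists>m. n = Suc m \<and> cv ext m (Tau b P'))" if "b \<in> ?B" for b
          using P(1)[OF that] unfolding beta
          by (rule rel_whd_beta) (use cv_whd[OF P(2)[OF that]] in blast)
        moreover from this[OF b\<^sub>0] obtain m where m: "n = Suc m" by blast
        ultimately have "conv ext (tau b' ?M)"
          by (intro IH[of m ?B, OF _ fin _ le]) (auto simp: tau_def)
        moreover have "whd ext M ?M" unfolding beta by (intro whd_foldl whd_beta)
        ultimately show ?thesis using b' by (auto simp: tau_def intro: conv_step tau_whd)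
      next
        case (TSum A Ms)
        let ?s = "Meet {\<alpha>. \<exists>Q. (\<alpha>, Q) \<in># A \<and> conv ext Q}"
        let ?good = "\<lambda>c. \<exists>ds. list_all2 (\<lambda>d M. \<forall>b\<ge>d. conv ext (tau b M)) ds Ms \<and> ?s \<le> arrs arr ds c"
        have "\<exists>T. finite T \<and> Meet T \<le> b \<and> (\<forall>c\<in>T. c \<noteq> top \<longrightarrow> ?good c)" if b: "b \<in> ?B" for b
        proof -
          from P(1)[OF b, unfolded TSum] obtain P\<^sub>0 Ls where
            P\<^sub>0: "P b = foldl App P\<^sub>0 Ls" "rel 0 P\<^sub>0 (TSum A)" "list_all2 (rel 0) Ls Ms" by (rule rel_spine)
          note cvb = P(2)[OF b, unfolded P\<^sub>0(1)]
          from P\<^sub>0(2) show ?thesis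
          proof cases
            case (rel_bareps \<beta>' \<beta>)
            from cv_const_spine[OF cvb[unfolded rel_bareps(1)]] obtain m T where
              mT: "m < n" "finite T" "Meet T \<le> b" and
              T: "\<And>c. c \<in> T \<Longrightarrow> \<exists>\<kappa>\<in>set [\<beta>]. \<exists>ds.
                list_all2 (\<lambda>d L. cv ext m (tau d L)) ds Ls \<and> \<kappa> \<le> arrs arr ds c" by blast
            have s: "?s \<le> \<beta>'"
              using rel_bareps by (cases "\<beta>' = top")
                (auto intro!: Meet_lower exI[of _ 0] simp: mem_bareps_iff conv_def cv_QProd_iff)
            have "?good c" if "c \<in> T" for c
            proof -
              from T[OF that] obtain ds where ds: "list_all2 (\<lambda>d L. cv ext m (tau d L)) ds Ls"
                "\<beta> \<le> arrs arr ds c" by auto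
              note s
              also note \<open>\<beta>' \<le> \<beta>\<close>
              also note ds(2)
              finally show ?thesis using IHs[OF mT(1) ds(1) P\<^sub>0(3)] by blast
            qed
            with mT show ?thesis by blast
          next
            case (rel_TSum Xs As)
            from cv_sel_spine[of n b "map fst As" Xs Ls] cvb rel_TSum obtain m T where
              mT: "m < n" "finite T" "Meet T \<le> b" and
              T: "\<And>c. c \<in> T \<Longrightarrow> c \<noteq> top \<Longrightarrow> \<exists>i<length (map fst As). \<exists>d es. map fst As ! i \<noteq> top \<and>
                d \<le> map fst As ! i \<and> cv ext m (tau d (Xs ! i)) \<and>
                list_all2 (\<lambda>e L. cv ext m (tau e L)) es Ls \<and> map fst As ! i \<le> arrs arr es c"
              by (auto simp del: nth_map)
            have "?good c" if c: "c \<in> T" "c \<noteq> top" for c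
            proof -
              from T[OF c] obtain i d es where i: "i < length As" "fst (As ! i) \<noteq> top"
                "d \<le> fst (As ! i)" "cv ext m (tau d (Xs ! i))"
                "list_all2 (\<lambda>e L. cv ext m (tau e L)) es Ls" "fst (As ! i) \<le> arrs arr es c"
                by (elim exE conjE) simp
              have "conv ext (snd (As ! i))"
                using rel_TSum(4)[OF i(1)] i by (intro IHc[OF mT(1)])
              then have "?s \<le> fst (As ! i)"
                using i(1) unfolding rel_TSum
                by (intro Meet_lower finite_sem_TSum CollectI exI[of _ "snd (As ! i)"]) simp
              also note i(6)
              finally show ?thesis using IHs[OF mT(1) i(5) P\<^sub>0(3)] by blast
            qed
            with mT show ?thesis by blast
          qed
        qed
        then have "\<forall>b\<in>?B. \<exists>T. finite T \<and> Meet T \<le> b \<and> (\<forall>c\<in>T. c \<noteq> top \<longrightarrow> ?good c)" by (rule ballI)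
        from bchoice[OF this] obtain T where
          T: "\<forall>b\<in>?B. finite (T b) \<and> Meet (T b) \<le> b \<and> (\<forall>c\<in>T b. c \<noteq> top \<longrightarrow> ?good c)" ..
        \<comment> \<open>The families found for the single members are pooled; each refines its
          member, so their union refines \<open>?B\<close> and hence b'.\<close>
        have finT: "finite (\<Union>b\<in>?B. T b)" using T fin by blast
        have "Meet (\<Union>b\<in>?B. T b) \<le> Meet ?B"
        proof -
          have "Meet (\<Union>b\<in>?B. T b) \<le> b" if "b \<in> ?B" for b
          proof -
            have "Meet (\<Union>b\<in>?B. T b) \<le> Meet (T b)" using that finT by (intro Meet_antimono) auto
            also have "\<dots> \<le> b" using T that by blast
            finally show ?thesis .
          qed
          then show ?thesis using le_Meet_iff[OF fin] by blast
        qed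
        also note le
        finally have leT: "Meet (\<Union>b\<in>?B. T b) \<le> b'" .
        show ?thesis
          unfolding TSum by (rule conv_TSum_spine[OF finT leT]) (use T in blast)
      qed
      then show ?thesis using b' by (simp add: tau_def)
    qed
  next
    fix X Q \<alpha> b
    assume code: "code 0 X Q \<alpha>" and b: "b \<noteq> top" and "cv ext n (tau b X)"
    then have cvX: "cv ext n (Tau b X)" by (simp add: tau_def)
    \<comment> \<open>The common end of the three cases. Because \<open>b \<noteq> top\<close>, the
      family has a member other than \<open>top\<close>, and one such member yields convergence of
      \<open>Q\<close>; the bound on \<alpha> uses all of them.\<close>
    have "conv ext Q \<and> \<alpha> \<le> b"
      if T: "finite T" "Meet T \<le> b" "\<And>c. c \<in> T \<Longrightarrow> c \<noteq> top \<Longrightarrow> conv ext Q \<and> \<alpha> \<le> c" for T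
    proof -
      from Meet_le_nontop[OF T(1,2) b] obtain c where "c \<in> T" "c \<noteq> top" by blast
      with T(3) have "conv ext Q" by blast
      moreover have "\<alpha> \<le> b" by (rule le_of_Meet_le[OF T(1,2)]) (use T(3) in blast)
      ultimately show ?thesis by blast
    qed
    note concl = this
    from code show "conv ext Q \<and> \<alpha> \<le> b"
    proof cases
      case (code_Tau P M \<beta>)
      have "cv ext n (Tau b (foldl App (const [arr \<beta> \<alpha>]) [P]))" using cvX code_Tau by simp
      from cv_const_spine[OF this] obtain m T where mT: "m < n" "finite T" "Meet T \<le> b" and
        T: "\<And>c. c \<in> T \<Longrightarrow> \<exists>\<kappa>\<in>set [arr \<beta> \<alpha>]. \<exists>ds.
          list_all2 (\<lambda>d L. cv ext m (tau d L)) ds [P] \<and> \<kappa> \<le> arrs arr ds c" by blast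
      show ?thesis
      proof (rule concl[OF mT(2,3)])
        fix c assume c: "c \<in> T" "c \<noteq> top"
        from T[OF c(1)] obtain d where d: "cv ext m (tau d P)" "arr \<beta> \<alpha> \<le> arr d c"
          by (auto simp: list_all2_Cons2)
        with c(2) have "d \<le> \<beta>" "\<alpha> \<le> c" by (auto simp: arr_le_arr_iff)
        with IH1[OF mT(1) code_Tau(3) d(1), of \<beta>] code_Tau show "conv ext Q \<and> \<alpha> \<le> c"
          by (simp add: tau_def)
      qed
    next
      case (code_QProd Xs Qs)
      from cv_const_spine[OF cvX[unfolded code_QProd(1) prod_const_def]] obtain m T where
        mT: "m < n" "finite T" "Meet T \<le> b" and
        T: "\<And>c. c \<in> T \<Longrightarrow> \<exists>\<kappa>\<in>set [arrs arr (replicate (length Qs) \<alpha>) \<alpha>]. \<exists>ds.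
          list_all2 (\<lambda>d L. cv ext m (tau d L)) ds Xs \<and> \<kappa> \<le> arrs arr ds c" by blast
      show ?thesis
      proof (rule concl[OF mT(2,3)])
        fix c assume c: "c \<in> T" "c \<noteq> top"
        from T[OF c(1)] obtain ds where ds: "list_all2 (\<lambda>d L. cv ext m (tau d L)) ds Xs"
          "arrs arr (replicate (length Qs) \<alpha>) \<alpha> \<le> arrs arr ds c" by auto
        have len: "length ds = length Qs" using ds(1) code_QProd by (simp add: list_all2_lengthD)
        with arrs_le_arrs[OF _ c(2) ds(2)] have le: "list_all2 (\<le>) ds (replicate (length Qs) \<alpha>)" "\<alpha> \<le> c"
          by auto
        have \<alpha>: "\<alpha> \<noteq> top" using le(2) c(2) by (auto simp: top_unique)
        have "conv ext (Qs ! i)" if i: "i < length Qs" for i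
        proof (rule IHc[OF mT(1) code_QProd(4)[OF i] _ \<alpha>])
          show "ds ! i \<le> \<alpha>" using le(1) i by (auto simp: list_all2_conv_all_nth)
          show "cv ext m (tau (ds ! i) (Xs ! i))"
            using ds(1) i len by (auto simp: list_all2_conv_all_nth)
        qed
        then have "conv ext Q"
          unfolding code_QProd by (intro conv_QProd) (auto simp: in_set_conv_nth)
        with le(2) show "conv ext Q \<and> \<alpha> \<le> c" by blast
      qed
    next
      case (code_QSum Xs Qs)
      have cvX': "cv ext n (Tau b (foldl App (sel (replicate (length Qs) \<alpha>)) (Xs @ [])))"
        using cvX code_QSum by simp
      have len: "length Xs = length (replicate (length Qs) \<alpha>)" using code_QSum by simp
      from cv_sel_spine[OF cvX' len] obtain m T where
        mT: "m < n" "finite T" "Meet T \<le> b" and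
        T: "\<And>c. c \<in> T \<Longrightarrow> c \<noteq> top \<Longrightarrow> \<exists>i<length (replicate (length Qs) \<alpha>). \<exists>d es.
          replicate (length Qs) \<alpha> ! i \<noteq> top \<and> d \<le> replicate (length Qs) \<alpha> ! i \<and>
          cv ext m (tau d (Xs ! i)) \<and> list_all2 (\<lambda>e L. cv ext m (tau e L)) es [] \<and>
          replicate (length Qs) \<alpha> ! i \<le> arrs arr es c" by blast
      show ?thesis
      proof (rule concl[OF mT(2,3)])
        fix c assume c: "c \<in> T" "c \<noteq> top"
        from T[OF c] obtain i d where i: "i < length Qs" "\<alpha> \<noteq> top" "d \<le> \<alpha>"
          "cv ext m (tau d (Xs ! i))" "\<alpha> \<le> c" by auto
        have "conv ext (Qs ! i)" by (rule IHc[OF mT(1) code_QSum(4)[OF i(1)] i(3,2,4)])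
        then have "conv ext Q"
          unfolding code_QSum using i(1) by (intro conv_QSum[of "Qs ! i"]) simp_all
        with i(5) show "conv ext Q \<and> \<alpha> \<le> c" by blast
      qed
    qed
  qed
qed

section \<open>From convergence under a test to convergence of terms\<close>

lemma conv_TSum_converges:
  assumes "conv ext (Tau b (foldl App (TSum A) Ms))" "b \<noteq> top" "foldl App (TSum A) Ms \<in> Terms"
  shows "converges_trm ext (foldl App (TSum A) Ms)"
  using assms
proof (induction Ms arbitrary: A)
  case Nil
  then obtain n where "cv ext n (Tau b (foldl App (TSum A) []))" by (auto simp: conv_def)
  from cv_TSum_spine[OF this] obtain m T where T: "finite T" "Meet T \<le> b"
    "\<forall>c\<in>T. \<exists>\<alpha> Q ds. (\<alpha>, Q) \<in># A \<and> cv ext m Q \<and>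
     list_all2 (\<lambda>d L. cv ext m (tau d L)) ds [] \<and> \<alpha> \<le> arrs arr ds c" by blast
  \<comment> \<open>Since b is not \<open>top\<close>, at least one summand was selected, and its
    test converges.\<close>
  from Meet_le_nontop[OF T(1,2) Nil(2)] obtain c where "c \<in> T" by blast
  with T(3) obtain \<alpha> Q where Q: "(\<alpha>, Q) \<in># A" "cv ext m Q" by blast
  then obtain B where "A = add_mset (\<alpha>, Q) B" by (meson multi_member_split)
  with Q Nil(3) show ?case by (auto simp: Terms_simps intro!: cv_converges_TSum)
next
  case (Cons M Ms)
  let ?N = "foldl App (TSum (sum_app ext A M)) Ms"
  have whd: "whd ext (foldl App (TSum A) (M # Ms)) ?N"
    by (simp add: whd_foldl whd_sum)
  from Cons.prems(1) obtain n where "cv ext n (Tau b (foldl App (TSum A) (M # Ms)))"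
    by (auto simp: conv_def)
  from cv_whd[OF this whd] have "conv ext (Tau b ?N)" by (auto simp: conv_def)
  with Cons.IH Cons.prems(2) whd_Terms[OF whd Cons.prems(3)] have "converges_trm ext ?N" by blast
  then show ?case
    unfolding converges_trm_def using whd_hred[OF whd] by (blast intro: converse_rtranclp_into_rtranclp)
qed

lemma converges_Lam:
  assumes "converges_trm ext M" shows "converges_trm ext (Lam M)"
proof -
  from assms obtain N where N: "(hred_trm ext)\<^sup>*\<^sup>* M N" "mhnf_trm N" by (auto simp: converges_trm_def)
  from N(1) have "(hred_trm ext)\<^sup>*\<^sup>* (Lam M) (Lam N)"
    by (induction rule: rtranclp_induct) (auto intro: hred_trm_hred_tst.intros(2) rtranclp.rtrancl_into_rtrancl)
  moreover have "mhnf_trm (Lam N)"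
    using N(2) unfolding mhnf_trm_def
  proof (elim disjE exE conjE)
    fix n y Ms assume "N = (Lam ^^ n) (foldl App (Var y) Ms)"
    then show "(\<exists>n y Ms. Lam N = (Lam ^^ n) (foldl App (Var y) Ms)) \<or>
      (\<exists>n \<alpha> Q B. Lam N = (Lam ^^ n) (TSum ({#(\<alpha>, Q)#} + B)) \<and> \<alpha> \<noteq> top \<and> hn_prod Q)"
      by (intro disjI1 exI[of _ "Suc n"] exI[of _ y] exI[of _ Ms]) simp
  next
    fix n \<alpha> Q B assume "N = (Lam ^^ n) (TSum ({#(\<alpha>, Q)#} + B))" "\<alpha> \<noteq> top" "hn_prod Q"
    then show "(\<exists>n y Ms. Lam N = (Lam ^^ n) (foldl App (Var y) Ms)) \<or>
      (\<exists>n \<alpha> Q B. Lam N = (Lam ^^ n) (TSum ({#(\<alpha>, Q)#} + B)) \<and> \<alpha> \<noteq> top \<and> hn_prod Q)"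
      by (intro disjI2 exI[of _ "Suc n"] exI[of _ \<alpha>] exI[of _ Q] exI[of _ B]) simp
  qed
  ultimately show ?thesis by (auto simp: converges_trm_def)
qed

text \<open>A test \<open>Tau\<close> of an abstraction replaces the bound variable by bar-epsilons,
  whereas head reduction of a term enters the abstraction and keeps the variable. Hence the
  induction of its own: a pair of \<open>ext b\<close> with codomain other than \<open>top\<close>
  instantiates the body of \<open>P\<close>, the body of \<open>M\<close> stays as it is, and
  \<open>rel_subst_left\<close> keeps them related.\<close>

lemma simulation_trm:
  "rel 0 P M \<Longrightarrow> b \<noteq> top \<Longrightarrow> cv ext n (tau b P) \<Longrightarrow> M \<in> Terms \<Longrightarrow> converges_trm ext M"
proof (induction n arbitrary: P M b rule: less_induct)
  case (less n)
  have cv: "cv ext n (Tau b P)" using less.prems by (simp add: tau_def)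
  show ?case
  proof (cases M rule: spine_cases)
    case (Var i Ms)
    then have "mhnf_trm M"
      unfolding mhnf_trm_def by (intro disjI1 exI[of _ 0] exI[of _ i] exI[of _ Ms]) simp
    then show ?thesis by (auto simp: converges_trm_def)
  next
    case (Lam L)
    with less.prems(1) obtain P' where P': "P = Lam P'" "rel (Suc 0) P' L"
      by (auto elim: rel_LamE)
    from cv[unfolded P'(1)] obtain m where m: "n = Suc m"
      "\<And>\<beta> \<gamma>. (\<beta>, \<gamma>) \<in> ext b \<Longrightarrow> cv ext m (tau \<gamma> (subst_trm P' 0 (const [\<beta>])))" by (rule cv_Lam) blast
    from ext_nontop[OF less.prems(2)] obtain \<beta> \<gamma> where bg: "(\<beta>, \<gamma>) \<in> ext b" "\<gamma> \<noteq> top" by blast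
    have "converges_trm ext L"
      using less.IH[OF _ rel_subst_left[OF P'(2)] bg(2) m(2)[OF bg(1)]] m(1) less.prems(4)
      by (simp add: Lam Terms_simps)
    then show ?thesis unfolding Lam by (rule converges_Lam)
  next
    case (beta L N Ms)
    let ?M = "foldl App (subst_trm L 0 N) Ms"
    have whd: "whd ext M ?M" unfolding beta by (intro whd_foldl whd_beta)
    from less.prems(1)[unfolded beta] obtain P' where P': "whd ext P P'" "rel 0 P' ?M"
      by (rule rel_whd_beta)
    from cv_whd[OF cv P'(1)] obtain m where "n = Suc m" "cv ext m (Tau b P')" .
    with less.IH[of m P' ?M b] P'(2) less.prems(2) whd_Terms[OF whd less.prems(4)]
    have "converges_trm ext ?M" by (simp add: tau_def)
    then show ?thesis
      unfolding converges_trm_def using whd_hred[OF whd] by (blast intro: converse_rtranclp_into_rtranclp)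
  next
    case (TSum A Ms)
    have "conv ext (tau b M)"
      using conjunct1[OF simulation, rule_format, of "{b}" M n b] less.prems by auto
    with less.prems(2,4) show ?thesis
      unfolding TSum by (intro conv_TSum_converges) (simp_all add: tau_def)
  qed
qed

end

section \<open>Open coded terms\<close>

lemma image_mset_map_prod_cong:
  "(\<And>\<alpha> Q. (\<alpha>, Q) \<in># A \<Longrightarrow> f Q = g Q) \<Longrightarrow> image_mset (map_prod id f) A = image_mset (map_prod id g) A"
  by (intro image_mset_cong) auto

lemma image_mset_map_prod_comp:
  "image_mset (map_prod id f) (image_mset (map_prod id g) A) = image_mset (map_prod id (\<lambda>Q. f (g Q))) A"
  by (induction A) auto

lemma lift_lift:
  fixes M :: "'d trm" and Q :: "'d tst"
  shows "\<forall>i j. i \<le> j \<longrightarrow> lift_trm (lift_trm M j) i = lift_trm (lift_trm M i) (Suc j)"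
    and "\<forall>i j. i \<le> j \<longrightarrow> lift_tst (lift_tst Q j) i = lift_tst (lift_tst Q i) (Suc j)"
proof (induction M and Q)
  case (TSum A)
  have "lift_tst (lift_tst Q j) i = lift_tst (lift_tst Q i) (Suc j)"
    if "(\<alpha>, Q) \<in># A" "i \<le> j" for \<alpha> Q i j
    using TSum[OF that(1), of Q] that(2) by simp
  then have "image_mset (map_prod id (\<lambda>Q. lift_tst (lift_tst Q j) i)) A =
      image_mset (map_prod id (\<lambda>Q. lift_tst (lift_tst Q i) (Suc j))) A" if "i \<le> j" for i j
    using that by (intro image_mset_map_prod_cong)
  then show ?case
    by (simp add: image_mset_map_prod_comp)
qed (simp_all add: multiset.map_comp comp_def cong: image_mset_cong)

lemma subst_lift:
  fixes M :: "'d trm" and Q :: "'d tst"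
  shows "\<forall>k N. subst_trm (lift_trm M k) k N = M"
    and "\<forall>k N. subst_tst (lift_tst Q k) k N = Q"
proof (induction M and Q)
  case (TSum A)
  have "image_mset (map_prod id (\<lambda>Q. subst_tst (lift_tst Q k) k N)) A = A" for k N
  proof -
    have "subst_tst (lift_tst Q k) k N = Q" if "(\<alpha>, Q) \<in># A" for \<alpha> Q
      using TSum[OF that, of Q] by simp
    then have "image_mset (map_prod id (\<lambda>Q. subst_tst (lift_tst Q k) k N)) A = image_mset (\<lambda>p. p) A"
      by (intro image_mset_cong) auto
    then show ?thesis by simp
  qed
  then show ?case
    by (simp add: image_mset_map_prod_comp)
qed (simp_all add: multiset.map_comp comp_def cong: image_mset_cong)

lemma subst_lift_commute:
  fixes M :: "'d trm" and Q :: "'d tst"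
  shows "\<forall>j k N. j \<le> k \<longrightarrow>
      subst_trm (lift_trm M j) (Suc k) (lift_trm N j) = lift_trm (subst_trm M k N) j"
    and "\<forall>j k N. j \<le> k \<longrightarrow>
      subst_tst (lift_tst Q j) (Suc k) (lift_trm N j) = lift_tst (subst_tst Q k N) j"
proof (induction M and Q)
  case (Var i)
  then show ?case by auto
next
  case (Lam M)
  have "lift_trm (lift_trm N j) 0 = lift_trm (lift_trm N 0) (Suc j)" for N :: "'d trm" and j
    using lift_lift(1) by blast
  with Lam show ?case by simp
next
  case (TSum A)
  have "subst_tst (lift_tst Q j) (Suc k) (lift_trm N j) = lift_tst (subst_tst Q k N) j"
    if "(\<alpha>, Q) \<in># A" "j \<le> k" for \<alpha> Q j k N
    using TSum[OF that(1), of Q] that(2) by simp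
  then have "image_mset (map_prod id (\<lambda>Q. subst_tst (lift_tst Q j) (Suc k) (lift_trm N j))) A =
      image_mset (map_prod id (\<lambda>Q. lift_tst (subst_tst Q k N) j)) A" if "j \<le> k" for j k N
    using that by (intro image_mset_map_prod_cong)
  then show ?case
    by (simp add: image_mset_map_prod_comp)
qed (simp_all add: multiset.map_comp comp_def cong: image_mset_cong)

text \<open>Adequacy instantiates all free variables of a code at once by realizers. A separate
  syntax, in which sums occur only as lists of bar-epsilon indices, allows this parallel
  instantiation to be defined without tests and multisets.\<close>

datatype 'd coded = CVar nat | CLam "'d coded" | CApp "'d coded" "'d coded" | CConst "'d list"

definition up :: "(nat \<Rightarrow> 'd trm) \<Rightarrow> nat \<Rightarrow> 'd trm" where
  "up \<sigma> = case_nat (Var 0) (\<lambda>i. lift_trm (\<sigma> i) 0)"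

primrec inst :: "'d::bounded_semilattice_inf_top coded \<Rightarrow> (nat \<Rightarrow> 'd trm) \<Rightarrow> 'd trm" where
  "inst (CVar i) \<sigma> = \<sigma> i"
| "inst (CLam t) \<sigma> = Lam (inst t (up \<sigma>))"
| "inst (CApp t u) \<sigma> = App (inst t \<sigma>) (inst u \<sigma>)"
| "inst (CConst \<kappa>s) \<sigma> = const \<kappa>s"

lemma inst_foldl: "inst (foldl CApp t us) \<sigma> = foldl App (inst t \<sigma>) (map (\<lambda>u. inst u \<sigma>) us)"
  by (induction us arbitrary: t) simp_all

lemma up_Terms: "(\<And>i. \<sigma> i \<in> Terms) \<Longrightarrow> up \<sigma> i \<in> Terms"
  by (cases i) (simp_all add: up_def Terms_simps lift_Terms)

lemma inst_Terms: "(\<And>i. \<sigma> i \<in> Terms) \<Longrightarrow> inst t \<sigma> \<in> Terms"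
  by (induction t arbitrary: \<sigma>) (simp_all add: Terms_simps const_Terms up_Terms)

lemma subst_inst:
  "(\<And>i. subst_trm (\<sigma> i) k N = \<rho> i) \<Longrightarrow> subst_trm (inst t \<sigma>) k N = inst t \<rho>"
proof (induction t arbitrary: \<sigma> \<rho> k N)
  case (CLam t)
  have "subst_trm (up \<sigma> i) (Suc k) (lift_trm N 0) = up \<rho> i" for i
    using CLam.prems by (cases i) (simp_all add: up_def subst_lift_commute)
  then have "subst_trm (inst t (up \<sigma>)) (Suc k) (lift_trm N 0) = inst t (up \<rho>)" by (rule CLam.IH)
  then show ?case by simp
qed simp_all

text \<open>Contracting an instance of \<open>CLam\<close> thus gives an instance again, with the
  argument, possibly open, as the value of the new variable.\<close>

lemma subst_inst_up: "subst_trm (inst t (up \<sigma>)) 0 N = inst t (case_nat N \<sigma>)"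
  by (rule subst_inst) (simp add: up_def subst_lift split: nat.split)

section \<open>A realizer yields sensibility\<close>

locale realizer = defim arr ext
  for arr :: "'d::bounded_semilattice_inf_top \<Rightarrow> 'd \<Rightarrow> 'd" and ext +
  fixes R :: "'d \<Rightarrow> 'd trm set"
  assumes S_realizer: "S_realizer arr ext R"
begin

lemma R_Terms: "M \<in> R \<alpha> \<Longrightarrow> M \<in> Terms"
  using S_realizer unfolding S_realizer_def saturated_def by blast

lemma R_expand: "red_trm ext M N \<Longrightarrow> M \<in> Terms \<Longrightarrow> N \<in> R \<alpha> \<Longrightarrow> M \<in> R \<alpha>"
  using S_realizer unfolding S_realizer_def saturated_def by blast

lemma R_inf: "R (inf \<alpha> \<beta>) = R \<alpha> \<inter> R \<beta>"
  and R_arr: "R (arr \<alpha> \<beta>) = fun_space (R \<alpha>) (R \<beta>)"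
  and R_top: "R top = Terms"
  and R_neg: "\<alpha> \<noteq> top \<Longrightarrow> N_neg \<alpha> \<subseteq> R \<alpha>"
  and R_pos: "\<alpha> \<noteq> top \<Longrightarrow> R \<alpha> \<subseteq> N_pos ext \<alpha>"
  using S_realizer unfolding S_realizer_def by blast+

lemma R_mono: assumes "\<alpha> \<le> \<beta>" "M \<in> R \<alpha>" shows "M \<in> R \<beta>"
proof -
  have "inf \<alpha> \<beta> = \<alpha>" using assms(1) by (rule inf_absorb1)
  with R_inf[of \<alpha> \<beta>] have "R \<alpha> = R \<alpha> \<inter> R \<beta>" by argo
  then have "R \<alpha> \<subseteq> R \<beta>" by (rule inf.orderI)
  with assms(2) show ?thesis by (rule subsetD[rotated])
qed

lemma R_Meet: "finite S \<Longrightarrow> M \<in> Terms \<Longrightarrow> (\<And>\<alpha>. \<alpha> \<in> S \<Longrightarrow> M \<in> R \<alpha>) \<Longrightarrow> M \<in> R (Meet S)"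
  by (induction S rule: finite_induct) (simp_all add: R_top R_inf)

lemma R_App: "M \<in> R (arr \<alpha> \<beta>) \<Longrightarrow> N \<in> R \<alpha> \<Longrightarrow> App M N \<in> R \<beta>"
  by (simp add: R_arr fun_space_def)

lemma R_foldl_App:
  "list_all2 (\<lambda>\<delta> X. X \<in> R \<delta>) \<delta>s Xs \<Longrightarrow> M \<in> R (arrs arr \<delta>s \<gamma>) \<Longrightarrow> foldl App M Xs \<in> R \<gamma>"
  by (induction \<delta>s Xs arbitrary: M rule: list_all2_induct) (auto intro: R_App)

text \<open>The other indices in the list only lower the meet, so \<open>N_neg\<close> applies with
  the empty sum as the remaining term.\<close>

lemma R_const:
  assumes "\<kappa> \<in> set \<kappa>s" shows "const \<kappa>s \<in> R \<kappa>"
proof (cases "\<kappa> = top")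
  case True
  then show ?thesis by (simp add: R_top const_Terms)
next
  case False
  have "const \<kappa>s = TSum ((\<Sum>\<kappa>\<in>#mset \<kappa>s. bareps \<kappa>) + {#})" by (simp add: const_def)
  moreover have "Meet (set_mset (mset \<kappa>s)) \<le> \<kappa>" using assms by (intro Meet_lower) simp_all
  moreover have "TSum {#} \<in> (Terms :: 'd trm set)" by (simp add: Terms_simps)
  ultimately have "const \<kappa>s \<in> N_neg \<kappa>" unfolding N_neg_def by blast
  with R_neg[OF False] show ?thesis by blast
qed

section \<open>Adequacy of the coding\<close>

definition realizes :: "(nat \<Rightarrow> 'd trm) \<Rightarrow> 'd list \<Rightarrow> bool" where
  "realizes \<sigma> as \<longleftrightarrow> (\<forall>i<length as. \<sigma> i \<in> R (as ! i)) \<and> (\<forall>i. \<sigma> i \<in> Terms)"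

text \<open>One code has to serve two ends: its instances simulate \<open>M\<close>, and they
  realize the types of \<open>M\<close>. The number k of variables left in place is arbitrary so
  that the first half passes under abstractions.\<close>

definition coding :: "'d coded \<Rightarrow> 'd trm \<Rightarrow> bool" where
  "coding t M \<longleftrightarrow> (\<forall>k \<sigma>. (\<forall>i<k. \<sigma> i = Var i) \<longrightarrow> rel k (inst t \<sigma>) M) \<and>
     (\<forall>as \<beta> \<sigma>. (as, \<beta>) \<in> sem_trm arr M (length as) \<longrightarrow> realizes \<sigma> as \<longrightarrow> inst t \<sigma> \<in> R \<beta>)"

definition coding_tst :: "'d coded \<Rightarrow> 'd tst \<Rightarrow> 'd \<Rightarrow> bool" where
  "coding_tst t Q \<alpha> \<longleftrightarrow> (\<forall>k \<sigma>. (\<forall>i<k. \<sigma> i = Var i) \<longrightarrow> code k (inst t \<sigma>) Q \<alpha>) \<and>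
     (\<forall>as \<sigma>. as \<in> sem_tst arr Q (length as) \<longrightarrow> realizes \<sigma> as \<longrightarrow> inst t \<sigma> \<in> R \<alpha>)"

lemma realizes_inst: "realizes \<sigma> as \<Longrightarrow> inst t \<sigma> \<in> Terms"
  by (simp add: realizes_def inst_Terms)

definition csel :: "'d list \<Rightarrow> 'd coded" where
  "csel \<alpha>s = CConst (map (sel_type \<alpha>s) [0..<length \<alpha>s])"

lemma inst_csel [simp]: "inst (csel \<alpha>s) \<sigma> = sel \<alpha>s"
  by (simp add: csel_def sel_def)

text \<open>The selector has the type that looks at argument i alone; all other arguments are used
  at \<open>top\<close>, where being a term suffices.\<close>

lemma R_sel:
  assumes "length Xs = length \<alpha>s" "\<forall>X\<in>set Xs. X \<in> Terms" "i < length \<alpha>s" "Xs ! i \<in> R (\<alpha>s ! i)"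
  shows "foldl App (sel \<alpha>s) Xs \<in> R (\<alpha>s ! i)"
proof (rule R_foldl_App)
  show "list_all2 (\<lambda>\<delta> X. X \<in> R \<delta>) ((replicate (length \<alpha>s) top)[i := \<alpha>s ! i]) Xs"
    using assms by (auto simp: list_all2_conv_all_nth nth_list_update R_top)
  have "sel \<alpha>s \<in> R (sel_type \<alpha>s i)"
    unfolding sel_def using assms(3) by (intro R_const) auto
  then show "sel \<alpha>s \<in> R (arrs arr ((replicate (length \<alpha>s) top)[i := \<alpha>s ! i]) (\<alpha>s ! i))"
    by (simp add: sel_type_def)
qed

text \<open>Tests are coded at a variable result type, which is the index of the summand in which
  the test occurs and is handed down through sums and products. Each case builds the code from the
  codes of the components and the matching constant.\<close>

lemma coding_exists:
  fixes M :: "'d trm" and Q :: "'d tst"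
  shows "M \<in> Terms \<longrightarrow> (\<exists>t. coding t M)"
    and "Q \<in> Tests \<longrightarrow> (\<forall>\<alpha>. \<alpha> \<noteq> top \<longrightarrow> (\<exists>t. coding_tst t Q \<alpha>))"
proof (induction M and Q)
  case (Var i)
  have "coding (CVar i) (Var i)"
    unfolding coding_def
  proof (intro conjI allI impI)
    show "rel k (inst (CVar i) \<sigma>) (Var i)" if "\<forall>i<k. \<sigma> i = Var i" for k \<sigma>
      using that by (cases "i < k") (auto intro: rel_code.intros)
    show "inst (CVar i) \<sigma> \<in> R \<beta>"
      if "(as, \<beta>) \<in> sem_trm arr (Var i) (length as)" "realizes \<sigma> as" for as \<beta> \<sigma>
      using that R_mono by (auto simp: realizes_def)
  qed
  then show ?case by blast
next
  case (Lam M)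
  show ?case
  proof
    assume "Lam M \<in> Terms"
    with Lam obtain t where t: "coding t M" by (auto simp: Terms_simps)
    have "coding (CLam t) (Lam M)"
      unfolding coding_def
    proof (intro conjI allI impI)
      fix k \<sigma> assume "\<forall>i<k. \<sigma> i = (Var i :: 'd trm)"
      then have "\<forall>i<Suc k. up \<sigma> i = Var i" by (auto simp: up_def split: nat.split)
      with t show "rel k (inst (CLam t) \<sigma>) (Lam M)"
        by (auto simp: coding_def intro: rel_Lam)
    next
      fix as \<beta> \<sigma> assume as: "(as, \<beta>) \<in> sem_trm arr (Lam M) (length as)" "realizes \<sigma> as"
      then obtain P where P: "finite P" "\<beta> = arrows arr P"
        "\<And>b c. (b, c) \<in> P \<Longrightarrow> (b # as, c) \<in> sem_trm arr M (Suc (length as))"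
        unfolding sem_Lam_iff by blast
      have T: "inst (CLam t) \<sigma> \<in> Terms" using as(2) by (rule realizes_inst)
      have "inst (CLam t) \<sigma> \<in> R (arr b c)" if bc: "(b, c) \<in> P" for b c
      proof -
        \<comment> \<open>Membership in the function space is checked on an arbitrary realizer
          \<open>L\<close>. The beta contractum is an instance of \<open>t\<close> with
          \<open>L\<close> as value of the bound variable, and saturation leads back to the
          redex.\<close>
        have "App (inst (CLam t) \<sigma>) L \<in> R c" if L: "L \<in> R b" for L
        proof (rule R_expand)
          show "red_trm ext (App (inst (CLam t) \<sigma>) L) (inst t (case_nat L \<sigma>))"
            unfolding inst.simps subst_inst_up[symmetric]
            by (intro red_trm_red_tst.intros(1) rule_trm.beta)
          show "App (inst (CLam t) \<sigma>) L \<in> Terms" using T L R_Terms by (simp only: Terms_simps)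
          have "realizes (case_nat L \<sigma>) (b # as)"
            using as(2) L R_Terms by (auto simp: realizes_def nth_Cons' split: nat.split)
          moreover have "(b # as, c) \<in> sem_trm arr M (length (b # as))" using P(3)[OF bc] by simp
          ultimately show "inst t (case_nat L \<sigma>) \<in> R c"
            using t unfolding coding_def by blast
        qed
        with T show ?thesis by (auto simp: R_arr fun_space_def)
      qed
      then show "inst (CLam t) \<sigma> \<in> R \<beta>"
        unfolding P(2) arrows_def using P(1) T by (intro R_Meet) auto
    qed
    then show "\<exists>t. coding t (Lam M)" by blast
  qed
next
  case (App M N)
  show ?case
  proof
    assume "App M N \<in> Terms"
    with App obtain t u where tu: "coding t M" "coding u N" by (auto simp: Terms_simps)
    have "coding (CApp t u) (App M N)"
      unfolding coding_def
    proof (intro conjI allI impI)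
      show "rel k (inst (CApp t u) \<sigma>) (App M N)" if "\<forall>i<k. \<sigma> i = (Var i :: 'd trm)" for k \<sigma>
        using tu that by (auto simp: coding_def intro: rel_App)
    next
      fix as \<beta> \<sigma> assume as: "(as, \<beta>) \<in> sem_trm arr (App M N) (length as)" "realizes \<sigma> as"
      then obtain P where P: "finite P" "\<beta> = Meet (snd ` P)"
        "(as, arrows arr P) \<in> sem_trm arr M (length as)" "(as, Meet (fst ` P)) \<in> sem_trm arr N (length as)"
        unfolding sem_App_iff by blast
      from P(3,4) as(2) tu have t: "inst t \<sigma> \<in> R (arrows arr P)" "inst u \<sigma> \<in> R (Meet (fst ` P))"
        unfolding coding_def by blast+
      have "inst (CApp t u) \<sigma> \<in> R c" if "(b, c) \<in> P" for b c
      proof -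
        have "inst t \<sigma> \<in> R (arr b c)" by (rule R_mono[OF arrows_lower[OF P(1) that] t(1)])
        moreover have "inst u \<sigma> \<in> R b"
          using P(1) that by (intro R_mono[OF _ t(2)] Meet_lower) force+
        ultimately show ?thesis by (simp add: R_App)
      qed
      then show "inst (CApp t u) \<sigma> \<in> R \<beta>"
        unfolding P(2) using P(1) realizes_inst[OF as(2)] by (intro R_Meet) (auto simp del: inst.simps)
    qed
    then show "\<exists>t. coding t (App M N)" by blast
  qed
next
  case (TSum A)
  show ?case
  proof
    assume A: "TSum A \<in> Terms"
    obtain As where As: "mset As = A" using ex_mset by blast
    have "\<exists>t. coding_tst t (snd p) (fst p)" if "p \<in> set As" for p
    proof -
      have "p \<in># A" using that As by auto
      with TSum[of p "snd p"] A show ?thesis by (cases p) (auto simp: Terms_simps)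
    qed
    then have "\<forall>p\<in>set As. \<exists>t. coding_tst t (snd p) (fst p)" by (rule ballI)
    from bchoice[OF this] obtain f where f: "\<forall>p\<in>set As. coding_tst (f p) (snd p) (fst p)" ..
    let ?t = "foldl CApp (csel (map fst As)) (map f As)"
    have inst: "inst ?t \<sigma> = foldl App (sel (map fst As)) (map (\<lambda>p. inst (f p) \<sigma>) As)" for \<sigma>
      by (simp add: inst_foldl comp_def)
    have "coding ?t (TSum A)"
      unfolding coding_def
    proof (intro conjI allI impI)
      show "rel k (inst ?t \<sigma>) (TSum A)" if "\<forall>i<k. \<sigma> i = (Var i :: 'd trm)" for k \<sigma>
        unfolding inst As[symmetric] using f that
        by (intro rel_TSum) (simp_all add: coding_tst_def)
    next
      fix as \<beta> \<sigma> assume as: "(as, \<beta>) \<in> sem_trm arr (TSum A) (length as)" "realizes \<sigma> as"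
      let ?S = "{\<alpha>. \<exists>Q. (\<alpha>, Q) \<in># A \<and> as \<in> sem_tst arr Q (length as)}"
      have "inst ?t \<sigma> \<in> R \<alpha>" if "\<alpha> \<in> ?S" for \<alpha>
      proof -
        from that obtain Q where "(\<alpha>, Q) \<in> set As" "as \<in> sem_tst arr Q (length as)"
          by (auto simp: As[symmetric])
        then obtain i where i: "i < length As" "As ! i = (\<alpha>, Q)" "as \<in> sem_tst arr Q (length as)"
          by (auto simp: in_set_conv_nth)
        have "coding_tst (f (As ! i)) (snd (As ! i)) (fst (As ! i))" using f i(1) by simp
        then have "inst (f (As ! i)) \<sigma> \<in> R \<alpha>"
          using i(2,3) as(2) by (simp add: coding_tst_def)
        then have "foldl App (sel (map fst As)) (map (\<lambda>p. inst (f p) \<sigma>) As) \<in> R (map fst As ! i)"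
          using i(1,2) realizes_inst[OF as(2)] by (intro R_sel) auto
        then show ?thesis using i(1,2) by (simp add: inst)
      qed
      then have "inst ?t \<sigma> \<in> R (Meet ?S)"
        using realizes_inst[OF as(2)] by (intro R_Meet finite_sem_TSum)
      then show "inst ?t \<sigma> \<in> R \<beta>"
        using as(1) R_mono unfolding sem_TSum_iff by blast
    qed
    then show "\<exists>t. coding t (TSum A)" by blast
  qed
next
  case (Tau \<beta> M)
  show ?case
  proof (intro impI allI)
    fix \<alpha> :: 'd assume M: "Tau \<beta> M \<in> Tests" and "\<alpha> \<noteq> top"
    with Tau obtain t where t: "coding t M" by (auto simp: Tests_simps)
    have "coding_tst (CApp (CConst [arr \<beta> \<alpha>]) t) (Tau \<beta> M) \<alpha>"
      unfolding coding_tst_def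
    proof (intro conjI allI impI)
      show "code k (inst (CApp (CConst [arr \<beta> \<alpha>]) t) \<sigma>) (Tau \<beta> M) \<alpha>"
        if "\<forall>i<k. \<sigma> i = (Var i :: 'd trm)" for k \<sigma>
        using t that M by (auto simp: coding_def Tests_simps intro: code_Tau)
      show "inst (CApp (CConst [arr \<beta> \<alpha>]) t) \<sigma> \<in> R \<alpha>"
        if "as \<in> sem_tst arr (Tau \<beta> M) (length as)" "realizes \<sigma> as" for as \<sigma>
        using t that R_App[OF R_const[of "arr \<beta> \<alpha>" "[arr \<beta> \<alpha>]"]] by (simp add: coding_def)
    qed
    then show "\<exists>t. coding_tst t (Tau \<beta> M) \<alpha>" by blast
  qed
next
  case (QSum A)
  show ?case
  proof (intro impI allI)
    fix \<alpha> :: 'd assume A: "QSum A \<in> Tests" and \<alpha>: "\<alpha> \<noteq> top"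
    obtain Qs where Qs: "mset Qs = A" using ex_mset by blast
    have "\<forall>Q\<in>set Qs. \<exists>t. coding_tst t Q \<alpha>"
      using QSum A \<alpha> by (auto simp: Tests_simps Qs[symmetric])
    from bchoice[OF this] obtain f where f: "\<forall>Q\<in>set Qs. coding_tst (f Q) Q \<alpha>" ..
    let ?t = "foldl CApp (csel (replicate (length Qs) \<alpha>)) (map f Qs)"
    have inst: "inst ?t \<sigma> = foldl App (sel (replicate (length Qs) \<alpha>)) (map (\<lambda>Q. inst (f Q) \<sigma>) Qs)" for \<sigma>
      by (simp add: inst_foldl comp_def)
    have "coding_tst ?t (QSum A) \<alpha>"
      unfolding coding_tst_def
    proof (intro conjI allI impI)
      show "code k (inst ?t \<sigma>) (QSum A) \<alpha>" if "\<forall>i<k. \<sigma> i = (Var i :: 'd trm)" for k \<sigma>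
        unfolding inst Qs[symmetric] using f that
        by (intro code_QSum) (simp_all add: coding_tst_def)
    next
      fix as \<sigma> assume as: "as \<in> sem_tst arr (QSum A) (length as)" "realizes \<sigma> as"
      then obtain i where i: "i < length Qs" "as \<in> sem_tst arr (Qs ! i) (length as)"
        by (auto simp: Qs[symmetric] in_set_conv_nth)
      have "coding_tst (f (Qs ! i)) (Qs ! i) \<alpha>" using f i(1) by simp
      then have "inst (f (Qs ! i)) \<sigma> \<in> R \<alpha>"
        using i(2) as(2) by (simp add: coding_tst_def)
      then have "foldl App (sel (replicate (length Qs) \<alpha>)) (map (\<lambda>Q. inst (f Q) \<sigma>) Qs)
          \<in> R (replicate (length Qs) \<alpha> ! i)"
        using i(1) realizes_inst[OF as(2)] by (intro R_sel) auto
      then show "inst ?t \<sigma> \<in> R \<alpha>" using i(1) by (simp add: inst)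
    qed
    then show "\<exists>t. coding_tst t (QSum A) \<alpha>" by blast
  qed
next
  case (QProd A)
  show ?case
  proof (intro impI allI)
    fix \<alpha> :: 'd assume A: "QProd A \<in> Tests" and \<alpha>: "\<alpha> \<noteq> top"
    obtain Qs where Qs: "mset Qs = A" using ex_mset by blast
    have "\<forall>Q\<in>set Qs. \<exists>t. coding_tst t Q \<alpha>"
      using QProd A \<alpha> by (auto simp: Tests_simps Qs[symmetric])
    from bchoice[OF this] obtain f where f: "\<forall>Q\<in>set Qs. coding_tst (f Q) Q \<alpha>" ..
    let ?\<kappa> = "arrs arr (replicate (length Qs) \<alpha>) \<alpha>"
    let ?t = "foldl CApp (CConst [?\<kappa>]) (map f Qs)"
    have inst: "inst ?t \<sigma> = foldl App (prod_const (length Qs) \<alpha>) (map (\<lambda>Q. inst (f Q) \<sigma>) Qs)" for \<sigma>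
      by (simp add: inst_foldl comp_def prod_const_def)
    have "coding_tst ?t (QProd A) \<alpha>"
      unfolding coding_tst_def
    proof (intro conjI allI impI)
      show "code k (inst ?t \<sigma>) (QProd A) \<alpha>" if "\<forall>i<k. \<sigma> i = (Var i :: 'd trm)" for k \<sigma>
        unfolding inst Qs[symmetric] using f that
        by (intro code_QProd) (simp_all add: coding_tst_def)
    next
      fix as \<sigma> assume as: "as \<in> sem_tst arr (QProd A) (length as)" "realizes \<sigma> as"
      show "inst ?t \<sigma> \<in> R \<alpha>"
        unfolding inst
      proof (rule R_foldl_App)
        have "inst (f Q) \<sigma> \<in> R \<alpha>" if "Q \<in> set Qs" for Q
          using as f that unfolding coding_tst_def by (auto simp: Qs[symmetric])
        then show "list_all2 (\<lambda>\<delta> X. X \<in> R \<delta>) (replicate (length Qs) \<alpha>) (map (\<lambda>Q. inst (f Q) \<sigma>) Qs)"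
          by (simp add: list_all2_conv_all_nth)
        show "prod_const (length Qs) \<alpha> \<in> R ?\<kappa>"
          unfolding prod_const_def by (rule R_const) simp
      qed
    qed
    then show "\<exists>t. coding_tst t (QProd A) \<alpha>" by blast
  qed
qed

text \<open>Variables of the environment become bar-epsilons, which realize their own index; beyond
  it the empty sum fills in.\<close>

definition closing :: "'d list \<Rightarrow> nat \<Rightarrow> 'd trm" where
  "closing as i = const (if i < length as then [as ! i] else [])"

lemma realizes_closing: "realizes (closing as) as"
  by (simp add: realizes_def closing_def R_const const_Terms)

lemma R_cv:
  assumes "P \<in> R \<alpha>" "\<alpha> \<noteq> top"
  obtains n where "cv ext n (tau \<alpha> P)"
proof -
  have "converges_tst ext (tau \<alpha> P)"
    using R_pos[OF assms(2)] assms(1) unfolding N_pos_def by blast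
  then show thesis using that by (rule converges_cv)
qed

text \<open>The instantiated code realizes \<beta>, so it converges under \<open>tau \<beta>\<close>
  by the bound \<open>N_pos\<close>, and the simulation hands this on to \<open>M\<close>. The
  variables of \<open>M\<close> remain, as \<open>rel 0\<close> treats them all as free.\<close>

lemma converges_trm_of_sem:
  assumes "M \<in> Terms" "(as, \<beta>) \<in> sem_trm arr M (length as)" "\<beta> \<noteq> top"
  shows "converges_trm ext M"
proof -
  from coding_exists(1) assms(1) obtain t where t: "coding t M" by blast
  let ?P = "inst t (closing as)"
  have "?P \<in> R \<beta>" using t assms(2) realizes_closing unfolding coding_def by blast
  then obtain n where n: "cv ext n (tau \<beta> ?P)" by (rule R_cv[OF _ assms(3)])
  have "rel 0 ?P M" using t unfolding coding_def by simp
  from simulation_trm[OF this assms(3) n assms(1)] show ?thesis .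
qed

text \<open>A test has no type of its own; any \<alpha> other than \<open>top\<close> can be the
  result type of its code and makes the code subject to \<open>N_pos\<close>.\<close>

lemma converges_tst_of_sem:
  assumes "Q \<in> Tests" "as \<in> sem_tst arr Q (length as)" "\<alpha> \<noteq> (top :: 'd)"
  shows "converges_tst ext Q"
proof -
  from coding_exists(2) assms(1,3) obtain t where t: "coding_tst t Q \<alpha>" by blast
  let ?X = "inst t (closing as)"
  have "?X \<in> R \<alpha>" using t assms(2) realizes_closing unfolding coding_tst_def by blast
  then obtain n where n: "cv ext n (tau \<alpha> ?X)" by (rule R_cv[OF _ assms(3)])
  have "code 0 ?X Q \<alpha>" using t unfolding coding_tst_def by simp
  with simulation[of n] n assms(3) have "conv ext Q" by blast
  then show ?thesis unfolding conv_def using cv_converges_tst assms(1) by blast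
qed

text \<open>The assumption excludes the one-element model. There \<open>Var 0\<close> converges
  although its only type is \<open>top\<close>, so sensibility fails, while the function with value
  \<open>Terms\<close> is a realizer.\<close>

lemma sensible:
  assumes nontrivial: "\<exists>\<alpha>::'d. \<alpha> \<noteq> top"
  shows "sensible arr ext"
  unfolding sensible_def
proof (intro conjI ballI allI impI)
  fix M :: "'d trm" and n assume M: "M \<in> Terms" "fv_trm M \<subseteq> {..<n}"
  show "\<not> converges_trm ext M \<longleftrightarrow> sem_trm arr M n = {(as, top) |as. length as = n}"
  proof
    assume *: "\<not> converges_trm ext M"
    have "\<beta> = top \<and> length as = n" if "(as, \<beta>) \<in> sem_trm arr M n" for as \<beta>
      using that * converges_trm_of_sem[OF M(1)] length_sem(1)[of M] by blast
    then show "sem_trm arr M n = {(as, top) |as. length as = n}"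
      using sem_top[OF M(2)] by auto
  next
    assume *: "sem_trm arr M n = {(as, top) |as. length as = n}"
    show "\<not> converges_trm ext M"
    proof
      assume "converges_trm ext M"
      then obtain N where N: "(hred_trm ext)\<^sup>*\<^sup>* M N" "mhnf_trm N" by (auto simp: converges_trm_def)
      from hreds_trm_expand[OF N(1) M(2)] sem_mhnf_trm[OF N(2) _ nontrivial]
      obtain as \<beta> where "(as, \<beta>) \<in> sem_trm arr M n" "\<beta> \<noteq> top" by blast
      with * show False by blast
    qed
  qed
next
  fix Q :: "'d tst" and n assume Q: "Q \<in> Tests" "fv_tst Q \<subseteq> {..<n}"
  obtain \<alpha> :: 'd where \<alpha>: "\<alpha> \<noteq> top" using nontrivial by blast
  show "\<not> converges_tst ext Q \<longleftrightarrow> sem_tst arr Q n = {}"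
  proof
    assume *: "\<not> converges_tst ext Q"
    show "sem_tst arr Q n = {}"
      using * converges_tst_of_sem[OF Q(1) _ \<alpha>] length_sem(2)[of Q] by blast
  next
    assume *: "sem_tst arr Q n = {}"
    show "\<not> converges_tst ext Q"
    proof
      assume "converges_tst ext Q"
      then obtain P where P: "(hred_tst ext)\<^sup>*\<^sup>* Q P" "mhnf_tst P" by (auto simp: converges_tst_def)
      from hreds_tst_expand[OF P(1) Q(2)] sem_mhnf_tst[OF P(2)] * show False by blast
    qed
  qed
qed

end

theorem mainTheorem9:
  fixes arr :: "'d::bounded_semilattice_inf_top \<Rightarrow> 'd \<Rightarrow> 'd"
    and ext :: "'d \<Rightarrow> ('d \<times> 'd) set"
  assumes "DEFiM arr ext"
    and nontrivial: "\<exists>\<alpha>::'d. \<alpha> \<noteq> top"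
  shows "sensible arr ext \<longleftrightarrow> (\<exists>R. S_realizer arr ext R)"
proof
  interpret defim arr ext by unfold_locales (fact assms(1))
  show "\<exists>R. S_realizer arr ext R" if "sensible arr ext"
    using S_realizer_sem_realizer[OF that] by blast
next
  assume "\<exists>R. S_realizer arr ext R"
  then obtain R where "S_realizer arr ext R" by blast
  then interpret realizer arr ext R
    using assms(1) by unfold_locales
  show "sensible arr ext" by (rule sensible[OF nontrivial])
qed

end
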